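(* Let $s\in\mathbb{C}$ with $0<\mathrm{Re}(s)<1$. For any integer $M\in\mathbb{N}$, as $n\to\infty$, $$\zeta(\Delta_n,s)=V_2(s)\Big(a(s)n^{2-2s}+\sum_{m=0}^{M-1}b_m(s)n^{-2m}\Big)+O(n^{-2M-2s+2}),$$ $$\zeta(\widetilde\Delta_n,s)=V_2(s)\Big(\widetilde a(s)n^{2-2s}+\sum_{m=0}^{M-1}\widetilde b_m(s)n^{-2m}\Big)+O(n^{-2M-2s+2}),$$ where $$a(s)=\int_0^\infty z^{3-2s}\int_0^1\!\!\int_0^1\Big(\frac{\sin^2(\pi x)}{\pi^2}+\frac{\sin^2(\pi y)}{\pi^2}+z^2\Big)^{-2}dx\,dy\,dz,$$ $$\widetilde a(s)=\int_0^\infty z^{3-2s}\int_0^1\!\!\int_0^1\Big(\frac{\sin^2(\pi x)}{\pi^2}+\frac{\sin^2(\pi y)}{\pi^2}-\frac{2}{3\pi^2}\sin^2(\pi x)\sin^2(\pi y)+z^2\Big)^{-2}dx\,dy\,dz,$$ and, with $\Phi_m(x,y,z):=\sum_{j=0}^m\frac{F_{m,j}(x,y)}{(x^2+y^2+z^2)^{2+j}}$, $$b_m(s)=\frac{4}{((2M+1)!)^2}\fint_0^\infty z^{3-2s}\int_0^\infty\!\!\int_0^\infty B_{2M+1}(x-[x])B_{2M+1}(y-[y])\,\partial_x^{2M+1}\partial_y^{2M+1}\Phi_m\,dx\,dy\,dz+\frac{8}{(2M+1)!}\fint_0^\infty z^{3-2s}\int_0^\infty\!\!\int_0^\infty B_{2M+1}(x-[x])\,\partial_x^{2M+1}\Phi_m\,dx\,dy\,dz;$$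 $\widetilde b_m(s)$ is given by the same formula with $F_{m,j}$ replaced by $\widetilde F_{m,j}$.
   Context: On $(\mathbb{Z}/n\mathbb{Z})^2$, the $5$-point star Laplacian $\Delta_n$ has eigenvalues $\lambda_{k}=\frac{n^2}{\pi^2}(\sin^2\frac{\pi k_1}{n}+\sin^2\frac{\pi k_2}{n})$ and the $9$-point star Laplacian $\widetilde\Delta_n$ has eigenvalues $\widetilde\lambda_k=\lambda_k-\frac{2n^2}{3\pi^2}\sin^2\frac{\pi k_1}{n}\sin^2\frac{\pi k_2}{n}$, $k_1,k_2\in\{0,\dots,n-1\}$ (with multiplicity). $\zeta(\Delta_n,s)=\sum_{k\neq(0,0)}\lambda_k^{-s}$, $\zeta(\widetilde\Delta_n,s)=\sum_{k\neq(0,0)}\widetilde\lambda_k^{-s}$. $V_2(s)=\frac{2\sin(\pi s)}{\pi}\frac{\Gamma(1-s)\Gamma(2)}{\Gamma(2-s)}$. $B_{2M+1}$ is the Bernoulli polynomial of degree $2M+1$, $[x]$ the integer part. Hadamard regularization: if $u(z)$ has, as $z\to0$ (resp. $\infty$), an asymptotic expansion in finitely many terms $c_{jk}z^{\beta_j}\log^kz$ plus a remainder $o(z^\beta)$ with $\mathrm{Re}\beta>0$ (resp. $<0$), $\mathrm{LIM}$ denotes the coefficient of $z^0\log^0z$; $\fint_0^\infty u\,dz:=\mathrm{LIM}_{\varepsilon\to0}\int_\varepsilon^1u\,dz+\mathrm{LIM}_{R\to\infty}\int_1^Ru\,dz$. Polynomials: for $\varepsilon\ge0$ let $S_\varepsilon(u)=\frac{\sin^2(\pi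 u\sqrt\varepsilon)}{\pi^2\varepsilon}$ ($S_0(u)=u^2$), entire in $\varepsilon$. For $z>0$ the Taylor coefficient of $\varepsilon^m$ at $\varepsilon=0$ of $(S_\varepsilon(x)+S_\varepsilon(y)+z^2)^{-2}$, respectively of $(S_\varepsilon(x)+S_\varepsilon(y)-\frac{2\pi^2}{3}\varepsilon S_\varepsilon(x)S_\varepsilon(y)+z^2)^{-2}$, is written uniquely as $\sum_{j=0}^mF_{m,j}(x,y)(x^2+y^2+z^2)^{-2-j}$, resp. $\sum_{j=0}^m\widetilde F_{m,j}(x,y)(x^2+y^2+z^2)^{-2-j}$, with $F_{m,j},\widetilde F_{m,j}$ symmetric polynomials homogeneous of degree $2m+2j$ (at $\varepsilon=n^{-2}$ these functions are $(\lambda+z^2)^{-2}$ evaluated at real arguments $k=(x,y)$). *)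

theory Defs
  imports "HOL-Analysis.Analysis" "HOL-Library.Landau_Symbols"
begin

text \<open>Eigenvalue of the 5-point star Laplacian for index (k1,k2).\<close>
definition lam5 :: "nat \<Rightarrow> nat \<Rightarrow> nat \<Rightarrow> real" where
  "lam5 n k1 k2 = (real n)^2 / pi^2 *
     ((sin (pi * real k1 / real n))^2 + (sin (pi * real k2 / real n))^2)"

text \<open>Eigenvalue of the 9-point star Laplacian for index (k1,k2).\<close>
definition lam9 :: "nat \<Rightarrow> nat \<Rightarrow> nat \<Rightarrow> real" where
  "lam9 n k1 k2 = lam5 n k1 k2 - 2 * (real n)^2 / (3 * pi^2) *
     (sin (pi * real k1 / real n))^2 * (sin (pi * real k2 / real n))^2"

definition zeta5 :: "nat \<Rightarrow> complex \<Rightarrow> complex" where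
  "zeta5 n s = (\<Sum>k\<in>({0..<n} \<times> {0..<n}) - {(0,0)}.
      (complex_of_real (lam5 n (fst k) (snd k))) powr (- s))"

definition zeta9 :: "nat \<Rightarrow> complex \<Rightarrow> complex" where
  "zeta9 n s = (\<Sum>k\<in>({0..<n} \<times> {0..<n}) - {(0,0)}.
      (complex_of_real (lam9 n (fst k) (snd k))) powr (- s))"

definition V2 :: "complex \<Rightarrow> complex" where
  "V2 s = 2 * sin (of_real pi * s) / of_real pi * (Gamma (1 - s) * Gamma 2 / Gamma (2 - s))"

fun bern_num :: "nat \<Rightarrow> real" where
  "bern_num 0 = 1"
| "bern_num (Suc n) = - (1 / real (n + 2)) * (\<Sum>k\<le>n. real ((n + 2) choose k) * bern_num k)"

definition bern_poly :: "nat \<Rightarrow> real \<Rightarrow> real" where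
  "bern_poly n x = (\<Sum>k\<le>n. real (n choose k) * bern_num k * x ^ (n - k))"

definition has_hexp_at_0 :: "(real \<Rightarrow> complex) \<Rightarrow> complex \<Rightarrow> bool" where
  "has_hexp_at_0 v c \<longleftrightarrow> (\<exists>B :: (complex \<times> nat) set. \<exists>d :: complex \<times> nat \<Rightarrow> complex. \<exists>r :: real.
     finite B \<and> (0, 0) \<notin> B \<and> r > 0 \<and>
     ((\<lambda>z. norm (v z - c - (\<Sum>p\<in>B. d p * (complex_of_real z) powr (fst p) * (complex_of_real (ln z)) ^ (snd p)))
            / z powr r) \<longlongrightarrow> 0) (at_right 0))"

definition has_hexp_at_inf :: "(real \<Rightarrow> complex) \<Rightarrow> complex \<Rightarrow> bool" where
  "has_hexp_at_inf v c \<longleftrightarrow> (\<exists>B :: (complex \<times> nat) set. \<exists>d :: complex \<times> nat \<Rightarrow> complex. \<exists>r :: real.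
     finite B \<and> (0, 0) \<notin> B \<and> r < 0 \<and>
     ((\<lambda>z. norm (v z - c - (\<Sum>p\<in>B. d p * (complex_of_real z) powr (fst p) * (complex_of_real (ln z)) ^ (snd p)))
            / z powr r) \<longlongrightarrow> 0) at_top)"

definition LIM0 :: "(real \<Rightarrow> complex) \<Rightarrow> complex" where
  "LIM0 v = (THE c. has_hexp_at_0 v c)"

definition LIMinf :: "(real \<Rightarrow> complex) \<Rightarrow> complex" where
  "LIMinf v = (THE c. has_hexp_at_inf v c)"

definition hfint :: "(real \<Rightarrow> complex) \<Rightarrow> complex" where
  "hfint u = LIM0 (\<lambda>e. integral {e..1} u) + LIMinf (\<lambda>R. integral {1..R} u)"

text \<open>S_eps(u) = sin^2(pi u sqrt eps)/(pi^2 eps), S_0(u) = u^2, as an entire function of eps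
  (on eps >= 0 this is the function of the paper; sin^2 is even, so the branch of the root is irrelevant).\<close>
definition Seps :: "complex \<Rightarrow> real \<Rightarrow> complex" where
  "Seps e u = (if e = 0 then complex_of_real (u^2)
               else (sin (complex_of_real (pi * u) * csqrt e))^2 / (complex_of_real (pi^2) * e))"

definition G5 :: "real \<Rightarrow> real \<Rightarrow> real \<Rightarrow> complex \<Rightarrow> complex" where
  "G5 x y z e = inverse ((Seps e x + Seps e y + complex_of_real (z^2))^2)"

definition G9 :: "real \<Rightarrow> real \<Rightarrow> real \<Rightarrow> complex \<Rightarrow> complex" where
  "G9 x y z e = inverse ((Seps e x + Seps e y
        - complex_of_real (2 * pi^2 / 3) * e * Seps e x * Seps e y + complex_of_real (z^2))^2)"

text \<open>Phi_m(x,y,z) = sum_j F_{m,j}(x,y) (x^2+y^2+z^2)^(-2-j), i.e. the Taylor coefficient of eps^m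
  at eps = 0 (real-valued, so we take the real part of the complex expression).\<close>
definition Phi5 :: "nat \<Rightarrow> real \<Rightarrow> real \<Rightarrow> real \<Rightarrow> real" where
  "Phi5 m x y z = Re ((deriv ^^ m) (G5 x y z) 0 / of_nat (fact m))"

definition Phi9 :: "nat \<Rightarrow> real \<Rightarrow> real \<Rightarrow> real \<Rightarrow> real" where
  "Phi9 m x y z = Re ((deriv ^^ m) (G9 x y z) 0 / of_nat (fact m))"

definition a5 :: "complex \<Rightarrow> complex" where
  "a5 s = integral {0<..} (\<lambda>z. (complex_of_real z) powr (3 - 2 * s) *
     complex_of_real (integral {0..1} (\<lambda>y. integral {0..1} (\<lambda>x.
       inverse (((sin (pi * x))^2 / pi^2 + (sin (pi * y))^2 / pi^2 + z^2)^2)))))"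

definition a9 :: "complex \<Rightarrow> complex" where
  "a9 s = integral {0<..} (\<lambda>z. (complex_of_real z) powr (3 - 2 * s) *
     complex_of_real (integral {0..1} (\<lambda>y. integral {0..1} (\<lambda>x.
       inverse (((sin (pi * x))^2 / pi^2 + (sin (pi * y))^2 / pi^2
                 - 2 / (3 * pi^2) * (sin (pi * x))^2 * (sin (pi * y))^2 + z^2)^2)))))"

definition bcoef :: "(real \<Rightarrow> real \<Rightarrow> real \<Rightarrow> real) \<Rightarrow> nat \<Rightarrow> complex \<Rightarrow> complex" where
  "bcoef Phi M s =
     4 / (of_nat (fact (2 * M + 1)))^2 *
       hfint (\<lambda>z. (complex_of_real z) powr (3 - 2 * s) *
         complex_of_real (integral {0..} (\<lambda>y. integral {0..} (\<lambda>x.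
           bern_poly (2 * M + 1) (x - of_int \<lfloor>x\<rfloor>) * bern_poly (2 * M + 1) (y - of_int \<lfloor>y\<rfloor>) *
           (deriv ^^ (2 * M + 1)) (\<lambda>x'. (deriv ^^ (2 * M + 1)) (\<lambda>y'. Phi x' y' z) y) x))))
   + 8 / of_nat (fact (2 * M + 1)) *
       hfint (\<lambda>z. (complex_of_real z) powr (3 - 2 * s) *
         complex_of_real (integral {0..} (\<lambda>y. integral {0..} (\<lambda>x.
           bern_poly (2 * M + 1) (x - of_int \<lfloor>x\<rfloor>) *
           (deriv ^^ (2 * M + 1)) (\<lambda>x'. Phi x' y z) x))))"

definition b5 :: "nat \<Rightarrow> nat \<Rightarrow> complex \<Rightarrow> complex" where
  "b5 M m s = bcoef (Phi5 m) M s"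

definition b9 :: "nat \<Rightarrow> nat \<Rightarrow> complex \<Rightarrow> complex" where
  "b9 M m s = bcoef (Phi9 m) M s"

end

theory Submission
  imports Defs "HOL-Computational_Algebra.Fundamental_Theorem_Algebra"
begin

text \<open>
  Write \<open>\<lambda>\<^sup>-\<^sup>s\<close> as \<open>V2 s\<close> times the integral of \<open>z powr (3 - 2 * s) / (\<lambda> + z\<^sup>2)\<^sup>2\<close> and apply the Euler--Maclaurin formula
  of order \<open>p = 2 * M + 1\<close> in both lattice variables to \<open>(\<lambda> + z\<^sup>2)\<^sup>-\<^sup>2\<close>, regarded as a function \<open>W\<close> of \<open>(x, y, z, \<epsilon>)\<close>
  at \<open>\<epsilon> = n\<^sup>-\<^sup>2\<close>. The main term scales exactly and gives \<open>a(s)\<close>; the remainder integrals are Taylor expanded in \<open>\<epsilon>\<close>.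
  All derivatives of \<open>W\<close> are polynomials in \<open>x\<close>, \<open>y\<close>, \<open>\<epsilon>\<close>, an entire series and \<open>Q\<^sup>-\<^sup>1\<close>, homogeneous for the scaling
  of weights \<open>1, 1, -2, -2\<close>; this alone bounds the Taylor remainder on the fundamental cell by
  \<open>n powr (-2 * M) * r powr (-4) * min r n powr (2 * M - |\<alpha>|)\<close>, \<open>\<alpha>\<close> the order of differentiation, with \<open>r\<^sup>2 = x\<^sup>2 + y\<^sup>2 + z\<^sup>2\<close>. Since \<open>|\<alpha>| > 2 M\<close>, integration over \<open>r \<ge> 1\<close> loses at most the factor
  \<open>n\<^sup>2\<^sup>-\<^sup>2\<^sup>\<sigma>\<close>. For \<open>z \<le> 1\<close> the unit square is treated by reading Euler--Maclaurin backwards, so that only the undifferentiated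
  function is evaluated near the origin. The lattice point \<open>0\<close> contributes \<open>z\<^sup>-\<^sup>4\<close>, whose regularised integral vanishes.
\<close>

section \<open>Bernoulli polynomials and Euler--Maclaurin summation\<close>

text \<open>The square in (\<lambda> + z^2)^-2 makes r^-4, unlike r^-2, integrable at infinity over
  the plane. The obstacle is z \<rightarrow> 0: the differentiated Taylor coefficients have degree
  2m - 4 - p or 2m - 4 - 2p, so absolute estimates near the origin are far too singular, while
  integration against z^(3-2s) tolerates only z^-2. Evenness in x and y is the way out. When
  Euler-Maclaurin is undone on [0,1], every boundary term at 0 except the value itself vanishes: odd
  derivatives are zero there, and even ones carry an odd Bernoulli number. Derivatives survive only
  on the far edges, where r \<ge> 1. The singular parts left by the coefficient m = 0 are z^-4 and
  z^-3; those of order z^-3 cancel between the single and the double integral. The error is cut at z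
  = n: n^(-2M) z^-2 below and n^(2-2M) z^-4 above integrate to the same order n^(2-2M-2 Re s). Since
  \<open>LIM0\<close> and \<open>LIMinf\<close> are definite descriptions, the constant term of an
  expansion must be shown unique; z = e^t turns this into a statement on exponential polynomials.
  The case M = 0 is drawn from M = 1, because the Euler-Maclaurin lemmas ask for p \<ge> 3.\<close>

lemma bern_poly_0 [simp]: "bern_poly 0 x = 1"
  by (simp add: bern_poly_def)

lemma bern_poly_at_0: "bern_poly j 0 = bern_num j"
proof -
  have "bern_poly j 0 = (\<Sum>k\<le>j. if k = j then bern_num j else 0)"
    unfolding bern_poly_def by (rule sum.cong) auto
  then show ?thesis by simp
qed

lemma bern_poly_has_derivative:
  "(bern_poly (Suc j) has_real_derivative real (Suc j) * bern_poly j x) (at x)"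
proof -
  have *: "real (Suc j choose k) * real (Suc j - k) = real (Suc j) * real (j choose k)" if "k \<le> j" for k
  proof -
    have "(Suc j choose k) * (Suc j - k) = Suc j * (j choose k)"
      by (metis binomial_absorb_comp mult.commute diff_Suc_1)
    then show ?thesis by (metis of_nat_mult)
  qed
  have eq: "bern_poly (Suc j) = (\<lambda>x. \<Sum>k\<le>Suc j. real (Suc j choose k) * bern_num k * x ^ (Suc j - k))"
    by (simp add: bern_poly_def fun_eq_iff del: sum.atMost_Suc)
  have "(bern_poly (Suc j) has_real_derivative
      (\<Sum>k\<le>Suc j. real (Suc j choose k) * bern_num k * (real (Suc j - k) * x ^ (Suc j - k - 1)))) (at x)"
    unfolding eq by (auto intro!: derivative_eq_intros sum.cong)
  also have "(\<Sum>k\<le>Suc j. real (Suc j choose k) * bern_num k * (real (Suc j - k) * x ^ (Suc j - k - 1)))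
      = (\<Sum>k\<le>j. real (Suc j) * (real (j choose k) * bern_num k * x ^ (j - k)))"
    unfolding sum.atMost_Suc using * by (auto intro!: sum.cong simp: Suc_diff_le mult_ac)
  finally show ?thesis unfolding bern_poly_def [of j] sum_distrib_left .
qed

text \<open>The recursion that defines \<open>bern_num\<close> is this equation for j = n + 2,
  solved for the last Bernoulli number but one. For j = 1 it fails: the values at 1 and 0 are 1/2
  and -1/2.\<close>

lemma bern_poly_at_1:
  assumes "j \<ge> 2"
  shows "bern_poly j 1 = bern_num j"
proof -
  obtain n where n: "j = Suc (Suc n)" using assms by (metis One_nat_def Suc_1 Suc_le_D Suc_le_mono)
  have "bern_poly j 1 = (\<Sum>k\<le>n. real ((n + 2) choose k) * bern_num k)
      + real (n + 2) * bern_num (Suc n) + bern_num (n + 2)"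
    unfolding bern_poly_def n by (simp del: bern_num.simps add: binomial_Suc_n)
  also have "real (n + 2) * bern_num (Suc n) = - (\<Sum>k\<le>n. real ((n + 2) choose k) * bern_num k)"
    by simp
  finally show ?thesis by (simp add: n)
qed

lemma bern_poly_1_eq: "bern_poly (Suc 0) x = x - 1 / 2"
  by (simp add: bern_poly_def eval_nat_numeral)

lemma continuous_on_bern_poly [continuous_intros]:
  "continuous_on S f \<Longrightarrow> continuous_on S (\<lambda>x. bern_poly j (f x))"
  unfolding bern_poly_def by (intro continuous_intros)

lemma bern_poly_integral_0:
  assumes "j > 0"
  shows "(bern_poly j has_integral 0) {0..1}"
proof -
  have "((\<lambda>x. real (Suc j) * bern_poly j x) has_integral (bern_poly (Suc j) 1 - bern_poly (Suc j) 0)) {0..1}"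
    by (rule fundamental_theorem_of_calculus)
      (auto simp: has_real_derivative_iff_has_vector_derivative[symmetric] simp del: of_nat_Suc
        intro: has_field_derivative_at_within bern_poly_has_derivative)
  then have "((\<lambda>x. real (Suc j) * bern_poly j x) has_integral 0) {0..1}"
    using assms by (simp add: bern_poly_at_0 bern_poly_at_1)
  then have "((\<lambda>x. (1 / real (Suc j)) * (real (Suc j) * bern_poly j x)) has_integral (1 / real (Suc j)) * 0) {0..1}"
    by (rule has_integral_mult_right)
  then show ?thesis by (simp del: of_nat_Suc)
qed

text \<open>By the induction hypothesis the difference \<open>g\<close> of the two sides has
  derivative 0, so it is constant; both sides have mean 0 over [0,1], so the constant is 0.\<close>

lemma bern_poly_reflect: "bern_poly j (1 - x) = (- 1) ^ j * bern_poly j x"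
proof (induction j arbitrary: x)
  case (Suc j)
  define g where "g x = bern_poly (Suc j) (1 - x) - (- 1) ^ Suc j * bern_poly (Suc j) x" for x
  have "(g has_real_derivative 0) (at x)" for x
  proof -
    have "(g has_real_derivative
      (real (Suc j) * bern_poly j (1 - x)) * (- 1) - (- 1) ^ Suc j * (real (Suc j) * bern_poly j x)) (at x)"
      unfolding g_def
      by (intro DERIV_diff DERIV_cmult bern_poly_has_derivative DERIV_chain2[OF bern_poly_has_derivative])
        (auto intro!: derivative_eq_intros)
    then show ?thesis by (simp add: Suc)
  qed
  then have "\<exists>c. \<forall>x. g x = c" by (metis DERIV_isconst_all)
  then obtain c where c: "\<And>x. g x = c" by blast
  have 1: "(bern_poly (Suc j) has_integral 0) {0..1}" by (rule bern_poly_integral_0) simp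
  have "((\<lambda>x. bern_poly (Suc j) (1 - x)) has_integral 0) {0..1}"
    using has_integral_affinity01[OF 1, of "-1" 1] 
    by (simp add: image_affinity_atLeastAtMost_diff add.commute)
  from has_integral_diff[OF this has_integral_mult_right[OF 1, of "(- 1) ^ Suc j"]]
  have "(g has_integral 0) {0..1}" unfolding g_def by simp
  then have "((\<lambda>x. c) has_integral 0) {0..1::real}" using c by (simp add: fun_eq_iff[THEN iffD2, of g "\<lambda>x. c"])
  moreover have "((\<lambda>x. c) has_integral c) {0..1::real}"
    using has_integral_const_real[of c 0 1] by simp
  ultimately have "c = 0" by (rule has_integral_unique[symmetric])
  then show ?case using c[of x] by (simp add: g_def)
qed simp

lemma bern_num_odd:
  assumes "odd j" "j \<ge> 2"
  shows "bern_num j = 0"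
proof -
  have "bern_num j = - bern_num j"
    using bern_poly_reflect[of j 0] assms by (simp add: bern_poly_at_0 bern_poly_at_1)
  then show ?thesis by simp
qed

section \<open>Euler-Maclaurin on the unit interval and over a period\<close>

definition em_coeff :: "nat \<Rightarrow> real" where
  "em_coeff i = (- 1) ^ i * bern_num (Suc i) / fact (Suc i)"

text \<open>Repeated integration by parts: the derivative of B_(p+1) / (p+1)! is B_p / p!. The
  derivatives of the function are carried along as a family \<open>g\<close>, the form in which the
  symbolic derivatives below will be supplied.\<close>

lemma em_by_parts:
  fixes g :: "nat \<Rightarrow> real \<Rightarrow> real"
  assumes g: "\<And>i x. (g i has_real_derivative g (Suc i) x) (at x)"
  shows "((\<lambda>x. bern_poly p x / fact p * g p x) has_integral
     (\<Sum>i<p. (- 1) ^ (p + i + 1) * (bern_poly (Suc i) 1 / fact (Suc i) * g i 1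
         - bern_poly (Suc i) 0 / fact (Suc i) * g i 0)) + (- 1) ^ p * integral {0..1} (g 0)) {0..1}"
proof (induction p)
  case 0
  have "continuous_on {0..1} (g 0)"
    using g by (meson DERIV_isCont continuous_at_imp_continuous_on)
  then show ?case by (simp add: integrable_integral integrable_continuous_real)
next
  case (Suc p)
  have d: "((\<lambda>x. bern_poly (Suc p) x / fact (Suc p) * g p x) has_real_derivative
      bern_poly p x / fact p * g p x + bern_poly (Suc p) x / fact (Suc p) * g (Suc p) x) (at x)" for x
  proof -
    have "((\<lambda>x. bern_poly (Suc p) x / fact (Suc p) * g p x) has_real_derivative
      (real (Suc p) * bern_poly p x) / fact (Suc p) * g p x + g (Suc p) x * (bern_poly (Suc p) x / fact (Suc p))) (at x)"
      by (intro DERIV_mult DERIV_cdivide bern_poly_has_derivative g)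
    then show ?thesis by (simp add: mult.commute del: of_nat_Suc)
  qed
  have "((\<lambda>x. bern_poly p x / fact p * g p x + bern_poly (Suc p) x / fact (Suc p) * g (Suc p) x) has_integral
      bern_poly (Suc p) 1 / fact (Suc p) * g p 1 - bern_poly (Suc p) 0 / fact (Suc p) * g p 0) {0..1}"
    by (rule fundamental_theorem_of_calculus)
      (auto simp: has_real_derivative_iff_has_vector_derivative[symmetric] simp del: of_nat_Suc fact_Suc times_divide_eq_left times_divide_eq_right
        intro: has_field_derivative_at_within d)
  from has_integral_diff[OF this Suc] show ?case
    by (rule back_subst[where P = "\<lambda>f. (f has_integral _) _", OF has_integral_eq_rhs])
      (simp_all add: sum_negf[symmetric] right_diff_distrib fun_eq_iff del: fact_Suc)
qed

text \<open>For i \<ge> 1 the polynomial B_(i+1) takes the same value at both ends, which leaves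
  \<open>em_coeff\<close>; its sign (-1)^i is (-1)^(p+i+1) for odd p. Only B_1 changes sign between
  the ends, and it produces the trapezoidal mean.\<close>

lemma em_unit_interval:
  fixes g :: "nat \<Rightarrow> real \<Rightarrow> real"
  assumes g: "\<And>i x. (g i has_real_derivative g (Suc i) x) (at x)" and p: "odd p" "p \<ge> 3"
  shows "((\<lambda>x. bern_poly p x * g p x) has_integral
     fact p * ((g 0 0 + g 0 1) / 2 - integral {0..1} (g 0)
       + (\<Sum>i\<in>{1..<p}. em_coeff i * (g i 1 - g i 0)))) {0..1}"
proof -
  have "(\<Sum>i<p. (- 1) ^ (p + i + 1) * (bern_poly (Suc i) 1 / fact (Suc i) * g i 1
         - bern_poly (Suc i) 0 / fact (Suc i) * g i 0))
      = (g 0 0 + g 0 1) / 2 + (\<Sum>i\<in>{1..<p}. em_coeff i * (g i 1 - g i 0))"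
  proof -
    have "{..<p} = insert 0 {1..<p}" using p by auto
    moreover have "(- 1) ^ (p + i + 1) * (bern_poly (Suc i) 1 / fact (Suc i) * g i 1
         - bern_poly (Suc i) 0 / fact (Suc i) * g i 0) = em_coeff i * (g i 1 - g i 0)"
      if "i \<in> {1..<p}" for i
      using that p by (simp add: bern_poly_at_0 bern_poly_at_1 em_coeff_def power_add
        right_diff_distrib diff_divide_distrib del: fact_Suc bern_num.simps)
    moreover have "(- 1) ^ (p + 0 + 1) * (bern_poly (Suc 0) 1 / fact (Suc 0) * g 0 1
         - bern_poly (Suc 0) 0 / fact (Suc 0) * g 0 0) = (g 0 0 + g 0 1) / 2"
      using p by (simp add: bern_poly_1_eq[of 0] bern_poly_1_eq[of 1] field_simps)
    ultimately show ?thesis by simp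
  qed
  with has_integral_mult_right[OF em_by_parts[of g p, OF g], of "fact p"] p show ?thesis by (simp add: diff_add_eq)
qed

text \<open>Summation over m unit intervals telescopes the boundary derivatives; periodicity of all
  derivatives removes them at m = n and turns the trapezoidal sum into the plain sum over k <
  n.\<close>

lemma em_periodic_sum:
  fixes g :: "nat \<Rightarrow> real \<Rightarrow> real"
  assumes g: "\<And>i x. (g i has_real_derivative g (Suc i) x) (at x)" and p: "odd p" "p \<ge> 3"
    and per: "\<And>i. g i (real n) = g i 0"
  shows "((\<lambda>x. g 0 x + 1 / fact p * (bern_poly p (x - of_int \<lfloor>x\<rfloor>) * g p x)) has_integral
          (\<Sum>k<n. g 0 (real k))) {0..real n}"
proof -
  have cont: "continuous_on S (g 0)" for S
    using g by (meson DERIV_isCont continuous_at_imp_continuous_on)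
  have "((\<lambda>x. g 0 x + 1 / fact p * (bern_poly p (x - of_int \<lfloor>x\<rfloor>) * g p x)) has_integral
          (\<Sum>k<m. g 0 (real k)) + (g 0 (real m) - g 0 0) / 2
          + (\<Sum>i\<in>{1..<p}. em_coeff i * (g i (real m) - g i 0))) {0..real m}" for m
  proof (induction m)
    case (Suc m)
    define h where "h i x = g i (x + real m)" for i x
    have h: "(h i has_real_derivative h (Suc i) x) (at x)" for i x
      unfolding h_def using DERIV_shift[of "g i" _ x "real m"] g by blast
    have 1: "((\<lambda>x. h 0 x + 1 / fact p * (bern_poly p x * h p x)) has_integral
       integral {0..1} (h 0) + 1 / fact p * (fact p * ((h 0 0 + h 0 1) / 2 - integral {0..1} (h 0)
       + (\<Sum>i\<in>{1..<p}. em_coeff i * (h i 1 - h i 0))))) {0..1}"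
      using h by (intro has_integral_add has_integral_mult_right em_unit_interval p integrable_integral
        integrable_continuous_real) (meson DERIV_isCont continuous_at_imp_continuous_on)+
    have 2: "((\<lambda>x. h 0 (x - real m) + 1 / fact p * (bern_poly p (x - real m) * h p (x - real m))) has_integral
       (h 0 0 + h 0 1) / 2 + (\<Sum>i\<in>{1..<p}. em_coeff i * (h i 1 - h i 0))) {real m..real (Suc m)}"
      using has_integral_shift_real_ivl[OF 1, of "- real m"] by (simp add: add.commute)
    have 3: "((\<lambda>x. g 0 x + 1 / fact p * (bern_poly p (x - of_int \<lfloor>x\<rfloor>) * g p x)) has_integral
       (h 0 0 + h 0 1) / 2 + (\<Sum>i\<in>{1..<p}. em_coeff i * (h i 1 - h i 0))) {real m..real (Suc m)}"
    proof (rule has_integral_eq[OF _ 2])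
      fix x assume x: "x \<in> {real m..real (Suc m)}"
      \<comment> \<open>At the right end the floor jumps, but B_p(1) = B_p(0) for p \<ge> 2, so the
        two integrands agree at every point.\<close>
      have "bern_poly p (x - real m) = bern_poly p (x - of_int \<lfloor>x\<rfloor>)"
      proof (cases "x = real (Suc m)")
        case True
        then show ?thesis using p by (simp add: bern_poly_at_0 bern_poly_at_1)
      next
        case False
        with x have "\<lfloor>x\<rfloor> = int m" by (intro floor_unique) auto
        then show ?thesis by simp
      qed
      then show "h 0 (x - real m) + 1 / fact p * (bern_poly p (x - real m) * h p (x - real m))
         = g 0 x + 1 / fact p * (bern_poly p (x - of_int \<lfloor>x\<rfloor>) * g p x)"
        by (simp add: h_def)
    qed
    have "(\<Sum>i\<in>{1..<p}. em_coeff i * (g i (real m) - g i 0)) + (\<Sum>i\<in>{1..<p}. em_coeff i * (h i 1 - h i 0))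
        = (\<Sum>i\<in>{1..<p}. em_coeff i * (g i (real (Suc m)) - g i 0))"
      unfolding sum.distrib[symmetric] by (simp add: h_def algebra_simps)
    then show ?case
      by (intro has_integral_eq_rhs[OF has_integral_combine[OF _ _ Suc 3]])
        (simp_all add: h_def field_simps)
  qed (simp add: has_integral_refl)
  from this[of n] per show ?thesis by simp
qed

section \<open>Symbolic derivatives of the summand\<close>

text \<open>\<open>sin\<^sup>2(\<pi> \<surd>w) / (\<pi>\<^sup>2 w) = (\<Sum>n. sinc_coeff n * w ^ n)\<close>, so that \<open>Seps e u = u\<^sup>2 * sinc_ser 0 (e * u\<^sup>2)\<close>;
  \<open>sinc_ser i\<close> is the \<open>i\<close>-th derivative of this entire function.\<close>
definition sinc_coeff :: "nat \<Rightarrow> real" where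
  "sinc_coeff n = (- 1) ^ n * 2 ^ (2 * n + 1) * pi ^ (2 * n) / fact (2 * n + 2)"

definition sinc_ser :: "nat \<Rightarrow> 'a \<Rightarrow> 'a::{real_normed_field,banach}" where
  "sinc_ser i w = (\<Sum>n. of_real ((diffs ^^ i) sinc_coeff n) * w ^ n)"

lemma cos_even_sums:
  fixes t :: "'a::{real_normed_field,banach}"
  shows "(\<lambda>n. of_real ((- 1) ^ n / fact (2 * n)) * t ^ (2 * n)) sums cos t"
proof -
  have "(\<lambda>n. cos_coeff (2 * n) *\<^sub>R t ^ (2 * n)) sums cos t"
    by (subst sums_mono_reindex[of "\<lambda>n. 2 * n" "\<lambda>n. cos_coeff n *\<^sub>R t ^ n"])
      (use cos_converges[of t] in \<open>auto simp: strict_mono_def cos_coeff_def elim!: evenE\<close>)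
  then show ?thesis by (simp add: cos_coeff_def scaleR_conv_of_real)
qed

lemma sinc_ser_sums_square:
  fixes t :: "'a::{real_normed_field,banach}"
  shows "(\<lambda>n. 2 * of_real pi ^ 2 * t ^ 2 * (of_real (sinc_coeff n) * (t ^ 2) ^ n)) sums
    (1 - cos (2 * of_real pi * t))"
proof -
  have "(\<lambda>n. of_real ((- 1) ^ Suc n / fact (2 * Suc n)) * (2 * of_real pi * t) ^ (2 * Suc n))
      sums (cos (2 * of_real pi * t) - 1)"
    using cos_even_sums[of "2 * of_real pi * t"] by (subst sums_Suc_iff) simp
  then have "(\<lambda>n. - (of_real ((- 1) ^ Suc n / fact (2 * Suc n)) * (2 * of_real pi * t) ^ (2 * Suc n)))
      sums - (cos (2 * of_real pi * t) - 1)"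
    by (rule sums_minus)
  moreover have "- (of_real ((- 1) ^ Suc n / fact (2 * Suc n)) * (2 * of_real pi * t) ^ (2 * Suc n))
      = 2 * of_real pi ^ 2 * t ^ 2 * (of_real (sinc_coeff n) * (t ^ 2) ^ n)" for n
    by (simp add: sinc_coeff_def power_mult_distrib power_mult[symmetric] power_add
       divide_simps del: fact_Suc of_nat_Suc) (simp add: power2_eq_square mult_ac)
  ultimately show ?thesis by simp
qed

text \<open>The cosine series gives convergence at real squares x^2 with x \<noteq> 0. Every w lies
  strictly inside the radius norm w + 1, which is such a square.\<close>

lemma summable_sinc_coeff: "summable (\<lambda>n. of_real (sinc_coeff n) * (w::'a::{real_normed_field,banach}) ^ n)"
proof -
  have "summable (\<lambda>n. sinc_coeff n * (x ^ 2) ^ n)" if "x \<noteq> 0" for x :: real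
  proof -
    have "summable (\<lambda>n. 2 * pi ^ 2 * x ^ 2 * (sinc_coeff n * (x ^ 2) ^ n))"
      using sinc_ser_sums_square[of x] by (simp add: sums_iff)
    then show ?thesis using that by (subst (asm) summable_cmult_iff) simp
  qed
  from this[of "sqrt (norm w + 1)"] have "summable (\<lambda>n. sinc_coeff n * (norm w + 1) ^ n)"
    by (simp add: real_sqrt_eq_zero_cancel_iff add_nonneg_eq_0_iff)
  then have "summable (\<lambda>n. norm (sinc_coeff n * (norm w) ^ n))"
    by (rule powser_insidea) simp
  then show ?thesis
    by (intro summable_norm_cancel[where f = "\<lambda>n. of_real (sinc_coeff n) * w ^ n"])
      (simp add: norm_mult norm_power abs_mult)
qed

lemma diffs_of_real: "diffs (\<lambda>n. of_real (c n) :: 'a::{real_normed_field,banach}) = (\<lambda>n. of_real (diffs c n))"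
  by (simp add: diffs_def fun_eq_iff)

lemma summable_sinc_diffs:
  "summable (\<lambda>n. of_real ((diffs ^^ i) sinc_coeff n) * (w::'a::{real_normed_field,banach}) ^ n)"
proof (induction i arbitrary: w)
  case (Suc i)
  have "summable (\<lambda>n. diffs (\<lambda>n. of_real ((diffs ^^ i) sinc_coeff n)) n * w ^ n)"
    by (rule termdiff_converges_all) (rule Suc)
  then show ?case by (simp add: diffs_of_real)
qed (simp add: summable_sinc_coeff)

lemma sinc_ser_has_derivative:
  "(sinc_ser i has_field_derivative sinc_ser (Suc i) w) (at (w::'a::{real_normed_field,banach}))"
  using termdiffs_strong_converges_everywhere[OF summable_sinc_diffs, of i w]
  unfolding sinc_ser_def[abs_def] by (simp add: diffs_of_real)

lemma of_real_sinc_ser: "sinc_ser i (of_real w :: 'a::{real_normed_field,banach}) = of_real (sinc_ser i w)"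
proof -
  have "(\<lambda>n. of_real (of_real ((diffs ^^ i) sinc_coeff n) * w ^ n)) sums (of_real (sinc_ser i w) :: 'a)"
    unfolding sinc_ser_def by (intro sums_of_real summable_sums summable_sinc_diffs)
  then show ?thesis by (simp add: sinc_ser_def sums_iff)
qed

lemma continuous_on_sinc_ser [continuous_intros]:
  "continuous_on S f \<Longrightarrow> continuous_on S (\<lambda>x. sinc_ser i (f x :: 'a::{real_normed_field,banach}))"
  by (rule continuous_on_compose2[of UNIV "sinc_ser i"])
    (auto intro!: continuous_at_imp_continuous_on DERIV_isCont sinc_ser_has_derivative)

lemma borel_measurable_sinc_ser [measurable]: "sinc_ser i \<in> borel_measurable (borel :: real measure)"
  by (intro borel_measurable_continuous_onI continuous_on_sinc_ser continuous_on_id)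

lemma sinc_ser_square:
  "2 * of_real pi ^ 2 * t ^ 2 * sinc_ser 0 (t ^ 2) = 1 - cos (2 * of_real pi * (t::'a::{real_normed_field,banach}))"
proof -
  have "(\<lambda>n. 2 * of_real pi ^ 2 * t ^ 2 * (of_real (sinc_coeff n) * (t ^ 2) ^ n)) sums
     (2 * of_real pi ^ 2 * t ^ 2 * sinc_ser 0 (t ^ 2))"
    unfolding sinc_ser_def funpow_0 by (intro sums_mult summable_sums summable_sinc_coeff)
  then show ?thesis using sinc_ser_sums_square sums_unique2 by blast
qed

lemma sinc_ser_at_0 [simp]: "sinc_ser 0 0 = 1"
proof -
  have "sinc_ser 0 (0 :: 'a) = of_real (sinc_coeff 0)"
    unfolding sinc_ser_def funpow_0 by (rule powser_zero)
  then show ?thesis by (simp add: sinc_coeff_def)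
qed

lemma Seps_eq: "Seps e u = of_real (u\<^sup>2) * sinc_ser 0 (e * of_real (u\<^sup>2))"
proof (cases "e = 0 \<or> u = 0")
  case False
  define t where "t = csqrt e * of_real u"
  have t2: "t ^ 2 = e * of_real (u\<^sup>2)" by (simp add: t_def power_mult_distrib)
  have "2 * (sin (complex_of_real (pi * u) * csqrt e))\<^sup>2 = 1 - cos (2 * of_real pi * t)"
    using cos_double_sin[of "of_real pi * t"] by (simp add: t_def mult_ac)
  also have "\<dots> = 2 * of_real pi ^ 2 * t ^ 2 * sinc_ser 0 (t ^ 2)"
    by (rule sinc_ser_square[symmetric])
  finally show ?thesis using False by (simp add: Seps_def t2 field_simps)
qed (auto simp: Seps_def)

section \<open>An expression language closed under partial differentiation\<close>

datatype dir = DX | DY | DE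

text \<open>\<open>Ser b i\<close> stands for \<open>sinc_ser i (\<epsilon> * b\<^sup>2)\<close> and \<open>QI\<close> for \<open>1 / Q\<close>. The derivation \<open>derq q\<close> takes the derivatives of \<open>Q\<close>,
  which are themselves expressions, as the parameter \<open>q\<close>.\<close>
datatype ex = Var dir | Con real | Ser dir nat | QI | Add ex ex | Mul ex ex

text \<open>On expressions without \<open>QI\<close> the parameter \<open>q\<close> of
  \<open>derq\<close> is never consulted and the derivative formula holds at every point. This
  breaks the circle between differentiating \<open>QI\<close> and differentiating
  \<open>Q\<close>.\<close>

primrec noQI :: "ex \<Rightarrow> bool" where
  "noQI (Var b) = True" | "noQI (Con c) = True" | "noQI (Ser b i) = True" | "noQI QI = False"
| "noQI (Add s t) = (noQI s \<and> noQI t)" | "noQI (Mul s t) = (noQI s \<and> noQI t)"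

primrec derq :: "(dir \<Rightarrow> ex) \<Rightarrow> dir \<Rightarrow> ex \<Rightarrow> ex" where
  "derq q a (Var b) = Con (if a = b then 1 else 0)"
| "derq q a (Con c) = Con 0"
| "derq q a (Ser b i) = Mul (Ser b (Suc i)) (Add (Mul (Con (if a = DE then 1 else 0)) (Mul (Var b) (Var b)))
     (Mul (Con (if a = b then 2 else 0)) (Mul (Var DE) (Var b))))"
| "derq q a QI = Mul (Con (- 1)) (Mul (Mul QI QI) (q a))"
| "derq q a (Add s t) = Add (derq q a s) (derq q a t)"
| "derq q a (Mul s t) = Add (Mul (derq q a s) t) (Mul s (derq q a t))"

lemma derq_noQI: "noQI t \<Longrightarrow> derq q a t = derq q' a t"
  by (induction t) auto

text \<open>\<open>\<kappa> = 0\<close> is the 5-point star, \<open>\<kappa> = 2 * pi\<^sup>2 / 3\<close> the 9-point star.\<close>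
locale star =
  fixes \<kappa> :: real
  assumes kappa: "0 \<le> \<kappa>" "\<kappa> \<le> 2 * pi\<^sup>2 / 3"
begin

text \<open>The expression for Q - z^2. No derivative in z is ever taken, so z stays outside the
  language and enters only as an argument of \<open>ev\<close>.\<close>

definition P :: ex where
  "P = (let S = (\<lambda>b. Mul (Mul (Var b) (Var b)) (Ser b 0)) in
     Add (Add (S DX) (S DY)) (Mul (Con (- \<kappa>)) (Mul (Var DE) (Mul (S DX) (S DY)))))"

definition S :: "(dir \<Rightarrow> 'a) \<Rightarrow> dir \<Rightarrow> 'a::{real_normed_field,banach}" where
  "S \<rho> b = \<rho> b * \<rho> b * sinc_ser 0 (\<rho> DE * (\<rho> b)\<^sup>2)"

text \<open>Spelled out instead of evaluated from \<open>P\<close>, because \<open>ev\<close> itself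
  refers to \<open>Q\<close> in its clause for \<open>QI\<close>; \<open>Q_eq_ev\<close> links the
  two. The type stays general so that the complex derivatives in \<open>Phi5\<close>,
  \<open>Phi9\<close> and the real analysis share one formula.\<close>

definition Q :: "(dir \<Rightarrow> 'a) \<Rightarrow> 'a \<Rightarrow> 'a::{real_normed_field,banach}" where
  "Q \<rho> z = S \<rho> DX + S \<rho> DY - of_real \<kappa> * (\<rho> DE * (S \<rho> DX * S \<rho> DY)) + z\<^sup>2"

primrec ev :: "ex \<Rightarrow> (dir \<Rightarrow> 'a) \<Rightarrow> 'a \<Rightarrow> 'a::{real_normed_field,banach}" where
  "ev (Var b) \<rho> z = \<rho> b"
| "ev (Con c) \<rho> z = of_real c"
| "ev (Ser b i) \<rho> z = sinc_ser i (\<rho> DE * (\<rho> b)\<^sup>2)"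
| "ev QI \<rho> z = inverse (Q \<rho> z)"
| "ev (Add s t) \<rho> z = ev s \<rho> z + ev t \<rho> z"
| "ev (Mul s t) \<rho> z = ev s \<rho> z * ev t \<rho> z"

text \<open>\<open>P\<close> contains no \<open>QI\<close>, so its derivatives can be formed with
  the dummy parameter \<open>\<lambda>_. Con 0\<close>; they then serve as the derivatives of
  \<open>Q\<close>.\<close>

definition der :: "dir \<Rightarrow> ex \<Rightarrow> ex" where
  "der = derq (\<lambda>a. derq (\<lambda>_. Con 0) a P)"

lemma noQI_P: "noQI P"
  by (simp add: P_def)

lemma der_simps [simp]:
  "der a (Var b) = Con (if a = b then 1 else 0)"
  "der a (Con c) = Con 0"
  "der a (Ser b i) = Mul (Ser b (Suc i)) (Add (Mul (Con (if a = DE then 1 else 0)) (Mul (Var b) (Var b)))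
     (Mul (Con (if a = b then 2 else 0)) (Mul (Var DE) (Var b))))"
  "der a QI = Mul (Con (- 1)) (Mul (Mul QI QI) (der a P))"
  "der a (Add s t) = Add (der a s) (der a t)"
  "der a (Mul s t) = Add (Mul (der a s) t) (Mul s (der a t))"
  unfolding der_def using derq_noQI[OF noQI_P] by simp_all

lemma Q_eq_ev: "Q \<rho> z = ev P \<rho> z + z\<^sup>2"
  by (simp add: Q_def P_def S_def Let_def)

text \<open>One induction used twice: with \<open>noQI\<close> it differentiates \<open>P\<close>,
  hence \<open>Q\<close>, everywhere; that settles the case \<open>QI\<close> where \<open>Q\<close>
  is nonzero, and the second alternative then covers all expressions.\<close>

lemma ev_has_derivative_aux:
  assumes "noQI t \<or> ((\<lambda>v. ev QI (\<rho>(a := v)) z) has_field_derivative ev (der a QI) \<rho> z) (at (\<rho> a))"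
  shows "((\<lambda>v. ev t (\<rho>(a := v)) z) has_field_derivative ev (der a t) \<rho> z) (at (\<rho> a))"
  using assms
proof (induction t)
  case (Ser b i)
  have "((\<lambda>v. (\<rho>(a := v)) DE * ((\<rho>(a := v)) b)\<^sup>2) has_field_derivative
      ev (Add (Mul (Con (if a = DE then 1 else 0)) (Mul (Var b) (Var b)))
     (Mul (Con (if a = b then 2 else 0)) (Mul (Var DE) (Var b)))) \<rho> z) (at (\<rho> a))"
    by (cases a; cases b) (auto intro!: derivative_eq_intros simp: power2_eq_square)
  from DERIV_chain2[OF _ this, of "sinc_ser i" "sinc_ser (Suc i) (\<rho> DE * (\<rho> b)\<^sup>2)"]
  show ?case by (simp add: sinc_ser_has_derivative)
qed (auto intro!: derivative_eq_intros)

lemma ev_has_derivative: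
  assumes "Q \<rho> z \<noteq> 0"
  shows "((\<lambda>v. ev t (\<rho>(a := v)) z) has_field_derivative ev (der a t) \<rho> z) (at (\<rho> a))"
proof (rule ev_has_derivative_aux, rule disjI2)
  have "((\<lambda>v. ev P (\<rho>(a := v)) z + z\<^sup>2) has_field_derivative ev (der a P) \<rho> z) (at (\<rho> a))"
    using ev_has_derivative_aux[of P] noQI_P by (auto intro!: derivative_eq_intros)
  then have "((\<lambda>v. Q (\<rho>(a := v)) z) has_field_derivative ev (der a P) \<rho> z) (at (\<rho> a))"
    by (simp add: Q_eq_ev)
  from DERIV_inverse_fun[OF this] assms
  show "((\<lambda>v. ev QI (\<rho>(a := v)) z) has_field_derivative ev (der a QI) \<rho> z) (at (\<rho> a))"
    by (simp add: mult_ac)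
qed

lemma continuous_ev_line:
  "isCont (\<lambda>v. Q (\<rho>(a := v)) z) w"
proof -
  have "((\<lambda>v. ev P ((\<rho>(a := w))(a := v)) z) has_field_derivative ev (der a P) (\<rho>(a := w)) z) (at ((\<rho>(a := w)) a))"
    by (rule ev_has_derivative_aux) (simp add: noQI_P)
  then have "isCont (\<lambda>v. ev P (\<rho>(a := v)) z) w" by (simp add: DERIV_isCont)
  then show ?thesis unfolding Q_eq_ev by (intro continuous_intros)
qed

lemma open_Q_nonzero: "open {v. Q (\<rho>(a := v)) z \<noteq> 0}"
  by (intro open_Collect_neq continuous_at_imp_continuous_on ballI continuous_ev_line continuous_on_const)

text \<open>Equality only where \<open>Q \<noteq> 0\<close>: this set is open along every coordinate line, so \<open>eqv\<close> is preserved by \<open>der\<close>.\<close>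
definition eqv :: "ex \<Rightarrow> ex \<Rightarrow> bool" where
  "eqv s t \<longleftrightarrow> (\<forall>(\<rho> :: dir \<Rightarrow> real) z. Q \<rho> z \<noteq> 0 \<longrightarrow> ev s \<rho> z = ev t \<rho> z)"

lemma eqv_refl: "eqv t t"
  and eqv_trans: "eqv s t \<Longrightarrow> eqv t u \<Longrightarrow> eqv s u"
  by (auto simp: eqv_def)

lemma eqv_der:
  assumes "eqv s t"
  shows "eqv (der a s) (der a t)"
  unfolding eqv_def
proof (intro allI impI)
  fix \<rho> :: "dir \<Rightarrow> real" and z :: real assume Q: "Q \<rho> z \<noteq> 0"
  have "((\<lambda>v. ev s (\<rho>(a := v)) z) has_field_derivative ev (der a t) \<rho> z) (at (\<rho> a))"
    by (rule has_field_derivative_transform_within_open[OF ev_has_derivative[OF Q, of t a] open_Q_nonzero[of \<rho> a z]])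
      (use Q assms in \<open>auto simp: eqv_def\<close>)
  with ev_has_derivative[OF Q, of s a] show "ev (der a s) \<rho> z = ev (der a t) \<rho> z"
    by (rule DERIV_unique)
qed

text \<open>Mixed derivatives commute by algebra on the expressions, first for \<open>P\<close> and
  then for \<open>QI\<close>; the identity holds even at points where \<open>Q\<close>
  vanishes.\<close>

lemma ev_der_commute_aux:
  assumes "noQI t \<or> ev (der a (der b QI)) \<rho> z = ev (der b (der a QI)) \<rho> z"
  shows "ev (der a (der b t)) \<rho> z = ev (der b (der a t)) \<rho> z"
  using assms
proof (induction t)
  case (Ser c i)
  show ?case by (cases a; cases b; cases c) (simp_all add: algebra_simps power2_eq_square)
qed (auto simp: algebra_simps)

lemma ev_der_commute: "ev (der a (der b t)) \<rho> z = ev (der b (der a t)) \<rho> z"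
proof (rule ev_der_commute_aux, rule disjI2)
  have "ev (der a (der b P)) \<rho> z = ev (der b (der a P)) \<rho> z"
    by (rule ev_der_commute_aux) (simp add: noQI_P)
  then show "ev (der a (der b QI)) \<rho> z = ev (der b (der a QI)) \<rho> z"
    by (simp add: algebra_simps)
qed

lemma eqv_funpow: "eqv s t \<Longrightarrow> eqv ((der a ^^ n) s) ((der a ^^ n) t)"
  by (induction n) (auto intro: eqv_der)

lemma eqv_commute_funpow1: "eqv (der a ((der b ^^ n) t)) ((der b ^^ n) (der a t))"
proof (induction n)
  case (Suc n)
  have "eqv (der a (der b ((der b ^^ n) t))) (der b (der a ((der b ^^ n) t)))"
    by (simp add: eqv_def ev_der_commute)
  with eqv_der[OF Suc, of b] show ?case by (auto intro: eqv_trans)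
qed (simp add: eqv_refl)

end

section \<open>Bounds for the sine series\<close>

lemma sinc_ser_sin:
  assumes "0 \<le> w"
  shows "pi\<^sup>2 * w * sinc_ser 0 w = (sin (pi * sqrt w))\<^sup>2"
proof -
  have "2 * pi ^ 2 * (sqrt w) ^ 2 * sinc_ser 0 ((sqrt w) ^ 2) = 1 - cos (2 * pi * sqrt w)"
    using sinc_ser_square[of "sqrt w"] by simp
  also have "\<dots> = 2 * (sin (pi * sqrt w))\<^sup>2"
    using cos_double_sin[of "pi * sqrt w"] by (simp add: mult_ac)
  finally show ?thesis using assms by simp
qed

lemma sinc_ser_nonneg:
  assumes "0 \<le> w"
  shows "0 \<le> sinc_ser 0 (w::real)"
proof (cases "w = 0")
  case False
  then show ?thesis using sinc_ser_sin[OF assms] assms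
    by (metis less_eq_real_def mult_pos_pos not_less pi_gt_zero zero_le_mult_iff zero_le_power2 zero_less_power)
qed simp

lemma mult_sinc_ser_le:
  assumes "0 \<le> w"
  shows "w * sinc_ser 0 (w::real) \<le> 1 / pi\<^sup>2"
proof -
  have "pi\<^sup>2 * w * sinc_ser 0 w \<le> 1"
    unfolding sinc_ser_sin[OF assms] by (metis abs_sin_le_one abs_square_le_1)
  then show ?thesis by (simp add: field_simps)
qed

text \<open>Since u \<le> pi/2 < 2, the cubic error u^3 / 6 is at most 2u/3. The square of this
  third is the 1/9 of \<open>sinc_ser_lower\<close>.\<close>

lemma sin_ge_third:
  assumes "0 \<le> u" "u \<le> pi / 2"
  shows "u / 3 \<le> sin u"
proof -
  have "\<bar>sin u - u\<bar> \<le> \<bar>u\<bar> ^ 3 / 6"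
    using Maclaurin_sin_bound[of u 3] by (simp add: eval_nat_numeral sin_coeff_def)
  moreover have "u * u \<le> 2 * 2"
    using assms pi_less_4 by (intro mult_mono) auto
  then have "u * (u * u) \<le> u * 4" using assms by (intro mult_left_mono) auto
  then have "\<bar>u\<bar> ^ 3 / 6 \<le> 2 * u / 3" using assms by (simp add: power3_eq_cube mult_ac)
  ultimately show ?thesis by linarith
qed

lemma sinc_ser_lower:
  assumes "0 \<le> w" "w \<le> 1 / 4"
  shows "1 / 9 \<le> sinc_ser 0 (w::real)"
proof (cases "w = 0")
  case False
  have "sqrt w \<le> 1 / 2" using assms by (intro real_le_lsqrt) (auto simp: power2_eq_square)
  then have "pi * sqrt w / 3 \<le> sin (pi * sqrt w)"
    using assms by (intro sin_ge_third) auto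
  then have "(pi * sqrt w / 3)\<^sup>2 \<le> (sin (pi * sqrt w))\<^sup>2"
    using assms by (intro power_mono) auto
  then have "pi\<^sup>2 * w * (1 / 9) \<le> pi\<^sup>2 * w * sinc_ser 0 w"
    unfolding sinc_ser_sin[OF assms(1)] using assms by (simp add: power_mult_distrib power_divide)
  then show ?thesis using assms False by (subst (asm) mult_le_cancel_left_pos) auto
qed simp

section \<open>Weights and uniform bounds for all derivatives\<close>

definition env :: "'a \<Rightarrow> 'a \<Rightarrow> 'a \<Rightarrow> dir \<Rightarrow> 'a" where
  "env x y e b = (case b of DX \<Rightarrow> x | DY \<Rightarrow> y | DE \<Rightarrow> e)"

lemma env_simps [simp]: "env x y e DX = x" "env x y e DY = y" "env x y e DE = e"
  "(env x y e)(DX := v) = env v y e" "(env x y e)(DY := v) = env x v e" "(env x y e)(DE := v) = env x y v"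
  by (auto simp: env_def fun_eq_iff split: dir.splits)

text \<open>\<open>homog t d l\<close>: every monomial of \<open>t\<close> has weight \<open>d\<close>, where \<open>x, y, \<epsilon>\<close> and \<open>Q\<inverse>\<close> have
  weights \<open>1, 1, -2, -2\<close>, and contains at least \<open>l\<close> factors \<open>Q\<inverse>\<close>.\<close>
inductive homog :: "ex \<Rightarrow> int \<Rightarrow> nat \<Rightarrow> bool" where
  homog_X: "homog (Var DX) 1 0"
| homog_Y: "homog (Var DY) 1 0"
| homog_E: "homog (Var DE) (- 2) 0"
| homog_const: "homog (Con c) 0 0"
| homog_0: "homog (Con 0) d l"
| homog_KX: "homog (Ser DX i) 0 0"
| homog_KY: "homog (Ser DY i) 0 0"
| homog_QI: "homog QI (- 2) 1"
| homog_Add: "homog s d l \<Longrightarrow> homog t d l \<Longrightarrow> homog (Add s t) d l"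
| homog_Mul: "homog s d l \<Longrightarrow> homog t d' l' \<Longrightarrow> homog (Mul s t) (d + d') (l + l')"
| homog_weaken: "homog t d (Suc l) \<Longrightarrow> homog t d l"

text \<open>The amount by which a derivative in this direction changes the weight; the variable
  itself has weight \<open>- wt b\<close>.\<close>

fun wt :: "dir \<Rightarrow> int" where "wt DX = - 1" | "wt DY = - 1" | "wt DE = 2"

context star
begin

lemma homog_C: "(c \<noteq> 0 \<Longrightarrow> d = 0) \<Longrightarrow> homog (Con c) d 0"
  by (cases "c = 0") (auto intro: homog.intros(4,5))

lemma homog_V: "homog (Var b) (- wt b) 0"
  by (cases b) (auto intro: homog.intros(1-3))

lemma homog_K: "b \<noteq> DE \<Longrightarrow> homog (Ser b i) 0 0"
  by (cases b) (auto intro: homog.intros(6,7))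

lemma homog_der_V: "homog (der a (Var b)) (wt a - wt b) 0"
  unfolding der_simps by (rule homog_C) (auto split: if_splits)

lemma homog_der_K:
  assumes "b \<noteq> DE"
  shows "homog (der a (Ser b i)) (wt a) 0"
proof -
  have b: "wt b = - 1" using assms by (cases b) auto
  \<comment> \<open>The constants are given the weights \<open>wt a - 2\<close> here and
    \<open>wt a + 1\<close> below. Each is nonzero only in the direction for which that weight is 0,
    and the zero constant has every weight.\<close>
  have 1: "homog (Mul (Con (if a = DE then 1 else 0)) (Mul (Var b) (Var b))) ((wt a - 2) + (- wt b + - wt b)) (0 + (0 + 0))"
    by (intro homog_Mul homog_C homog_V) (auto split: if_splits)
  have 2: "homog (Mul (Con (if a = b then 2 else 0)) (Mul (Var DE) (Var b))) ((wt a + 1) + (- wt DE + - wt b)) (0 + (0 + 0))"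
    by (intro homog_Mul homog_C homog_V) (auto split: if_splits simp: b)
  have "homog (der a (Ser b i)) (0 + wt a) (0 + 0)"
    unfolding der_simps by (intro homog_Mul homog_K homog_Add) (use assms 1 2 b in auto)
  then show ?thesis by simp
qed

lemma homog_der_aux: "homog t d l \<Longrightarrow> (noQI t \<or> homog (der a P) (2 + wt a) 0) \<Longrightarrow> homog (der a t) (d + wt a) l"
proof (induction rule: homog.induct)
  case homog_QI
  then have "homog (Mul (Con (- 1)) (Mul (Mul QI QI) (der a P))) (0 + ((- 2 + - 2) + (2 + wt a))) (0 + ((1 + 1) + 0))"
    by (intro homog_Mul homog_C homog.homog_QI) auto
  \<comment> \<open>Differentiating \<open>QI\<close> yields two factors \<open>QI\<close>; one of
    them is forgotten, so \<open>l\<close> is only a lower bound for their number.\<close>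
  then show ?case by (intro homog_weaken[of _ _ 1]) (simp add: algebra_simps numeral_2_eq_2)
next
  case (homog_Mul s d l t d' l')
  have "homog (Mul (der a s) t) (d + wt a + d') (l + l')" "homog (Mul s (der a t)) (d + (d' + wt a)) (l + l')"
    using homog_Mul by (auto intro!: homog.homog_Mul)
  then show ?case by (auto intro!: homog_Add simp: algebra_simps)
next
  case (homog_weaken t d l)
  then show ?case by (intro homog.homog_weaken[of _ _ l]) auto
next
  case (homog_KX i)
  show ?case using homog_der_K[of DX a i] by simp
next
  case (homog_KY i)
  show ?case using homog_der_K[of DY a i] by simp
next
  case homog_X show ?case using homog_der_V[of a DX] by (simp add: add.commute)
next
  case homog_Y show ?case using homog_der_V[of a DY] by (simp add: add.commute)
next
  case homog_E show ?case using homog_der_V[of a DE] by simp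
next
  case (homog_Add s d l t) then show ?case by (auto intro!: homog.homog_Add)
qed (simp_all add: homog.intros(5))

lemma homog_P: "homog P 2 0"
proof -
  have S: "homog (Mul (Mul (Var b) (Var b)) (Ser b 0)) 2 0" if "b \<noteq> DE" for b
  proof -
    have "homog (Mul (Mul (Var b) (Var b)) (Ser b 0)) ((- wt b + - wt b) + 0) ((0 + 0) + 0)"
      by (intro homog_Mul homog_V homog_K that)
    then show ?thesis using that by (cases b) auto
  qed
  have "homog (Mul (Con (- \<kappa>)) (Mul (Var DE) (Mul (Mul (Mul (Var DX) (Var DX)) (Ser DX 0))
      (Mul (Mul (Var DY) (Var DY)) (Ser DY 0))))) (0 + (- wt DE + (2 + 2))) (0 + (0 + (0 + 0)))"
    by (intro homog_Mul S homog_V homog_C) auto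
  then show ?thesis unfolding P_def Let_def by (intro homog_Add S) auto
qed

lemma homog_der: "homog t d l \<Longrightarrow> homog (der a t) (d + wt a) l"
  by (rule homog_der_aux) (use homog_der_aux[OF homog_P] noQI_P in auto)

lemma homog_funpow: "homog t d l \<Longrightarrow> homog ((der a ^^ n) t) (d + int n * wt a) l"
proof (induction n)
  case (Suc n)
  from homog_der[OF Suc.IH[OF Suc.prems], of a] show ?case by (simp add: algebra_simps)
qed simp

text \<open>The region where weights become estimates: x and y are at most \<mu>, \<epsilon> is at
  most \<mu>^-2, and 1/Q is at most 14 r^-2. Two scales \<mu> \<le> r are kept apart because later
  \<mu> stops growing at n while r does not.\<close>

definition adm :: "real \<Rightarrow> real \<Rightarrow> real \<Rightarrow> real \<Rightarrow> real \<Rightarrow> real \<Rightarrow> bool" where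
  "adm x y z e \<mu> r \<longleftrightarrow> 0 < \<mu> \<and> \<mu> \<le> r \<and> \<bar>x\<bar> \<le> \<mu> \<and> \<bar>y\<bar> \<le> \<mu> \<and> 0 \<le> e \<and> e * \<mu>\<^sup>2 \<le> 1
     \<and> \<bar>inverse (Q (env x y e) z)\<bar> \<le> 14 * r powi (- 2)"

text \<open>In a monomial with k \<ge> l factors \<open>QI\<close> these contribute r^(-2k), and the
  other factors, of total weight d + 2k, are at most a constant times \<mu>^(d+2k). The k - l
  surplus pairs r^-2 \<mu>^2 are at most 1, which is the case \<open>homog_weaken\<close>. The
  series factors are bounded since their argument stays in [0,1].\<close>

lemma homog_bound:
  assumes "homog t d l"
  shows "\<exists>B\<ge>0. \<forall>x y z e \<mu> r. adm x y z e \<mu> r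
     \<longrightarrow> \<bar>ev t (env x y e) z\<bar> \<le> B * (r powi (- 2 * int l) * \<mu> powi (d + 2 * int l))"
  using assms
proof (induction rule: homog.induct)
  case homog_X show ?case by (rule exI[of _ 1]) (auto simp: adm_def)
next
  case homog_Y show ?case by (rule exI[of _ 1]) (auto simp: adm_def)
next
  case homog_E show ?case by (rule exI[of _ 1]) (auto simp: adm_def power_int_minus field_simps)
next
  case (homog_const c) show ?case by (rule exI[of _ "\<bar>c\<bar>"]) (auto simp: adm_def)
next
  case (homog_0 d l) show ?case by (rule exI[of _ 0]) auto
next
  case homog_QI show ?case by (rule exI[of _ 14]) (auto simp: adm_def)
next
  case (homog_Add s d l t)
  from homog_Add.IH obtain A B where AB: "0 \<le> A" "0 \<le> B"
   "\<And>x y z e \<mu> r. adm x y z e \<mu> r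
     \<Longrightarrow> \<bar>ev s (env x y e) z\<bar> \<le> A * (r powi (- 2 * int l) * \<mu> powi (d + 2 * int l))"
   "\<And>x y z e \<mu> r. adm x y z e \<mu> r
     \<Longrightarrow> \<bar>ev t (env x y e) z\<bar> \<le> B * (r powi (- 2 * int l) * \<mu> powi (d + 2 * int l))"
    by metis
  show ?case
    by (rule exI[of _ "A + B"]) (use AB in \<open>auto simp: distrib_right intro!: order_trans[OF abs_triangle_ineq] add_mono\<close>)
next
  case (homog_Mul s d l t d' l')
  from homog_Mul.IH obtain A B where AB: "0 \<le> A" "0 \<le> B"
   "\<And>x y z e \<mu> r. adm x y z e \<mu> r
     \<Longrightarrow> \<bar>ev s (env x y e) z\<bar> \<le> A * (r powi (- 2 * int l) * \<mu> powi (d + 2 * int l))"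
   "\<And>x y z e \<mu> r. adm x y z e \<mu> r
     \<Longrightarrow> \<bar>ev t (env x y e) z\<bar> \<le> B * (r powi (- 2 * int l') * \<mu> powi (d' + 2 * int l'))"
    by metis
  show ?case
  proof (rule exI[of _ "A * B"], intro conjI allI impI)
    fix x y z e \<mu> r :: real
    assume adm: "adm x y z e \<mu> r"
    then have *: "0 < \<mu>" "\<mu> \<le> r" by (auto simp: adm_def)
    have "\<bar>ev s (env x y e) z\<bar> * \<bar>ev t (env x y e) z\<bar>
       \<le> (A * (r powi (- 2 * int l) * \<mu> powi (d + 2 * int l))) * (B * (r powi (- 2 * int l') * \<mu> powi (d' + 2 * int l')))"
      using AB(3,4)[OF adm] AB * by (intro mult_mono) auto
    also have "\<dots> = A * B * ((r powi (- 2 * int l) * r powi (- 2 * int l')) * (\<mu> powi (d + 2 * int l) * \<mu> powi (d' + 2 * int l')))"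
      by (simp add: mult_ac)
    also have "\<dots> = A * B * (r powi (- 2 * int (l + l')) * \<mu> powi (d + d' + 2 * int (l + l')))"
      using * by (subst power_int_add[symmetric], force, subst power_int_add[symmetric], force)
        (simp add: algebra_simps)
    finally show "\<bar>ev (Mul s t) (env x y e) z\<bar> \<le> A * B * (r powi (- 2 * int (l + l')) * \<mu> powi (d + d' + 2 * int (l + l')))"
      by (simp add: abs_mult)
  qed (use AB in auto)
next
  case (homog_weaken t d l)
  from homog_weaken.IH obtain B where B: "0 \<le> B"
   "\<And>x y z e \<mu> r. adm x y z e \<mu> r
     \<Longrightarrow> \<bar>ev t (env x y e) z\<bar> \<le> B * (r powi (- 2 * int (Suc l)) * \<mu> powi (d + 2 * int (Suc l)))"
    by metis
  show ?case
  proof (rule exI[of _ B], intro conjI allI impI)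
    fix x y z e \<mu> r :: real
    assume adm: "adm x y z e \<mu> r"
    then have *: "0 < \<mu>" "\<mu> \<le> r" by (auto simp: adm_def)
    have "r powi (- 2 * int (Suc l)) * \<mu> powi (d + 2 * int (Suc l))
      = (r powi (- 2 * int l) * r powi (- 2)) * (\<mu> powi (d + 2 * int l) * \<mu> powi 2)"
      using * by (subst power_int_add[symmetric], force, subst power_int_add[symmetric], force)
        (simp add: algebra_simps)
    also have "\<dots> = (r powi (- 2 * int l) * \<mu> powi (d + 2 * int l)) * (\<mu>\<^sup>2 / r\<^sup>2)"
      by (simp add: power_int_minus field_simps)
    also have "\<dots> \<le> (r powi (- 2 * int l) * \<mu> powi (d + 2 * int l)) * 1"
      using * by (intro mult_left_mono mult_nonneg_nonneg) auto
    finally have "B * (r powi (- 2 * int (Suc l)) * \<mu> powi (d + 2 * int (Suc l)))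
        \<le> B * (r powi (- 2 * int l) * \<mu> powi (d + 2 * int l))"
      using B by (intro mult_left_mono) auto
    then show "\<bar>ev t (env x y e) z\<bar> \<le> B * (r powi (- 2 * int l) * \<mu> powi (d + 2 * int l))"
      using B(2)[OF adm] by linarith
  qed (use B in auto)
next
  case (homog_KX i)
  have "compact (sinc_ser i ` {0..1::real})"
    by (intro compact_continuous_image continuous_intros) auto
  then obtain B where B: "\<And>w. w \<in> {0..1::real} \<Longrightarrow> \<bar>sinc_ser i w\<bar> \<le> B"
    by (fastforce dest: compact_imp_bounded simp: bounded_iff)
  moreover have "0 \<le> B" using B[of 0] by auto
  moreover have "e * x\<^sup>2 \<in> {0..1}" if "\<bar>x\<bar> \<le> \<mu>" "0 \<le> e" "e * \<mu>\<^sup>2 \<le> 1" for e x \<mu> :: real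
    using that mult_left_mono[of "x\<^sup>2" "\<mu>\<^sup>2" e] abs_le_square_iff[of x \<mu>] by auto
  ultimately show ?case by (intro exI[of _ B]) (auto simp: adm_def)
next
  case (homog_KY i)
  have "compact (sinc_ser i ` {0..1::real})"
    by (intro compact_continuous_image continuous_intros) auto
  then obtain B where B: "\<And>w. w \<in> {0..1::real} \<Longrightarrow> \<bar>sinc_ser i w\<bar> \<le> B"
    by (fastforce dest: compact_imp_bounded simp: bounded_iff)
  moreover have "0 \<le> B" using B[of 0] by auto
  moreover have "e * x\<^sup>2 \<in> {0..1}" if "\<bar>x\<bar> \<le> \<mu>" "0 \<le> e" "e * \<mu>\<^sup>2 \<le> 1" for e x \<mu> :: real
    using that mult_left_mono[of "x\<^sup>2" "\<mu>\<^sup>2" e] abs_le_square_iff[of x \<mu>] by auto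
  ultimately show ?case by (intro exI[of _ B]) (auto simp: adm_def)
qed

text \<open>The upper bound on \<kappa> enters here: \<epsilon> S(x) \<le> 1/pi^2, so \<kappa>
  \<epsilon> S(x) \<le> 2/3 and likewise for y. The mixed term is thus at most 2/3 of either S,
  hence at most a third of their sum.\<close>

lemma Q_lower_aux:
  fixes e x y z :: real
  assumes "0 \<le> e"
  shows "Q (env x y e) z \<ge> 2 / 3 * (S (env x y e) DX + S (env x y e) DY) + z\<^sup>2"
    and "0 \<le> S (env x y e) DX" and "0 \<le> S (env x y e) DY"
proof -
  have S: "0 \<le> w * w * sinc_ser 0 (e * w\<^sup>2)" "\<kappa> * (e * (w * w * sinc_ser 0 (e * w\<^sup>2))) \<le> 2 / 3" for w
  proof -
    show "0 \<le> w * w * sinc_ser 0 (e * w\<^sup>2)" using assms sinc_ser_nonneg[of "e * w\<^sup>2"] by simp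
    have "\<kappa> * (e * (w * w * sinc_ser 0 (e * w\<^sup>2))) = \<kappa> * (e * w\<^sup>2 * sinc_ser 0 (e * w\<^sup>2))"
      by (simp add: power2_eq_square mult_ac)
    also have "\<dots> \<le> (2 * pi\<^sup>2 / 3) * (1 / pi\<^sup>2)"
      using assms kappa sinc_ser_nonneg[of "e * w\<^sup>2"] by (intro mult_mono mult_sinc_ser_le) auto
    finally show "\<kappa> * (e * (w * w * sinc_ser 0 (e * w\<^sup>2))) \<le> 2 / 3" by simp
  qed
  define a b where "a = S (env x y e) DX" and "b = S (env x y e) DY"
  have a: "0 \<le> a" "\<kappa> * (e * a) \<le> 2 / 3" and b: "0 \<le> b" "\<kappa> * (e * b) \<le> 2 / 3"
    unfolding a_def b_def S_def using S by auto
  have "(\<kappa> * (e * a)) * b \<le> 2 / 3 * b" "(\<kappa> * (e * b)) * a \<le> 2 / 3 * a"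
    by (rule mult_right_mono[OF a(2) b(1)], rule mult_right_mono[OF b(2) a(1)])
  moreover define T where "T = \<kappa> * (e * (a * b))"
  ultimately have "T \<le> 2 / 3 * b" "T \<le> 2 / 3 * a" by (simp_all add: mult_ac)
  then have "T \<le> (a + b) / 3" by (simp add: field_simps)
  then show "Q (env x y e) z \<ge> 2 / 3 * (S (env x y e) DX + S (env x y e) DY) + z\<^sup>2"
    unfolding Q_def T_def a_def b_def by (simp add: field_simps)
  show "0 \<le> S (env x y e) DX" "0 \<le> S (env x y e) DY" using a b by (simp_all add: a_def b_def)
qed

lemma Q_ge_z:
  fixes e x y z :: real
  assumes "0 \<le> e"
  shows "Q (env x y e) z \<ge> z\<^sup>2"
  using Q_lower_aux(2,3)[OF assms, of x y] by (intro order_trans[OF _ Q_lower_aux(1)[OF assms]]) simp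

lemma Q_pos: "0 < z \<Longrightarrow> 0 \<le> e \<Longrightarrow> Q (env x y e) z > 0" for e x y z :: real
  using Q_ge_z[of e z x y] by (smt (verit) zero_less_power)

text \<open>The constant: 2/3 times 1/9 is 2/27, which exceeds 1/14. For \<epsilon> = n^-2 the
  hypotheses say that x and y lie within half a period of 0, where the sine has no other
  zero.\<close>

lemma Q_lower:
  fixes e x y z :: real
  assumes "0 \<le> e" "e * x\<^sup>2 \<le> 1 / 4" "e * y\<^sup>2 \<le> 1 / 4"
  shows "Q (env x y e) z \<ge> (x\<^sup>2 + y\<^sup>2 + z\<^sup>2) / 14"
proof -
  have "S (env x y e) DX \<ge> x\<^sup>2 / 9" "S (env x y e) DY \<ge> y\<^sup>2 / 9"
    using assms sinc_ser_lower[of "e * x\<^sup>2"] sinc_ser_lower[of "e * y\<^sup>2"]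
      mult_left_mono[of "1 / 9" "sinc_ser 0 (e * x\<^sup>2)" "x\<^sup>2"] mult_left_mono[of "1 / 9" "sinc_ser 0 (e * y\<^sup>2)" "y\<^sup>2"]
    by (auto simp: S_def power2_eq_square)
  moreover have "0 \<le> x\<^sup>2" "0 \<le> y\<^sup>2" "0 \<le> z\<^sup>2" by auto
  ultimately show ?thesis using Q_lower_aux(1)[OF assms(1), of x y z] by argo
qed

end

section \<open>The derivatives of Q^-2 and the Taylor remainder in \<epsilon>\<close>

lemma deriv_funpow_eq:
  fixes g :: "nat \<Rightarrow> 'a \<Rightarrow> 'a::real_normed_field"
  assumes "\<And>i x. (g i has_field_derivative g (Suc i) x) (at x)"
  shows "(deriv ^^ i) (g 0) = g i"
proof (induction i)
  case (Suc i)
  have "deriv (g i) = g (Suc i)" by (rule ext, rule DERIV_imp_deriv, rule assms)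
  with Suc show ?case by simp
qed simp

context star
begin

definition H :: ex where "H = Mul QI QI"

text \<open>The order of differentiation is that of \<open>bcoef\<close>: \<epsilon> first, then y,
  then x. A further derivative in y or \<epsilon> has to be moved inwards, which
  \<open>eqv_D_Y\<close> and \<open>eqv_D_E\<close> do.\<close>

definition D :: "nat \<Rightarrow> nat \<Rightarrow> nat \<Rightarrow> ex" where
  "D i j m = (der DX ^^ i) ((der DY ^^ j) ((der DE ^^ m) H))"

definition W :: "nat \<Rightarrow> nat \<Rightarrow> nat \<Rightarrow> real \<Rightarrow> real \<Rightarrow> real \<Rightarrow> real \<Rightarrow> real" where
  "W i j m x y z e = ev (D i j m) (env x y e) z"

lemma eqv_D_Y: "eqv (der DY (D i j m)) (D i (Suc j) m)"
  unfolding D_def using eqv_commute_funpow1[where a = DY and b = DX and n = i] by simp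

lemma eqv_D_E: "eqv (der DE (D i j m)) (D i j (Suc m))"
proof -
  have "eqv (der DE ((der DX ^^ i) ((der DY ^^ j) ((der DE ^^ m) H))))
     ((der DX ^^ i) (der DE ((der DY ^^ j) ((der DE ^^ m) H))))"
    by (rule eqv_commute_funpow1)
  moreover have "eqv ((der DX ^^ i) (der DE ((der DY ^^ j) ((der DE ^^ m) H))))
     ((der DX ^^ i) ((der DY ^^ j) (der DE ((der DE ^^ m) H))))"
    by (intro eqv_funpow eqv_commute_funpow1)
  ultimately show ?thesis unfolding D_def by (auto intro: eqv_trans)
qed

lemma W_derivative:
  assumes "0 < z" "0 \<le> e"
  shows "((\<lambda>x. W i j m x y z e) has_real_derivative W (Suc i) j m x y z e) (at x)"
    and "((\<lambda>y. W i j m x y z e) has_real_derivative W i (Suc j) m x y z e) (at y)"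
    and "((\<lambda>e. W i j m x y z e) has_real_derivative W i j (Suc m) x y z e) (at e)"
proof -
  have Q: "Q (env x y e) z \<noteq> 0" using Q_pos[OF assms, of x y] by simp
  show "((\<lambda>x. W i j m x y z e) has_real_derivative W (Suc i) j m x y z e) (at x)"
    using ev_has_derivative[OF Q, of "D i j m" DX] by (simp add: W_def D_def)
  show "((\<lambda>y. W i j m x y z e) has_real_derivative W i (Suc j) m x y z e) (at y)"
    using ev_has_derivative[OF Q, of "D i j m" DY] eqv_D_Y[of i j m] Q by (simp add: W_def eqv_def)
  show "((\<lambda>e. W i j m x y z e) has_real_derivative W i j (Suc m) x y z e) (at e)"
    using ev_has_derivative[OF Q, of "D i j m" DE] eqv_D_E[of i j m] Q by (simp add: W_def eqv_def)
qed

lemma ev_of_real: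
  "ev t (\<lambda>b. of_real (\<rho> b)) (of_real z) = (of_real (ev t \<rho> z) :: 'a::{real_normed_field,banach})"
proof -
  have S: "S (\<lambda>b. of_real (\<rho> b)) b = (of_real (S \<rho> b) :: 'a)" for b
    unfolding S_def by (metis of_real_mult of_real_power of_real_sinc_ser)
  have Q: "Q (\<lambda>b. of_real (\<rho> b)) (of_real z) = (of_real (Q \<rho> z) :: 'a)"
    unfolding Q_def S by simp
  show ?thesis
  proof (induction t)
    case (Ser b i)
    show ?case unfolding ev.simps by (metis of_real_mult of_real_power of_real_sinc_ser)
  qed (auto simp: Q)
qed

definition Phi :: "nat \<Rightarrow> real \<Rightarrow> real \<Rightarrow> real \<Rightarrow> real" where
  "Phi m x y z = Re ((deriv ^^ m) (\<lambda>e. inverse ((Seps e x + Seps e y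
        - complex_of_real \<kappa> * e * Seps e x * Seps e y + complex_of_real (z^2))^2)) 0 / of_nat (fact m))"

text \<open>\<open>Phi\<close> is built from complex derivatives in e at 0. They agree with the
  symbolic ones near 0, and at real arguments the symbolic derivative is a real number, so taking
  \<open>Re\<close> loses nothing.\<close>

lemma Phi_eq_W:
  assumes "0 < z"
  shows "Phi m x y z = W 0 0 m x y z 0 / fact m"
proof -
  define \<rho> where "\<rho> = env (complex_of_real x) (complex_of_real y)"
  define U where "U = {e. Q (\<rho> e) (complex_of_real z) \<noteq> 0}"
  have U: "open U" using open_Q_nonzero[of "\<rho> 0" DE "complex_of_real z"] by (simp add: U_def \<rho>_def)
  have \<rho>0: "\<rho> 0 = (\<lambda>b. of_real (env x y 0 b))"
    by (auto simp: \<rho>_def env_def fun_eq_iff split: dir.splits)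
  have real: "ev t (\<rho> 0) (of_real z) = of_real (ev t (env x y 0) z)" for t
    unfolding \<rho>0 by (rule ev_of_real)
  have "Q (env x y 0) z \<noteq> 0" using Q_pos[OF assms, of 0 x y] by simp
  moreover have "ev QI (\<rho> 0) (of_real z) = of_real (inverse (Q (env x y 0) z))"
    unfolding real by simp
  ultimately have U0: "0 \<in> U" by (auto simp: U_def)
  have Seps: "Seps e u = of_real u * of_real u * sinc_ser 0 (e * (of_real u)\<^sup>2)" for e u
    unfolding Seps_eq by (simp add: power2_eq_square)
  have G: "inverse ((Seps e x + Seps e y - complex_of_real \<kappa> * e * Seps e x * Seps e y + complex_of_real (z^2))^2)
    = ev H (\<rho> e) (of_real z)" for e
    by (simp add: H_def Q_def S_def Seps \<rho>_def power2_eq_square mult_ac)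
  \<comment> \<open>The claim is made on the whole open set \<open>U\<close>, not just at 0, since
    each induction step differentiates it once more.\<close>
  have "(deriv ^^ m) (\<lambda>e. ev H (\<rho> e) (of_real z)) e = ev ((der DE ^^ m) H) (\<rho> e) (of_real z)" if "e \<in> U" for e
    using that
  proof (induction m arbitrary: e)
    case (Suc m)
    have "((\<lambda>v. ev ((der DE ^^ m) H) (\<rho> v) (of_real z)) has_field_derivative
      ev (der DE ((der DE ^^ m) H)) (\<rho> e) (of_real z)) (at e)"
      using ev_has_derivative[of "\<rho> e" "of_real z" "(der DE ^^ m) H" DE] Suc.prems by (simp add: U_def \<rho>_def)
    then have "((deriv ^^ m) (\<lambda>e. ev H (\<rho> e) (of_real z)) has_field_derivative
      ev (der DE ((der DE ^^ m) H)) (\<rho> e) (of_real z)) (at e)"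
      by (rule has_field_derivative_transform_within_open[OF _ U Suc.prems]) (simp add: Suc.IH)
    then show ?case by (simp add: DERIV_imp_deriv)
  qed simp
  from this[OF U0] have "(deriv ^^ m) (\<lambda>e. ev H (\<rho> e) (of_real z)) 0 = complex_of_real (W 0 0 m x y z 0)"
    unfolding real by (simp add: W_def D_def)
  moreover have "of_nat (fact m) = complex_of_real (fact m)" by simp
  ultimately show ?thesis
    unfolding Phi_def G by (simp only: Re_complex_of_real of_real_divide[symmetric])
qed

lemma Phi_derivs:
  assumes "0 < z"
  shows "(deriv ^^ p) (\<lambda>x'. (deriv ^^ q) (\<lambda>y'. Phi m x' y' z) y) x = W p q m x y z 0 / fact m"
proof -
  have "(deriv ^^ q) (\<lambda>y'. Phi m x' y' z) = (\<lambda>y'. W 0 q m x' y' z 0 / fact m)" for x'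
    using deriv_funpow_eq[of "\<lambda>i y'. W 0 i m x' y' z 0 / fact m" q] assms
    by (simp add: Phi_eq_W W_derivative(2) DERIV_cdivide)
  moreover have "(deriv ^^ p) (\<lambda>x'. W 0 q m x' y z 0 / fact m) = (\<lambda>x'. W p q m x' y z 0 / fact m)"
    using deriv_funpow_eq[of "\<lambda>i x'. W i q m x' y z 0 / fact m" p] assms
    by (simp add: W_derivative(1) DERIV_cdivide)
  ultimately show ?thesis by simp
qed

lemma homog_D: "homog (D i j m) (- 4 - int i - int j + 2 * int m) 2"
proof -
  have "homog H (- 2 + - 2) (1 + 1)" unfolding H_def by (intro homog_Mul homog_QI)
  then have "homog H (- 4) 2" by (simp add: numeral_2_eq_2)
  then have "homog (D i j m) (- 4 + int m * wt DE + int j * wt DY + int i * wt DX) 2"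
    unfolding D_def by (intro homog_funpow)
  then show ?thesis by (simp add: algebra_simps)
qed

definition rad :: "real \<Rightarrow> real \<Rightarrow> real \<Rightarrow> real" where
  "rad x y z = sqrt (x\<^sup>2 + y\<^sup>2 + z\<^sup>2)"

lemma rad_sq [simp]: "(rad x y z)\<^sup>2 = x\<^sup>2 + y\<^sup>2 + z\<^sup>2"
  by (simp add: rad_def)

lemma rad_pos: "0 < z \<Longrightarrow> 0 < rad x y z"
  by (auto simp: rad_def intro: add_nonneg_pos)

lemma rad_ge: "\<bar>x\<bar> \<le> rad x y z" "\<bar>y\<bar> \<le> rad x y z" "\<bar>z\<bar> \<le> rad x y z"
  by (auto simp: rad_def intro!: real_le_rsqrt)

text \<open>With N = n this is the fundamental cell at any \<epsilon> up to n^-2. Both r and N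
  dominate the coordinates, so \<mu> may be their minimum; the factor 14 comes from
  \<open>Q_lower\<close>.\<close>

lemma adm_box:
  assumes "0 < z" "0 < N" "\<bar>x\<bar> \<le> N / 2" "\<bar>y\<bar> \<le> N / 2" "0 \<le> e" "e * N\<^sup>2 \<le> 1"
  shows "adm x y z e (min (rad x y z) N) (rad x y z)"
proof -
  have e4: "e * w\<^sup>2 \<le> 1 / 4" if "\<bar>w\<bar> \<le> N / 2" for w
  proof -
    have "w\<^sup>2 \<le> (N / 2)\<^sup>2" using that assms by (subst abs_le_square_iff[symmetric]) auto
    then have "e * w\<^sup>2 \<le> e * (N / 2)\<^sup>2" using assms by (intro mult_left_mono)
    then show ?thesis using assms by (simp add: power_divide)
  qed
  have r: "0 < rad x y z" by (rule rad_pos) fact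
  have "(rad x y z)\<^sup>2 / 14 \<le> Q (env x y e) z"
    using Q_lower[OF assms(5) e4[OF assms(3)] e4[OF assms(4)], of z] by simp
  moreover have "0 < (rad x y z)\<^sup>2 / 14" using r by (simp del: rad_sq)
  ultimately have "inverse (Q (env x y e) z) \<le> inverse ((rad x y z)\<^sup>2 / 14)" "0 < Q (env x y e) z"
    by (rule le_imp_inverse_le, linarith)
  moreover have "e * (min (rad x y z) N)\<^sup>2 \<le> e * N\<^sup>2"
    using assms r by (intro mult_left_mono power_mono) auto
  ultimately show ?thesis
    unfolding adm_def using assms r rad_ge(1)[of x y z] rad_ge(2)[of y x z] rad_ge(3)[of z x y]
    by (auto simp: power_int_minus field_simps simp del: rad_sq)
qed

lemma adm_0:
  assumes "0 < z"
  shows "adm x y z 0 (rad x y z) (rad x y z)"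
proof -
  \<comment> \<open>At \<epsilon> = 0 the cell may have any size: this N contains the point and is
    large enough for the minimum of r and N to be r.\<close>
  define N where "N = 2 * rad x y z"
  have "adm x y z 0 (min (rad x y z) N) (rad x y z)"
    using assms rad_pos[OF assms, of x y] rad_ge(1)[of x y z] rad_ge(2)[of y x z] rad_ge(3)[of z x y] by (intro adm_box) (auto simp: N_def)
  then show ?thesis using rad_pos[OF assms, of x y] by (simp add: N_def)
qed

lemma W_bound_0:
  "\<exists>B\<ge>0. \<forall>x y z. 0 < z \<longrightarrow> \<bar>W i j m x y z 0\<bar> \<le> B * rad x y z powi (2 * int m - 4 - int i - int j)"
proof -
  from homog_bound[OF homog_D[of i j m]] obtain B where B: "B \<ge> 0"
    "\<And>x y z e \<mu> r. adm x y z e \<mu> r \<Longrightarrow> \<bar>ev (D i j m) (env x y e) z\<bar> \<le> B * (r powi (- 2 * int 2) * \<mu> powi ((- 4 - int i - int j + 2 * int m) + 2 * int 2))"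
    by blast
  have "\<bar>W i j m x y z 0\<bar> \<le> B * rad x y z powi (2 * int m - 4 - int i - int j)" if "0 < z" for x y z
  proof -
    have "rad x y z powi (- 2 * int 2) * rad x y z powi ((- 4 - int i - int j + 2 * int m) + 2 * int 2)
      = rad x y z powi (2 * int m - 4 - int i - int j)"
      using rad_pos[OF that, of x y] by (subst power_int_add[symmetric]) (auto simp: algebra_simps)
    with B(2)[OF adm_0[OF that, of x y]] show ?thesis unfolding W_def by metis
  qed
  with B show ?thesis by blast
qed

definition Rem :: "nat \<Rightarrow> nat \<Rightarrow> nat \<Rightarrow> nat \<Rightarrow> real \<Rightarrow> real \<Rightarrow> real \<Rightarrow> real" where
  "Rem M n i j x y z = W i j 0 x y z (1 / (real n)\<^sup>2) - (\<Sum>m<M. W i j m x y z 0 / fact m * (1 / (real n)\<^sup>2) ^ m)"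

lemma Rem_bound:
  assumes "M > 0"
  shows "\<exists>B\<ge>0. \<forall>n x y z. 0 < n \<longrightarrow> 0 < z \<longrightarrow> \<bar>x\<bar> \<le> n / 2 \<longrightarrow> \<bar>y\<bar> \<le> n / 2 \<longrightarrow>
     \<bar>Rem M n i j x y z\<bar> \<le> B * real n powi (- 2 * int M) *
       (rad x y z powi (- 4) * min (rad x y z) (real n) powi (2 * int M - int i - int j))"
proof -
  from homog_bound[OF homog_D[of i j M]] obtain B where B: "B \<ge> 0"
    "\<And>x y z e \<mu> r. adm x y z e \<mu> r \<Longrightarrow> \<bar>ev (D i j M) (env x y e) z\<bar> \<le> B * (r powi (- 2 * int 2) * \<mu> powi ((- 4 - int i - int j + 2 * int M) + 2 * int 2))"
    by blast
  have "\<bar>Rem M n i j x y z\<bar> \<le> B * real n powi (- 2 * int M) *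
       (rad x y z powi (- 4) * min (rad x y z) (real n) powi (2 * int M - int i - int j))"
    if n: "0 < n" and z: "0 < z" and xy: "\<bar>x\<bar> \<le> n / 2" "\<bar>y\<bar> \<le> n / 2" for n x y z
  proof -
    define h where "h = 1 / (real n)\<^sup>2"
    have "h > 0" using n by (simp add: h_def)
    \<comment> \<open>Lagrange remainder: the intermediate \<epsilon> depends on the point, but it
      lies in (0, n^-2), where the bound for the M-th derivative is uniform.\<close>
    from Maclaurin[OF this assms, of "\<lambda>m e. W i j m x y z e" "W i j 0 x y z"]
    obtain e where e: "0 < e" "e < h"
      "W i j 0 x y z h = (\<Sum>m<M. W i j m x y z 0 / fact m * h ^ m) + W i j M x y z e / fact M * h ^ M"
      using W_derivative(3)[OF z] by auto
    then have "Rem M n i j x y z = W i j M x y z e / fact M * h ^ M"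
      by (simp add: Rem_def h_def)
    also have "\<bar>\<dots>\<bar> = \<bar>W i j M x y z e\<bar> / fact M * h ^ M" using \<open>h > 0\<close> by (simp add: abs_mult)
    also have "\<dots> \<le> \<bar>W i j M x y z e\<bar> / 1 * h ^ M"
      using \<open>h > 0\<close> by (intro mult_right_mono divide_left_mono fact_ge_1) auto
    also have "\<dots> \<le> (B * (rad x y z powi (- 2 * int 2) * min (rad x y z) (real n) powi ((- 4 - int i - int j + 2 * int M) + 2 * int 2))) * h ^ M"
    proof -
      have "e * (real n)\<^sup>2 \<le> 1" using e n by (simp add: h_def field_simps)
      then have "adm x y z e (min (rad x y z) (real n)) (rad x y z)"
        using n z xy e by (intro adm_box) auto
      from B(2)[OF this] show ?thesis using \<open>h > 0\<close> unfolding W_def by (intro mult_right_mono) auto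
    qed
    also have "h ^ M = real n powi (- 2 * int M)"
    proof -
      have "- 2 * int M = - int (2 * M)" by simp
      then show ?thesis unfolding h_def
        by (simp only: power_int_minus power_int_of_nat) (simp add: power_one_over power_mult inverse_eq_divide)
    qed
    finally show ?thesis by (simp add: algebra_simps)
  qed
  with B show ?thesis by blast
qed

end

section \<open>Continuity, measurability and symmetries of \<open>W\<close>\<close>

context star
begin

lemma continuous_on_ev:
  fixes f g h k :: "'b::topological_space \<Rightarrow> real"
  assumes "continuous_on U f" "continuous_on U g" "continuous_on U h" "continuous_on U k"
    and "\<And>w. w \<in> U \<Longrightarrow> Q (env (f w) (g w) (h w)) (k w) \<noteq> 0"
  shows "continuous_on U (\<lambda>w. ev t (env (f w) (g w) (h w)) (k w))"
proof -
  have Var: "continuous_on U (\<lambda>w. env (f w) (g w) (h w) b)" for b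
    using assms(1-3) by (cases b) simp_all
  have S: "continuous_on U (\<lambda>w. S (env (f w) (g w) (h w)) b)" for b
    unfolding S_def by (intro continuous_intros Var)
  show ?thesis
  proof (induction t)
    case QI
    show ?case unfolding ev.simps
      by (intro continuous_on_inverse) (use assms(5) in \<open>auto simp: Q_def intro!: continuous_intros Var S assms(3,4)\<close>)
  qed (auto intro!: continuous_intros Var assms(3))
qed

lemma borel_measurable_ev:
  fixes f g h k :: "'b \<Rightarrow> real"
  assumes [measurable]: "f \<in> borel_measurable N" "g \<in> borel_measurable N" "h \<in> borel_measurable N" "k \<in> borel_measurable N"
  shows "(\<lambda>w. ev t (env (f w) (g w) (h w)) (k w)) \<in> borel_measurable N"
proof -
  have Var [measurable]: "(\<lambda>w. env (f w) (g w) (h w) b) \<in> borel_measurable N" for b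
    by (cases b) simp_all
  have Ser [measurable]: "(\<lambda>w. sinc_ser i (env (f w) (g w) (h w) DE * (env (f w) (g w) (h w) b)\<^sup>2)) \<in> borel_measurable N" for b i
    by (rule measurable_compose[OF _ borel_measurable_sinc_ser]) measurable
  have S [measurable]: "(\<lambda>w. S (env (f w) (g w) (h w)) b) \<in> borel_measurable N" for b
    unfolding S_def by measurable
  show ?thesis
  proof (induction t)
    case QI
    show ?case unfolding ev.simps Q_def by measurable
  next
    case (Add s t)
    note Add [measurable]
    show ?case unfolding ev.simps by measurable
  next
    case (Mul s t)
    note Mul [measurable]
    show ?case unfolding ev.simps by measurable
  qed (auto simp del: env_simps)
qed

lemma borel_measurable_W [measurable (raw)]:
  fixes f g h k :: "'b \<Rightarrow> real"
  assumes [measurable]: "f \<in> borel_measurable N" "g \<in> borel_measurable N" "h \<in> borel_measurable N" "k \<in> borel_measurable N"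
  shows "(\<lambda>w. W i j m (f w) (g w) (h w) (k w)) \<in> borel_measurable N"
  unfolding W_def by (rule borel_measurable_ev) measurable

lemma continuous_on_W [continuous_intros]:
  fixes f g :: "'b::topological_space \<Rightarrow> real"
  assumes "continuous_on U f" "continuous_on U g" "0 < z" "0 \<le> e"
  shows "continuous_on U (\<lambda>w. W i j m (f w) (g w) z e)"
  unfolding W_def by (rule continuous_on_ev) (use assms Q_pos in \<open>auto simp: less_le\<close>)

text \<open>Covers parity (c = 0, s = -1) and translation by a period (c = n, s = 1) at once; k is
  the factor by which the expression changes. The set \<open>A\<close> confines the environments,
  because periodicity holds only at \<epsilon> = n^-2.\<close>

definition symm :: "(dir \<Rightarrow> real) set \<Rightarrow> dir \<Rightarrow> real \<Rightarrow> real \<Rightarrow> real \<Rightarrow> real \<Rightarrow> ex \<Rightarrow> bool" where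
  "symm A b c s z k t \<longleftrightarrow> (\<forall>\<rho>\<in>A. Q \<rho> z \<noteq> 0 \<longrightarrow> ev t (\<rho>(b := c + s * \<rho> b)) z = k * ev t \<rho> z)"

text \<open>Differentiate the symmetry on both sides: by the chain rule a derivative in the moved
  direction acquires the factor s. The set \<open>A\<close> must allow variation in direction
  \<open>a\<close>; a set with \<epsilon> fixed does so for x and y only, hence the index m = 0 in
  \<open>W_periodic\<close>.\<close>

lemma symm_der:
  assumes "symm A b c s z k t"
    and QT: "\<And>\<rho>. \<rho> \<in> A \<Longrightarrow> Q (\<rho>(b := c + s * \<rho> b)) z = Q \<rho> z"
    and A: "\<And>\<rho> v. \<rho> \<in> A \<Longrightarrow> \<rho>(a := v) \<in> A" and s: "s * s = 1"
  shows "symm A b c s z ((if a = b then s else 1) * k) (der a t)"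
  unfolding symm_def
proof (intro ballI impI)
  fix \<rho> assume \<rho>: "\<rho> \<in> A" "Q \<rho> z \<noteq> 0"
  define \<rho>' where "\<rho>' = \<rho>(b := c + s * \<rho> b)"
  have Q': "Q \<rho>' z \<noteq> 0" using \<rho> QT unfolding \<rho>'_def by simp
  have "((\<lambda>v. k * ev t (\<rho>(a := v)) z) has_field_derivative k * ev (der a t) \<rho> z) (at (\<rho> a))"
    by (intro DERIV_cmult ev_has_derivative \<rho>)
  then have 1: "((\<lambda>v. ev t ((\<rho>(a := v))(b := c + s * (\<rho>(a := v)) b)) z) has_field_derivative k * ev (der a t) \<rho> z) (at (\<rho> a))"
    by (rule has_field_derivative_transform_within_open[OF _ open_Q_nonzero[of \<rho> a z]])
      (use \<rho> A assms(1) in \<open>auto simp: symm_def simp del: fun_upd_apply\<close>)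
  have 2: "((\<lambda>v. ev t ((\<rho>(a := v))(b := c + s * (\<rho>(a := v)) b)) z) has_field_derivative
     (if a = b then s else 1) * ev (der a t) \<rho>' z) (at (\<rho> a))"
  proof (cases "a = b")
    case True
    have "((\<lambda>v. ev t (\<rho>'(b := c + s * v)) z) has_field_derivative ev (der b t) \<rho>' z * s) (at (\<rho> b))"
    proof (rule DERIV_chain2[where f = "\<lambda>v. ev t (\<rho>'(b := v)) z" and g = "\<lambda>v. c + s * v"])
      show "((\<lambda>v. ev t (\<rho>'(b := v)) z) has_field_derivative ev (der b t) \<rho>' z) (at (c + s * \<rho> b))"
        using ev_has_derivative[OF Q', of t b] by (simp add: \<rho>'_def)
    qed (auto intro!: derivative_eq_intros)
    then show ?thesis using True by (simp add: \<rho>'_def mult.commute)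
  next
    case False
    then show ?thesis
      using ev_has_derivative[OF Q', of t a] by (simp add: \<rho>'_def fun_upd_twist)
  qed
  from DERIV_unique[OF 1 2] s have "(if a = b then s else 1) * (k * ev (der a t) \<rho> z)
     = (if a = b then s * s else 1) * ev (der a t) \<rho>' z"
    by (auto simp: mult.assoc)
  with s show "ev (der a t) (\<rho>(b := c + s * \<rho> b)) z = (if a = b then s else 1) * k * ev (der a t) \<rho> z"
    by (auto simp: \<rho>'_def)
qed

lemma symm_funpow:
  assumes "symm A b c s z k t"
    and "\<And>\<rho>. \<rho> \<in> A \<Longrightarrow> Q (\<rho>(b := c + s * \<rho> b)) z = Q \<rho> z"
    and "\<And>\<rho> v. \<rho> \<in> A \<Longrightarrow> \<rho>(a := v) \<in> A" "s * s = 1"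
  shows "symm A b c s z ((if a = b then s ^ i else 1) * k) ((der a ^^ i) t)"
proof (induction i)
  case (Suc i)
  from symm_der[OF Suc assms(2-4)] show ?case by (auto simp: mult.assoc)
qed (use assms in simp)

lemma symm_H:
  assumes "\<And>\<rho>. \<rho> \<in> A \<Longrightarrow> Q (\<rho>(b := c + s * \<rho> b)) z = Q \<rho> z"
  shows "symm A b c s z 1 H"
  using assms by (auto simp: symm_def H_def simp del: fun_upd_apply)

lemma W_parity:
  assumes "0 < z" "0 \<le> e"
  shows "W i j m (- x) y z e = (- 1) ^ i * W i j m x y z e"
    and "W i j m x (- y) z e = (- 1) ^ j * W i j m x y z e"
proof -
  have Q: "Q (\<rho>(b := 0 + (- 1) * \<rho> b)) z = Q \<rho> z" if "b \<noteq> DE" for \<rho> b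
    using that by (cases b) (auto simp: Q_def S_def)
  have Q0: "Q (env x y e) z \<noteq> 0" for x y using Q_pos[OF assms, of x y] by simp
  have "symm UNIV b 0 (- 1) z ((if DX = b then (- 1) ^ i else 1) * ((if DY = b then (- 1) ^ j else 1) * ((if DE = b then (- 1) ^ m else 1) * 1))) (D i j m)"
    if "b \<noteq> DE" for b
    unfolding D_def by (intro symm_funpow symm_H Q that) auto
  from this[of DX] this[of DY] Q0[of x y]
  show "W i j m (- x) y z e = (- 1) ^ i * W i j m x y z e"
    "W i j m x (- y) z e = (- 1) ^ j * W i j m x y z e"
    unfolding W_def symm_def by (auto dest!: bspec[where x = "env x y e"])
qed

lemma W_odd_at_0:
  assumes "0 < z" "0 \<le> e"
  shows "odd i \<Longrightarrow> W i j m 0 y z e = 0" "odd j \<Longrightarrow> W i j m x 0 z e = 0"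
  using W_parity[OF assms, of i j m 0 y] W_parity[OF assms, of i j m x 0] by auto

lemma S_grid:
  assumes "0 < n"
  shows "x * x * sinc_ser 0 (1 / (real n)\<^sup>2 * x\<^sup>2) = (real n)\<^sup>2 / pi\<^sup>2 * (sin (pi * x / real n))\<^sup>2"
proof -
  have "sqrt (x\<^sup>2 / (real n)\<^sup>2) = \<bar>x\<bar> / real n" using assms by (simp add: real_sqrt_divide)
  then have "pi\<^sup>2 * (x\<^sup>2 / (real n)\<^sup>2) * sinc_ser 0 (x\<^sup>2 / (real n)\<^sup>2) = (sin (pi * x / real n))\<^sup>2"
    using sinc_ser_sin[of "x\<^sup>2 / (real n)\<^sup>2"] by (cases "x \<ge> 0") (auto simp: power2_eq_square)
  then show ?thesis using assms by (simp add: field_simps power2_eq_square)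
qed

lemma W_periodic:
  assumes "0 < z" "0 < n"
  defines "e \<equiv> 1 / (real n)\<^sup>2"
  shows "W i j 0 (real n + x) y z e = W i j 0 x y z e"
    and "W i j 0 x (real n + y) z e = W i j 0 x y z e"
proof -
  have e: "0 \<le> e" by (simp add: e_def)
  have per: "sin (pi * (real n + v) / real n) = - sin (pi * v / real n)" for v
  proof -
    have "pi * (real n + v) / real n = pi * v / real n + pi" using assms by (simp add: field_simps)
    then show ?thesis by simp
  qed
  have Q: "Q (\<rho>(b := real n + 1 * \<rho> b)) z = Q \<rho> z" if "b \<noteq> DE" "\<rho> \<in> {\<rho>. \<rho> DE = e}" for \<rho> b
    using that by (cases b) (auto simp: Q_def S_def e_def S_grid[OF assms(2), simplified] per)
  have Q0: "Q (env x y e) z \<noteq> 0" for x y using Q_pos[OF assms(1) e, of x y] by simp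
  have "symm {\<rho>. \<rho> DE = e} b (real n) 1 z ((if DX = b then 1 ^ i else 1) * ((if DY = b then 1 ^ j else 1) * 1)) (D i j 0)"
    if "b \<noteq> DE" for b
    unfolding D_def funpow_0 by (intro symm_funpow symm_H Q that) auto
  from bspec[OF this[of DX, unfolded symm_def], of "env x y e"] bspec[OF this[of DY, unfolded symm_def], of "env x y e"] Q0[of x y]
  show "W i j 0 (real n + x) y z e = W i j 0 x y z e" "W i j 0 x (real n + y) z e = W i j 0 x y z e"
    unfolding W_def by simp_all
qed

lemma W_reflect:
  assumes "0 < z" "0 < n"
  defines "e \<equiv> 1 / (real n)\<^sup>2"
  shows "W i j 0 (real n - x) y z e = (- 1) ^ i * W i j 0 x y z e"
    and "W i j 0 x (real n - y) z e = (- 1) ^ j * W i j 0 x y z e"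
  using W_periodic[OF assms(1,2), of i j "- x" y] W_periodic[OF assms(1,2), of i j x "- y"]
    W_parity[OF assms(1), of e i j 0] by (simp_all add: e_def)

definition swap :: "dir \<Rightarrow> dir" where
  "swap b = (case b of DX \<Rightarrow> DY | DY \<Rightarrow> DX | DE \<Rightarrow> DE)"

lemma swap_simps [simp]: "swap DX = DY" "swap DY = DX" "swap DE = DE" "swap (swap b) = b"
  by (auto simp: swap_def split: dir.splits)

lemma swap_der:
  assumes "\<And>\<rho> :: dir \<Rightarrow> real. Q \<rho> z \<noteq> 0 \<Longrightarrow> ev t (\<rho> \<circ> swap) z = ev t' \<rho> z" and "Q \<rho> z \<noteq> 0"
  shows "ev (der (swap a) t) (\<rho> \<circ> swap) z = ev (der a t') (\<rho> :: dir \<Rightarrow> real) z"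
proof -
  have Q: "Q (\<rho> \<circ> swap) z = Q \<rho> z" by (simp add: Q_def S_def mult_ac)
  have upd: "(\<rho>(a := v)) \<circ> swap = (\<rho> \<circ> swap)(swap a := v)" for v
    by (rule ext) (metis comp_apply fun_upd_apply swap_simps(4))
  have "((\<lambda>v. ev t ((\<rho>(a := v)) \<circ> swap) z) has_field_derivative ev (der a t') \<rho> z) (at (\<rho> a))"
    by (rule has_field_derivative_transform_within_open[OF ev_has_derivative[OF assms(2), of t' a] open_Q_nonzero[of \<rho> a z]])
      (use assms in auto)
  moreover have "((\<lambda>v. ev t ((\<rho>(a := v)) \<circ> swap) z) has_field_derivative ev (der (swap a) t) (\<rho> \<circ> swap) z) (at (\<rho> a))"
    unfolding upd using ev_has_derivative[of "\<rho> \<circ> swap" z t "swap a"] assms(2) Q by simp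
  ultimately show ?thesis by (rule DERIV_unique[symmetric])
qed

lemma W_swap:
  assumes "0 < z" "0 \<le> e"
  shows "W 0 j 0 x y z e = W j 0 0 y x z e"
proof -
  have Q: "Q (\<rho> \<circ> swap) z = Q \<rho> z" for \<rho> :: "dir \<Rightarrow> real" by (simp add: Q_def S_def mult_ac)
  have "ev ((der DY ^^ j) H) (\<rho> \<circ> swap) z = ev ((der DX ^^ j) H) \<rho> z" if "Q \<rho> z \<noteq> 0" for \<rho> :: "dir \<Rightarrow> real"
    using that
  proof (induction j arbitrary: \<rho>)
    case 0
    then show ?case using Q[of \<rho>] by (simp add: H_def comp_def)
  next
    case (Suc j)
    from swap_der[OF Suc.IH Suc.prems, of DX] show ?case by (simp add: comp_def)
  qed
  moreover have "env y x e \<circ> swap = env x y e"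
    by (auto simp: env_def swap_def fun_eq_iff split: dir.splits)
  moreover have "Q (env y x e) z \<noteq> 0" using Q_pos[OF assms, of y x] by simp
  ultimately show ?thesis unfolding W_def D_def by (metis funpow_0)
qed

lemma W_000: "W 0 0 0 x y z e = inverse ((Q (env x y e) z)\<^sup>2)"
  by (simp add: W_def D_def H_def power2_eq_square)

lemma W_Phi0: "W 0 0 0 x y z 0 = inverse ((x\<^sup>2 + y\<^sup>2 + z\<^sup>2)\<^sup>2)"
  by (simp add: W_000 Q_def S_def power2_eq_square)

end

section \<open>Euler--Maclaurin in two variables\<close>

text \<open>A non-integrable function has integral 0 by convention, and B is nonnegative because it
  bounds the value at 0.\<close>

lemma integral_abs_le:
  fixes f :: "real \<Rightarrow> real"
  assumes "\<And>x. x \<in> {0..1} \<Longrightarrow> \<bar>f x\<bar> \<le> B"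
  shows "\<bar>integral {0..1} f\<bar> \<le> B"
proof -
  have B: "0 \<le> B" using assms[of 0] by simp
  show ?thesis
  proof (cases "f integrable_on {0..1}")
    case True
    from has_integral_bound_real[OF B _ integrable_integral[OF True], of "{}"] assms show ?thesis by auto
  qed (simp add: not_integrable_integral B)
qed

text \<open>Sum of the absolute coefficients of \<open>em_end\<close>, with 1/2 rounded up to 1 so
  that the total is at least 1.\<close>

definition em_weight :: "nat \<Rightarrow> real" where
  "em_weight p = 1 + (\<Sum>i\<in>{1..<p}. \<bar>em_coeff i\<bar>)"

definition em_end :: "nat \<Rightarrow> (nat \<Rightarrow> real \<Rightarrow> real) \<Rightarrow> real" where
  "em_end p g = g 0 1 / 2 + (\<Sum>i\<in>{1..<p}. em_coeff i * g i 1)"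

lemma em_end_bound:
  assumes "0 < p" "\<And>i. i < p \<Longrightarrow> \<bar>g i 1\<bar> \<le> K"
  shows "\<bar>em_end p g\<bar> \<le> em_weight p * K"
proof -
  have K: "0 \<le> K" using assms(2)[of 0] assms(1) by simp
  have "\<bar>em_end p g\<bar> \<le> \<bar>g 0 1 / 2\<bar> + \<bar>\<Sum>i\<in>{1..<p}. em_coeff i * g i 1\<bar>"
    unfolding em_end_def by (rule abs_triangle_ineq)
  also have "\<dots> \<le> K + (\<Sum>i\<in>{1..<p}. \<bar>em_coeff i\<bar> * K)"
  proof (intro add_mono order_trans[OF sum_abs] sum_mono)
    show "\<bar>g 0 1 / 2\<bar> \<le> K" using assms(2)[OF assms(1)] K by simp
  qed (auto simp: abs_mult assms intro!: mult_left_mono)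
  finally show ?thesis by (simp add: em_weight_def distrib_right sum_distrib_right)
qed

lemma em_weight_ge_1: "1 \<le> em_weight p"
  by (simp add: em_weight_def sum_nonneg)

text \<open>At the end 0 only the value survives: for odd i the derivative vanishes by hypothesis,
  and for even i \<ge> 2 the coefficient contains the odd Bernoulli number B_(i+1) = 0. All
  derivatives are thus evaluated at 1.\<close>

lemma em_half:
  fixes g :: "nat \<Rightarrow> real \<Rightarrow> real"
  assumes g: "\<And>i x. (g i has_real_derivative g (Suc i) x) (at x)" and p: "odd p" "p \<ge> 3"
    and odd: "\<And>i. odd i \<Longrightarrow> g i 0 = 0"
  shows "((\<lambda>x. bern_poly p x * g p x) has_integral
     fact p * (g 0 0 / 2 - integral {0..1} (g 0) + em_end p g)) {0..1}"
proof -
  have "em_coeff i * (g i 1 - g i 0) = em_coeff i * g i 1" if "i \<in> {1..<p}" for i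
  proof (cases "odd i")
    case False
    then have "bern_num (Suc i) = 0" using that by (intro bern_num_odd) auto
    then show ?thesis by (simp add: em_coeff_def)
  qed (simp add: odd)
  then have "(\<Sum>i\<in>{1..<p}. em_coeff i * (g i 1 - g i 0)) = (\<Sum>i\<in>{1..<p}. em_coeff i * g i 1)"
    by (intro sum.cong) auto
  with em_unit_interval[of g p, OF g p] show ?thesis
    by (simp add: em_end_def add_divide_distrib algebra_simps)
qed

text \<open>The partial derivatives of a smooth function that is even in both variables; evenness is
  recorded through its consequence on the axes.\<close>

locale even_family =
  fixes F :: "nat \<Rightarrow> nat \<Rightarrow> real \<Rightarrow> real \<Rightarrow> real" and p :: nat
  assumes dx: "\<And>i j x y. ((\<lambda>x. F i j x y) has_real_derivative F (Suc i) j x y) (at x)"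
    and dy: "\<And>i j x y. ((\<lambda>y. F i j x y) has_real_derivative F i (Suc j) x y) (at y)"
    and cont: "\<And>i j U. continuous_on U (\<lambda>w. F i j (fst w) (snd w))"
    and odd_x: "\<And>i j y. odd i \<Longrightarrow> F i j 0 y = 0" and odd_y: "\<And>i j x. odd j \<Longrightarrow> F i j x 0 = 0"
    and p: "odd p" "p \<ge> 3"
begin

lemma em_x: "((\<lambda>x. bern_poly p x * F p j x y) has_integral
     fact p * (F 0 j 0 y / 2 - integral {0..1} (\<lambda>x. F 0 j x y) + em_end p (\<lambda>i x. F i j x y))) {0..1}"
  by (rule em_half) (use dx odd_x p in auto)

lemma em_y: "((\<lambda>y. bern_poly p y * F i p x y) has_integral
     fact p * (F i 0 x 0 / 2 - integral {0..1} (\<lambda>y. F i 0 x y) + em_end p (\<lambda>j y. F i j x y))) {0..1}"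
  by (rule em_half) (use dy odd_y p in auto)

lemma cont1: "continuous_on U (\<lambda>x. F i j x y)" "continuous_on U (\<lambda>y. F i j x y)"
  using dx dy by (meson DERIV_isCont continuous_at_imp_continuous_on)+

lemma cont_int: "continuous_on {0..1} (\<lambda>y. integral {0..1} (\<lambda>x. F i j x y))"
  using integral_continuous_on_param[of "{0..1}" 0 1 "\<lambda>y x. F i j x y"]
    continuous_on_compose2[OF cont[where U = UNIV], where f = "\<lambda>w. (snd w, fst w)" and s = "{0..1} \<times> {0..1}"]
  by (simp add: continuous_intros case_prod_beta)

lemma cont_end: "continuous_on U (\<lambda>y. em_end p (\<lambda>i x. F i j x y))"
  "continuous_on U (\<lambda>x. em_end p (\<lambda>j y. F i j x y))"
  unfolding em_end_def by (auto intro!: continuous_intros cont1)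

context
  fixes K :: real
  assumes K: "\<And>i y. i < p \<Longrightarrow> y \<in> {0..1} \<Longrightarrow> \<bar>F i 0 1 y\<bar> \<le> K"
    "\<And>j x. j < p \<Longrightarrow> x \<in> {0..1} \<Longrightarrow> \<bar>F 0 j x 1\<bar> \<le> K"
    "\<And>i j. i < p \<Longrightarrow> j < p \<Longrightarrow> \<bar>F i j 1 1\<bar> \<le> K"
begin

lemma K_nonneg: "0 \<le> K" using K(3)[of 0 0] p by simp

text \<open>The constant K bounds derivatives on the edges x = 1 and y = 1 only. Apart from these
  edge terms, the p-th derivative has been traded for integrals of the function itself over an axis
  and over the square.\<close>

lemma square_single:
  "\<bar>integral {0..1} (\<lambda>y. integral {0..1} (\<lambda>x. bern_poly p x * F p 0 x y))
     - fact p * (integral {0..1} (\<lambda>y. F 0 0 0 y) / 2 - integral {0..1} (\<lambda>y. integral {0..1} (\<lambda>x. F 0 0 x y)))\<bar>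
   \<le> fact p * (em_weight p * K)"
proof -
  have "integral {0..1} (\<lambda>y. integral {0..1} (\<lambda>x. bern_poly p x * F p 0 x y))
    = integral {0..1} (\<lambda>y. fact p * (F 0 0 0 y / 2 - integral {0..1} (\<lambda>x. F 0 0 x y) + em_end p (\<lambda>i x. F i 0 x y)))"
    by (intro integral_cong integral_unique em_x)
  also have "\<dots> = fact p * (integral {0..1} (\<lambda>y. F 0 0 0 y) / 2 - integral {0..1} (\<lambda>y. integral {0..1} (\<lambda>x. F 0 0 x y))
     + integral {0..1} (\<lambda>y. em_end p (\<lambda>i x. F i 0 x y)))"
    by (intro integral_unique has_integral_mult_right has_integral_add has_integral_diff has_integral_divide
      integrable_integral integrable_continuous_real cont1 cont_int cont_end)
  finally show ?thesis
  proof -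
    assume *: "integral {0..1} (\<lambda>y. integral {0..1} (\<lambda>x. bern_poly p x * F p 0 x y)) = fact p * (integral {0..1} (\<lambda>y. F 0 0 0 y) / 2 - integral {0..1} (\<lambda>y. integral {0..1} (\<lambda>x. F 0 0 x y))
     + integral {0..1} (\<lambda>y. em_end p (\<lambda>i x. F i 0 x y)))"
    have "\<bar>integral {0..1} (\<lambda>y. em_end p (\<lambda>i x. F i 0 x y))\<bar> \<le> em_weight p * K"
      by (intro integral_abs_le em_end_bound K) (use p in auto)
    then have "fact p * \<bar>integral {0..1} (\<lambda>y. em_end p (\<lambda>i x. F i 0 x y))\<bar> \<le> fact p * (em_weight p * K)"
      by (intro mult_left_mono) auto
    then show ?thesis unfolding * by (simp add: abs_mult algebra_simps)
  qed
qed

text \<open>\<open>em_half\<close> in x and then in y: the product structure gives a quarter of the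
  corner value, minus half of each axis integral, plus the integral over the square. The remaining
  terms lie on far edges and add up to at most 1/2 + 1 + 3 times the squared weight, rounded to
  5.\<close>

lemma square_double:
  "\<bar>integral {0..1} (\<lambda>y. integral {0..1} (\<lambda>x. bern_poly p x * bern_poly p y * F p p x y))
     - (fact p)\<^sup>2 * (F 0 0 0 0 / 4 - integral {0..1} (\<lambda>y. F 0 0 0 y) / 2 - integral {0..1} (\<lambda>x. F 0 0 x 0) / 2
          + integral {0..1} (\<lambda>y. integral {0..1} (\<lambda>x. F 0 0 x y)))\<bar>
   \<le> (fact p)\<^sup>2 * (5 * (em_weight p)\<^sup>2 * K)"
proof -
  define T where "T i x = F i 0 x 0 / 2 - integral {0..1} (\<lambda>y. F i 0 x y) + em_end p (\<lambda>j y. F i j x y)" for i x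
  define w where "w = em_weight p"
  have w: "1 \<le> w" by (simp add: w_def em_weight_ge_1)
  have em_T: "((\<lambda>y. bern_poly p y * F i p x y) has_integral fact p * T i x) {0..1}" for i x
    unfolding T_def by (rule em_y)
  have contb: "continuous_on {0..1} (\<lambda>y. bern_poly p y * integral {0..1} (\<lambda>x. F 0 p x y))"
    by (intro continuous_intros cont_int)
  \<comment> \<open>The inner x-integral is brought outside so that \<open>em_y\<close> applies at
    each fixed x.\<close>
  have swap: "integral {0..1} (\<lambda>y. bern_poly p y * integral {0..1} (\<lambda>x. F 0 p x y)) = fact p * integral {0..1} (T 0)"
  proof -
    have "integral {0..1} (\<lambda>y. bern_poly p y * integral {0..1} (\<lambda>x. F 0 p x y))
      = integral {0..1} (\<lambda>y. integral {0..1} (\<lambda>x. bern_poly p y * F 0 p x y))"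
      by simp
    also have "\<dots> = integral {0..1} (\<lambda>x. integral {0..1} (\<lambda>y. bern_poly p y * F 0 p x y))"
      using integral_swap_continuous[of 0 0 1 1 "\<lambda>x y. bern_poly p y * F 0 p x y"]
      by (simp add: case_prod_beta continuous_intros cont)
    also have "\<dots> = integral {0..1} (\<lambda>x. fact p * T 0 x)"
      by (intro integral_cong integral_unique em_T)
    finally show ?thesis by simp
  qed
  have "integral {0..1} (\<lambda>y. integral {0..1} (\<lambda>x. bern_poly p x * bern_poly p y * F p p x y))
    = integral {0..1} (\<lambda>y. bern_poly p y * (fact p * (F 0 p 0 y / 2 - integral {0..1} (\<lambda>x. F 0 p x y) + em_end p (\<lambda>i x. F i p x y))))"
  proof (rule integral_cong)
    fix y
    have "integral {0..1} (\<lambda>x. bern_poly p y * (bern_poly p x * F p p x y))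
      = bern_poly p y * integral {0..1} (\<lambda>x. bern_poly p x * F p p x y)"
      by simp
    then show "integral {0..1} (\<lambda>x. bern_poly p x * bern_poly p y * F p p x y)
      = bern_poly p y * (fact p * (F 0 p 0 y / 2 - integral {0..1} (\<lambda>x. F 0 p x y) + em_end p (\<lambda>i x. F i p x y)))"
      unfolding integral_unique[OF em_x] by (simp add: mult_ac)
  qed
  also have "\<dots> = fact p * (fact p * (T 0 0 / 2 - integral {0..1} (T 0) + em_end p T))"
  proof (rule integral_unique)
    have "((\<lambda>y. fact p * ((bern_poly p y * F 0 p 0 y) / 2 - bern_poly p y * integral {0..1} (\<lambda>x. F 0 p x y)
       + ((bern_poly p y * F 0 p 1 y) / 2 + (\<Sum>i\<in>{1..<p}. em_coeff i * (bern_poly p y * F i p 1 y))))) has_integral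
       fact p * ((fact p * T 0 0) / 2 - integral {0..1} (\<lambda>y. bern_poly p y * integral {0..1} (\<lambda>x. F 0 p x y))
       + ((fact p * T 0 1) / 2 + (\<Sum>i\<in>{1..<p}. em_coeff i * (fact p * T i 1))))) {0..1}"
      by (intro has_integral_mult_right has_integral_add has_integral_diff has_integral_divide has_integral_sum em_T
        integrable_integral integrable_continuous_real contb) auto
    moreover have "(\<lambda>y. fact p * ((bern_poly p y * F 0 p 0 y) / 2 - bern_poly p y * integral {0..1} (\<lambda>x. F 0 p x y)
       + ((bern_poly p y * F 0 p 1 y) / 2 + (\<Sum>i\<in>{1..<p}. em_coeff i * (bern_poly p y * F i p 1 y)))))
      = (\<lambda>y. bern_poly p y * (fact p * (F 0 p 0 y / 2 - integral {0..1} (\<lambda>x. F 0 p x y) + em_end p (\<lambda>i x. F i p x y))))"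
      by (simp add: fun_eq_iff em_end_def algebra_simps sum_distrib_left)
    moreover have "fact p * ((fact p * T 0 0) / 2 - fact p * integral {0..1} (T 0)
       + ((fact p * T 0 1) / 2 + (\<Sum>i\<in>{1..<p}. em_coeff i * (fact p * T i 1))))
      = fact p * (fact p * (T 0 0 / 2 - integral {0..1} (T 0) + em_end p T))"
      by (simp add: em_end_def algebra_simps sum_distrib_left)
    ultimately show "((\<lambda>y. bern_poly p y * (fact p * (F 0 p 0 y / 2 - integral {0..1} (\<lambda>x. F 0 p x y) + em_end p (\<lambda>i x. F i p x y)))) has_integral
       fact p * (fact p * (T 0 0 / 2 - integral {0..1} (T 0) + em_end p T))) {0..1}"
      unfolding swap by simp
  qed
  finally have 1: "integral {0..1} (\<lambda>y. integral {0..1} (\<lambda>x. bern_poly p x * bern_poly p y * F p p x y))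
     = fact p * (fact p * (T 0 0 / 2 - integral {0..1} (T 0) + em_end p T))" .
  have end0: "\<bar>em_end p (\<lambda>j y. F 0 j x y)\<bar> \<le> w * K" if "x \<in> {0..1}" for x
    unfolding w_def using that p by (intro em_end_bound K) auto
  have intT: "integral {0..1} (T 0) = integral {0..1} (\<lambda>x. F 0 0 x 0) / 2
     - integral {0..1} (\<lambda>y. integral {0..1} (\<lambda>x. F 0 0 x y)) + integral {0..1} (\<lambda>x. em_end p (\<lambda>j y. F 0 j x y))"
  proof -
    have sw: "integral {0..1} (\<lambda>x. integral {0..1} (\<lambda>y. F 0 0 x y)) = integral {0..1} (\<lambda>y. integral {0..1} (\<lambda>x. F 0 0 x y))"
      using integral_swap_continuous[of 0 0 1 1 "\<lambda>x y. F 0 0 x y"] by (simp add: case_prod_beta cont)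
    have c: "continuous_on {0..1} (\<lambda>x. integral {0..1} (\<lambda>y. F 0 0 x y))"
      using integral_continuous_on_param[of "{0..1}" 0 1 "\<lambda>x y. F 0 0 x y"] cont
      by (simp add: case_prod_beta)
    show ?thesis unfolding T_def sw[symmetric]
      by (intro integral_unique has_integral_add has_integral_diff has_integral_divide
        integrable_integral integrable_continuous_real cont1 c cont_end)
  qed
  \<comment> \<open>The value T i 1 has three parts, on the edge x = 1 or at its corner (1,1), each
    at most the weight times K; the outer boundary functional brings a second factor of the
    weight.\<close>
  have bT: "\<bar>em_end p T\<bar> \<le> w * (3 * w * K)"
    unfolding w_def
  proof (rule em_end_bound)
    fix i assume i: "i < p"
    have "\<bar>F i 0 1 0\<bar> \<le> K" "\<bar>integral {0..1} (\<lambda>y. F i 0 1 y)\<bar> \<le> K" "\<bar>em_end p (\<lambda>j y. F i j 1 y)\<bar> \<le> em_weight p * K"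
      using i p by (intro K integral_abs_le em_end_bound; auto)+
    moreover have "K \<le> em_weight p * K" using em_weight_ge_1 K_nonneg mult_right_mono[of 1 "em_weight p" K] by simp
    ultimately show "\<bar>T i 1\<bar> \<le> 3 * em_weight p * K" unfolding T_def by linarith
  qed (use p in simp)
  have "T 0 0 / 2 - integral {0..1} (T 0) + em_end p T
     - (F 0 0 0 0 / 4 - integral {0..1} (\<lambda>y. F 0 0 0 y) / 2 - integral {0..1} (\<lambda>x. F 0 0 x 0) / 2
          + integral {0..1} (\<lambda>y. integral {0..1} (\<lambda>x. F 0 0 x y)))
     = em_end p (\<lambda>j y. F 0 j 0 y) / 2 - integral {0..1} (\<lambda>x. em_end p (\<lambda>j y. F 0 j x y)) + em_end p T"
    unfolding intT by (simp add: T_def field_simps)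
  moreover have "\<bar>em_end p (\<lambda>j y. F 0 j 0 y)\<bar> \<le> w * K" "\<bar>integral {0..1} (\<lambda>x. em_end p (\<lambda>j y. F 0 j x y))\<bar> \<le> w * K"
    by (intro end0 integral_abs_le; simp)+
  moreover have "w * K \<le> w\<^sup>2 * K" 
    using w K_nonneg by (intro mult_right_mono) (auto simp: power2_eq_square)
  moreover have "w * (3 * w * K) = 3 * (w\<^sup>2 * K)" by (simp add: power2_eq_square)
  ultimately have "\<bar>T 0 0 / 2 - integral {0..1} (T 0) + em_end p T
     - (F 0 0 0 0 / 4 - integral {0..1} (\<lambda>y. F 0 0 0 y) / 2 - integral {0..1} (\<lambda>x. F 0 0 x 0) / 2
          + integral {0..1} (\<lambda>y. integral {0..1} (\<lambda>x. F 0 0 x y)))\<bar> \<le> 5 * (w\<^sup>2 * K)"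
    using bT by linarith
  then have "(fact p)\<^sup>2 * \<bar>T 0 0 / 2 - integral {0..1} (T 0) + em_end p T
     - (F 0 0 0 0 / 4 - integral {0..1} (\<lambda>y. F 0 0 0 y) / 2 - integral {0..1} (\<lambda>x. F 0 0 x 0) / 2
          + integral {0..1} (\<lambda>y. integral {0..1} (\<lambda>x. F 0 0 x y)))\<bar> \<le> (fact p)\<^sup>2 * (5 * w\<^sup>2 * K)"
    by (intro mult_left_mono) auto
  moreover have "a * (a * c) - a\<^sup>2 * d = a\<^sup>2 * (c - d)" for a c d :: real
    by (simp add: power2_eq_square algebra_simps)
  ultimately show ?thesis unfolding 1 w_def by (simp only: abs_mult) simp
qed

end

end

section \<open>A product majorant on the quadrant\<close>

lemma set_integral_inverse_square:
  assumes "0 < z"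
  shows "set_integrable lborel {0..} (\<lambda>x. inverse (z\<^sup>2 + x\<^sup>2))"
    and "(LINT x:{0..}|lborel. inverse (z\<^sup>2 + x\<^sup>2)) = pi / (2 * z)"
proof -
  define g where "g x = indicator {0..} x * inverse (z\<^sup>2 + x\<^sup>2)" for x :: real
  have nz: "z\<^sup>2 + x\<^sup>2 > 0" for x using assms by (intro add_pos_nonneg) auto
  have d: "((\<lambda>x. arctan (x / z) / z) has_real_derivative inverse (z\<^sup>2 + x\<^sup>2)) (at x)" for x
  proof -
    have "1 + (x / z)\<^sup>2 = (z\<^sup>2 + x\<^sup>2) / z\<^sup>2" using assms by (simp add: power_divide add_divide_distrib)
    then have "inverse (1 + (x / z)\<^sup>2) * (1 / z) / z = inverse (z\<^sup>2 + x\<^sup>2)"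
      using assms by (simp add: power2_eq_square inverse_eq_divide)
    moreover have "((\<lambda>x. arctan (x / z) / z) has_real_derivative inverse (1 + (x / z)\<^sup>2) * (1 / z) / z) (at x)"
      by (intro DERIV_cdivide DERIV_chain2[OF DERIV_arctan] DERIV_ident)
    ultimately show ?thesis by simp
  qed
  have "((\<lambda>x. arctan (x / z) / z) \<longlongrightarrow> (pi / 2) / z) at_top"
    using assms by (intro tendsto_divide tendsto_const filterlim_compose[OF tendsto_arctan_at_top])
      (auto intro!: filterlim_tendsto_pos_mult_at_top[OF tendsto_const _ filterlim_ident, of "1 / z", simplified])
  then have "(\<integral>\<^sup>+x. ennreal (inverse (z\<^sup>2 + x\<^sup>2)) * indicator {0..} x \<partial>lborel) = pi / (2 * z)"
    using nn_integral_FTC_atLeast[of "\<lambda>x. inverse (z\<^sup>2 + x\<^sup>2)" 0 "\<lambda>x. arctan (x / z) / z" "pi / 2 / z"] d nz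
    by (simp add: less_imp_le)
  then have "(\<integral>\<^sup>+x. ennreal (g x) \<partial>lborel) = ennreal (pi / (2 * z))"
  proof -
    assume *: "(\<integral>\<^sup>+x. ennreal (inverse (z\<^sup>2 + x\<^sup>2)) * indicator {0..} x \<partial>lborel) = pi / (2 * z)"
    have "ennreal (g x) = ennreal (inverse (z\<^sup>2 + x\<^sup>2)) * indicator {0..} x" for x
      by (auto simp: g_def indicator_def)
    then show ?thesis using * by simp
  qed
  moreover have "AE x in lborel. 0 \<le> g x" using nz by (auto simp: g_def less_imp_le)
  moreover have "g \<in> borel_measurable lborel" unfolding g_def by measurable
  moreover have "0 \<le> pi / (2 * z)" using assms by simp
  ultimately have "integrable lborel g \<and> integral\<^sup>L lborel g = pi / (2 * z)"
    using nn_integral_eq_integrable by blast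
  then show "set_integrable lborel {0..} (\<lambda>x. inverse (z\<^sup>2 + x\<^sup>2))"
    "(LINT x:{0..}|lborel. inverse (z\<^sup>2 + x\<^sup>2)) = pi / (2 * z)"
    by (simp_all add: set_integrable_def set_lebesgue_integral_def g_def[abs_def])
qed

lemma integrable_product_fst_snd:
  fixes f g :: "real \<Rightarrow> real"
  assumes f: "integrable lborel f" "\<And>x. 0 \<le> f x" and g: "integrable lborel g" "\<And>x. 0 \<le> g x"
  shows "integrable lborel (\<lambda>w. f (fst w) * g (snd w))"
    and "(LINT w|lborel. f (fst w) * g (snd w)) = integral\<^sup>L lborel f * integral\<^sup>L lborel g"
proof -
  have [measurable]: "f \<in> borel_measurable borel" "g \<in> borel_measurable borel" using f g by auto
  have nn: "(\<integral>\<^sup>+x. ennreal (f x) \<partial>lborel) = ennreal (integral\<^sup>L lborel f)"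
    "(\<integral>\<^sup>+x. ennreal (g x) \<partial>lborel) = ennreal (integral\<^sup>L lborel g)"
    using f g by (auto intro!: nn_integral_eq_integral)
  have "(\<integral>\<^sup>+w. ennreal (f (fst w) * g (snd w)) \<partial>lborel) = (\<integral>\<^sup>+x. \<integral>\<^sup>+y. ennreal (f x) * ennreal (g y) \<partial>lborel \<partial>lborel)"
    unfolding lborel_prod[symmetric] by (subst lborel.nn_integral_fst[symmetric]) (auto simp: ennreal_mult f g)
  also have "\<dots> = ennreal (integral\<^sup>L lborel f * integral\<^sup>L lborel g)"
    by (simp add: nn_integral_cmult nn_integral_multc nn ennreal_mult f g)
  finally have "(\<integral>\<^sup>+w. ennreal (f (fst w) * g (snd w)) \<partial>lborel) = ennreal (integral\<^sup>L lborel f * integral\<^sup>L lborel g)" .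
  moreover have "AE w in lborel. 0 \<le> f (fst w) * g (snd w)" using f g by auto
  moreover have "(\<lambda>w. f (fst w) * g (snd w)) \<in> borel_measurable (lborel :: (real \<times> real) measure)"
    by (simp add: borel_prod[symmetric])
  moreover have "0 \<le> integral\<^sup>L lborel f * integral\<^sup>L lborel g" using f g by simp
  ultimately have "integrable lborel (\<lambda>w. f (fst w) * g (snd w)) \<and> (LINT w|lborel. f (fst w) * g (snd w)) = integral\<^sup>L lborel f * integral\<^sup>L lborel g"
    using nn_integral_eq_integrable by blast
  then show "integrable lborel (\<lambda>w. f (fst w) * g (snd w))"
    "(LINT w|lborel. f (fst w) * g (snd w)) = integral\<^sup>L lborel f * integral\<^sup>L lborel g" by auto
qed

text \<open>Dominates r^-4, since both z^2 + x^2 and z^2 + y^2 are at most r^2, and factors into two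
  arctangent integrals.\<close>

definition maj :: "real \<Rightarrow> real \<times> real \<Rightarrow> real" where
  "maj z w = inverse (z\<^sup>2 + (fst w)\<^sup>2) * inverse (z\<^sup>2 + (snd w)\<^sup>2)"

abbreviation quadrant :: "(real \<times> real) set" where "quadrant \<equiv> {0..} \<times> {0..}"

lemma maj_nonneg [simp]: "0 \<le> maj z w"
  by (simp add: maj_def)

lemma set_integral_maj:
  assumes "0 < z"
  shows "set_integrable lborel quadrant (maj z)" "(LINT w:quadrant|lborel. maj z w) = (pi / (2 * z))\<^sup>2"
proof -
  have "integrable lborel (\<lambda>w. (indicator {0..} (fst w) * inverse (z\<^sup>2 + (fst w)\<^sup>2)) * (indicator {0..} (snd w) * inverse (z\<^sup>2 + (snd w)\<^sup>2)))"
    "(LINT w|lborel. (indicator {0..} (fst w) * inverse (z\<^sup>2 + (fst w)\<^sup>2)) * (indicator {0..} (snd w) * inverse (z\<^sup>2 + (snd w)\<^sup>2))) = (pi / (2 * z)) * (pi / (2 * z))"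
    using integrable_product_fst_snd[of "\<lambda>x. indicator {0..} x * inverse (z\<^sup>2 + x\<^sup>2)" "\<lambda>x. indicator {0..} x * inverse (z\<^sup>2 + x\<^sup>2)"]
      set_integral_inverse_square[OF assms] unfolding set_integrable_def set_lebesgue_integral_def by auto
  moreover have "(indicator {0..} (fst w) * inverse (z\<^sup>2 + (fst w)\<^sup>2)) * (indicator {0..} (snd w) * inverse (z\<^sup>2 + (snd w)\<^sup>2))
    = indicator quadrant w *\<^sub>R maj z w" for w :: "real \<times> real"
    by (cases w) (auto simp: maj_def indicator_def)
  ultimately show "set_integrable lborel quadrant (maj z)" "(LINT w:quadrant|lborel. maj z w) = (pi / (2 * z))\<^sup>2"
    by (simp_all add: set_integrable_def set_lebesgue_integral_def power2_eq_square)
qed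

lemma set_integral_maj_bound:
  fixes F :: "real \<times> real \<Rightarrow> real"
  assumes z: "0 < z" and F: "F \<in> borel_measurable borel" and A: "A \<in> sets borel" "A \<subseteq> quadrant"
    and b: "\<And>w. w \<in> A \<Longrightarrow> \<bar>F w\<bar> \<le> c * maj z w" and c: "0 \<le> c"
  shows "set_integrable lborel A F" "\<bar>LINT w:A|lborel. F w\<bar> \<le> c * (pi / (2 * z))\<^sup>2"
proof -
  have [measurable]: "F \<in> borel_measurable borel" "A \<in> sets borel" "quadrant \<in> sets borel" using F A
    by (auto intro!: borel_closed closed_Times)
  have [measurable]: "maj z \<in> borel_measurable borel" unfolding maj_def borel_prod[symmetric] by measurable
  have i: "integrable lborel (\<lambda>w. indicator quadrant w *\<^sub>R (c * maj z w))"
    using set_integrable_mult_right[OF set_integral_maj(1)[OF z], of c] by (simp add: set_integrable_def)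
  have le: "norm (indicator A w *\<^sub>R F w) \<le> norm (indicator quadrant w *\<^sub>R (c * maj z w))" for w
    using b[of w] A c by (auto simp: indicator_def)
  show I: "set_integrable lborel A F" unfolding set_integrable_def
    by (rule Bochner_Integration.integrable_bound[OF i]) (use le in auto)
  have "\<bar>LINT w:A|lborel. F w\<bar> \<le> (LINT w|lborel. norm (indicator A w *\<^sub>R F w))"
    unfolding set_lebesgue_integral_def using integral_norm_bound[of lborel "\<lambda>w. indicator A w *\<^sub>R F w"] by simp
  also have "\<dots> \<le> (LINT w|lborel. indicator quadrant w *\<^sub>R (c * maj z w))"
    using I i le c by (intro integral_mono integrable_norm) (auto simp: set_integrable_def indicator_def abs_mult)
  also have "\<dots> = c * (pi / (2 * z))\<^sup>2"
    using set_integral_maj(2)[OF z] by (simp add: set_lebesgue_integral_def mult.left_commute)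
  finally show "\<bar>LINT w:A|lborel. F w\<bar> \<le> c * (pi / (2 * z))\<^sup>2" .
qed

lemma integrable_maj_section:
  assumes "0 < z" "0 \<le> y"
  shows "set_integrable lborel {0..} (\<lambda>x. maj z (x, y))"
  using set_integrable_mult_left[OF set_integral_inverse_square(1)[OF assms(1)], of "inverse (z\<^sup>2 + y\<^sup>2)"]
  by (simp add: maj_def)

text \<open>Bridge from the iterated gauge integrals of \<open>bcoef\<close> to Lebesgue integrals
  over the product. Domination by \<open>maj\<close> makes every single section integrable, not just
  almost every one.\<close>

lemma nested_integral_eq:
  fixes F :: "real \<times> real \<Rightarrow> real"
  assumes z: "0 < z" and F: "F \<in> borel_measurable borel"
    and A: "A \<in> sets borel" "A \<subseteq> {0..}" and B: "B \<in> sets borel" "B \<subseteq> {0..}"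
    and b: "\<And>x y. x \<in> A \<Longrightarrow> y \<in> B \<Longrightarrow> \<bar>F (x, y)\<bar> \<le> c * maj z (x, y)" and c: "0 \<le> c"
  shows "integral B (\<lambda>y. integral A (\<lambda>x. F (x, y))) = (LINT w:A \<times> B|lborel. F w)"
proof -
  have [measurable]: "A \<in> sets borel" "B \<in> sets borel" "F \<in> borel_measurable (borel \<Otimes>\<^sub>M borel)"
    using assms by (auto simp: borel_prod)
  have AB: "A \<times> B \<in> sets borel" unfolding borel_prod[symmetric] by measurable
  define f where "f x y = indicator A x * (indicator B y * F (x, y))" for x y
  have f_eq: "case_prod f = (\<lambda>w. indicator (A \<times> B) w *\<^sub>R F w)"
    by (auto simp: f_def fun_eq_iff indicator_def)
  have "set_integrable lborel (A \<times> B) F"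
    by (rule set_integral_maj_bound[OF z F AB _ _ c]) (use A B b in auto)
  then have f: "integrable (lborel \<Otimes>\<^sub>M lborel) (case_prod f)"
    unfolding lborel_prod f_eq by (simp add: set_integrable_def)
  have inner: "(LINT x|lborel. f x y) = indicator B y *\<^sub>R integral A (\<lambda>x. F (x, y))" for y
  proof (cases "y \<in> B")
    case True
    have "integrable lborel (\<lambda>x. indicator {0..} x *\<^sub>R (c * maj z (x, y)))"
      using set_integrable_mult_right[OF integrable_maj_section[OF z, of y], of c] True B by (auto simp: set_integrable_def)
    then have "set_integrable lborel A (\<lambda>x. F (x, y))" unfolding set_integrable_def
    proof (rule Bochner_Integration.integrable_bound)
      show "AE x in lborel. norm (indicator A x *\<^sub>R F (x, y)) \<le> norm (indicator {0..} x *\<^sub>R (c * maj z (x, y)))"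
        using b[OF _ True] A c by (auto simp: indicator_def)
    qed measurable
    from set_borel_integral_eq_integral(2)[OF this] True show ?thesis
      by (simp add: f_def set_lebesgue_integral_def)
  qed (simp add: f_def)
  have "integrable lborel (\<lambda>y. LINT x|lborel. f x y)" by (rule lborel_pair.integrable_snd[OF f])
  then have "set_integrable lborel B (\<lambda>y. integral A (\<lambda>x. F (x, y)))"
    unfolding inner set_integrable_def .
  from set_borel_integral_eq_integral(2)[OF this]
  have "integral B (\<lambda>y. integral A (\<lambda>x. F (x, y))) = (LINT y|lborel. LINT x|lborel. f x y)"
    unfolding inner set_lebesgue_integral_def by simp
  also have "\<dots> = (LINT w:A \<times> B|lborel. F w)"
    unfolding lborel_pair.integral_snd[OF f] unfolding lborel_prod f_eq set_lebesgue_integral_def by simp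
  finally show ?thesis .
qed

lemma set_integral_swap:
  fixes F :: "real \<times> real \<Rightarrow> real"
  assumes F: "F \<in> borel_measurable borel" and A: "A \<in> sets borel"
  shows "(LINT w:A \<times> A|lborel. F (snd w, fst w)) = (LINT w:A \<times> A|lborel. F w)"
proof -
  have [measurable]: "A \<in> sets borel" "F \<in> borel_measurable (borel \<Otimes>\<^sub>M borel)" "A \<times> A \<in> sets (borel \<Otimes>\<^sub>M borel)"
    using assms by (auto simp: borel_prod)
  have "(\<lambda>w. indicator (A \<times> A) w *\<^sub>R F w) \<in> borel_measurable (lborel \<Otimes>\<^sub>M lborel)"
    by measurable
  from lborel_pair.integral_product_swap[OF this] show ?thesis
    unfolding lborel_prod set_lebesgue_integral_def
    by (simp add: case_prod_beta' indicator_def mem_Times_iff conj_commute)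
qed

section \<open>Euler-Maclaurin over the periodic square\<close>

definition bern_per :: "nat \<Rightarrow> real \<Rightarrow> real" where
  "bern_per p x = bern_poly p (x - of_int \<lfloor>x\<rfloor>)"

lemma borel_measurable_bern_per [measurable]: "bern_per p \<in> borel_measurable borel"
proof -
  have "bern_poly p \<in> borel_measurable borel" by (intro borel_measurable_continuous_onI continuous_intros)
  then show ?thesis unfolding bern_per_def[abs_def] by (rule measurable_compose_rev) measurable
qed

lemma bern_per_bounded: "\<exists>b\<ge>1. \<forall>x. \<bar>bern_per p x\<bar> \<le> b"
proof -
  have "compact (bern_poly p ` {0..1})" by (intro compact_continuous_image continuous_intros) auto
  then obtain b where b: "\<And>x. x \<in> {0..1} \<Longrightarrow> \<bar>bern_poly p x\<bar> \<le> b"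
    by (fastforce dest: compact_imp_bounded simp: bounded_iff)
  have "\<bar>bern_per p x\<bar> \<le> max b 1" for x
  proof -
    have "x - of_int \<lfloor>x\<rfloor> \<in> {0..1}" using frac_ge_0[of x] frac_lt_1[of x] by (simp add: frac_def less_imp_le)
    from b[OF this] show ?thesis by (simp add: bern_per_def)
  qed
  then show ?thesis by (intro exI[of _ "max b 1"]) auto
qed

lemma bern_per_unit:
  assumes "x \<in> {0..1}" "p \<ge> 2"
  shows "bern_per p x = bern_poly p x"
proof (cases "x = 1")
  case True
  then show ?thesis using assms by (simp add: bern_per_def bern_poly_at_0 bern_poly_at_1)
next
  case False
  with assms have "\<lfloor>x\<rfloor> = 0" by (intro floor_unique) auto
  then show ?thesis by (simp add: bern_per_def)
qed

text \<open>Away from the integers this is the reflection of B_p for odd p; at an integer both sides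
  are B_p(0) = 0.\<close>

lemma bern_per_reflect:
  assumes "odd p" "p \<ge> 3"
  shows "bern_per p (real n - x) = - bern_per p x"
proof (cases "x \<in> \<int>")
  case True
  then obtain k where "x = of_int k" by (auto elim: Ints_cases)
  then have "\<lfloor>real n - x\<rfloor> = int n - k" "\<lfloor>x\<rfloor> = k"
    by (metis floor_of_int of_int_diff of_int_of_nat_eq, simp)
  then show ?thesis using assms \<open>x = of_int k\<close> by (simp add: bern_per_def bern_poly_at_0 bern_num_odd)
next
  case False
  then have "of_int \<lfloor>x\<rfloor> \<noteq> x" by (metis Ints_of_int)
  then have "of_int \<lfloor>x\<rfloor> < x" using of_int_floor_le[of x] by linarith
  then have "\<lfloor>real n - x\<rfloor> = int n - \<lfloor>x\<rfloor> - 1" by (intro floor_unique) (simp_all, linarith+)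
  then have "real n - x - of_int \<lfloor>real n - x\<rfloor> = 1 - (x - of_int \<lfloor>x\<rfloor>)" by simp
  then show ?thesis using assms unfolding bern_per_def by (simp only: bern_poly_reflect) simp
qed

lemma integral_reflect_half:
  fixes f :: "real \<Rightarrow> real"
  assumes "0 \<le> N" and f: "\<And>x. f (N - x) = f x"
  shows "integral {0..N} f = 2 * integral {0..N / 2} f"
proof (cases "f integrable_on {0..N / 2}")
  case True
  define I where "I = integral {0..N / 2} f"
  have I: "(f has_integral I) {0..N / 2}" using True by (simp add: I_def integrable_integral)
  have "(f has_integral I) {N / 2..N}"
    using has_integral_affinity[of f I 0 "N / 2" "- 1" N] I assms
    by (simp add: image_affinity_atLeastAtMost_diff add.commute)
  from has_integral_combine[OF _ _ I this] assms show ?thesis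
    by (simp add: integral_unique flip: I_def)
next
  case False
  then have "\<not> f integrable_on {0..N}"
    using assms integrable_on_subinterval[of f "{0..N}" 0 "N / 2"] by auto
  with False show ?thesis by (simp add: not_integrable_integral)
qed

lemma nested_reflect_half:
  fixes h :: "real \<Rightarrow> real \<Rightarrow> real"
  assumes "0 \<le> N" "\<And>x y. h (N - x) y = h x y" "\<And>x y. h x (N - y) = h x y"
  shows "integral {0..N} (\<lambda>y. integral {0..N} (\<lambda>x. h x y))
    = 4 * integral {0..N / 2} (\<lambda>y. integral {0..N / 2} (\<lambda>x. h x y))"
proof -
  have "integral {0..N} (\<lambda>x. h x y) = 2 * integral {0..N / 2} (\<lambda>x. h x y)" for y
    by (rule integral_reflect_half) (use assms in auto)
  then have "integral {0..N} (\<lambda>y. integral {0..N} (\<lambda>x. h x y)) = 2 * integral {0..N} (\<lambda>y. integral {0..N / 2} (\<lambda>x. h x y))"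
    by simp
  also have "integral {0..N} (\<lambda>y. integral {0..N / 2} (\<lambda>x. h x y)) = 2 * integral {0..N / 2} (\<lambda>y. integral {0..N / 2} (\<lambda>x. h x y))"
    by (rule integral_reflect_half) (use assms in auto)
  finally show ?thesis by simp
qed

text \<open>\<open>maj\<close> has a positive minimum on the square, so boundedness is the same as
  domination there, and compact squares can use the integration lemmas of the quadrant.\<close>

lemma bounded_by_maj:
  fixes F :: "real \<times> real \<Rightarrow> real"
  assumes z: "0 < z" and N: "0 \<le> N" and cont: "continuous_on ({0..N} \<times> {0..N}) F"
  shows "\<exists>c\<ge>0. \<forall>w\<in>{0..N} \<times> {0..N}. \<bar>F w\<bar> \<le> c * maj z w"
proof -
  have "compact (F ` ({0..N} \<times> {0..N}))"
    by (intro compact_continuous_image compact_Times cont) auto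
  then obtain b where b: "\<And>w. w \<in> {0..N} \<times> {0..N} \<Longrightarrow> \<bar>F w\<bar> \<le> b"
    by (fastforce dest: compact_imp_bounded simp: bounded_iff)
  have b0: "0 \<le> b" using b[of "(0, 0)"] N by auto
  define m where "m = inverse (z\<^sup>2 + N\<^sup>2)"
  have m: "0 < m" using z by (simp add: m_def add_pos_nonneg)
  have "\<bar>F w\<bar> \<le> (b / (m * m)) * maj z w" if w: "w \<in> {0..N} \<times> {0..N}" for w
  proof -
    have "m \<le> inverse (z\<^sup>2 + x\<^sup>2)" if "0 \<le> x" "x \<le> N" for x
      unfolding m_def using that z by (intro le_imp_inverse_le add_mono power_mono) (auto intro: add_pos_nonneg)
    then have "m * m \<le> maj z w" unfolding maj_def using w m by (intro mult_mono) auto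
    then have "(b / (m * m)) * (m * m) \<le> (b / (m * m)) * maj z w"
      using b0 m by (intro mult_left_mono) auto
    then show ?thesis using b[OF w] m by simp
  qed
  then show ?thesis using b0 m by (intro exI[of _ "b / (m * m)"]) auto
qed

definition J1 :: "nat \<Rightarrow> (nat \<Rightarrow> nat \<Rightarrow> real \<Rightarrow> real \<Rightarrow> real) \<Rightarrow> (real \<times> real) set \<Rightarrow> real" where
  "J1 p F A = (LINT w:A|lborel. bern_per p (fst w) * F p 0 (fst w) (snd w))"

definition J2 :: "nat \<Rightarrow> (nat \<Rightarrow> nat \<Rightarrow> real \<Rightarrow> real \<Rightarrow> real) \<Rightarrow> (real \<times> real) set \<Rightarrow> real" where
  "J2 p F A = (LINT w:A|lborel. bern_per p (fst w) * bern_per p (snd w) * F p p (fst w) (snd w))"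

text \<open>The 8 is 2 times 4: two variables in the single term, four reflected quarters of the
  cell. The double term has only the four quarters.\<close>

definition em_kernel :: "nat \<Rightarrow> (nat \<Rightarrow> nat \<Rightarrow> real \<Rightarrow> real \<Rightarrow> real) \<Rightarrow> (real \<times> real) set \<Rightarrow> real" where
  "em_kernel p F A = 8 / fact p * J1 p F A + 4 / (fact p)\<^sup>2 * J2 p F A"

definition hbox :: "nat \<Rightarrow> (real \<times> real) set" where
  "hbox n = {0..real n / 2} \<times> {0..real n / 2}"

text \<open>In each variable summation is integration of F + B_p F^(p) / p!. The product of the two
  operations has four terms, \<open>h1\<close> to \<open>h4\<close>; the two mixed ones agree
  because F is symmetric under exchange of x and y.\<close>

lemma periodic_em_2d:
  fixes F :: "nat \<Rightarrow> nat \<Rightarrow> real \<Rightarrow> real \<Rightarrow> real"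
  assumes dx: "\<And>i j x y. ((\<lambda>x. F i j x y) has_real_derivative F (Suc i) j x y) (at x)"
    and dy: "\<And>i j x y. ((\<lambda>y. F i j x y) has_real_derivative F i (Suc j) x y) (at y)"
    and cont: "\<And>i j U. continuous_on U (\<lambda>w. F i j (fst w) (snd w))"
    and per_x: "\<And>i j y. F i j (real n) y = F i j 0 y" and per_y: "\<And>i j x. F i j x (real n) = F i j x 0"
    and refl_x: "\<And>i j x y. F i j (real n - x) y = (- 1) ^ i * F i j x y"
    and refl_y: "\<And>i j x y. F i j x (real n - y) = (- 1) ^ j * F i j x y"
    and swap: "\<And>j x y. F 0 j x y = F j 0 y x"
    and p: "odd p" "p \<ge> 3"
  shows "(\<Sum>k2<n. \<Sum>k1<n. F 0 0 (real k1) (real k2)) =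
     integral {0..real n} (\<lambda>y. integral {0..real n} (\<lambda>x. F 0 0 x y)) + em_kernel p F (hbox n)"
proof -
  define N where "N = real n"
  have N: "0 \<le> N" by (simp add: N_def)
  define b where "b = bern_per p"
  have [measurable]: "b \<in> borel_measurable borel" by (simp add: b_def)
  have Fm: "(\<lambda>w. F i j (fst w) (snd w)) \<in> borel_measurable borel" for i j
    by (intro borel_measurable_continuous_onI cont)
  have bx: "(\<lambda>w :: real \<times> real. b (fst w)) \<in> borel_measurable borel" "(\<lambda>w :: real \<times> real. b (snd w)) \<in> borel_measurable borel"
    unfolding borel_prod[symmetric] by measurable
  note [measurable] = Fm bx
  obtain B where B: "1 \<le> B" "\<And>x. \<bar>b x\<bar> \<le> B" using bern_per_bounded[of p] by (auto simp: b_def)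
  have maj: "\<exists>c\<ge>0. \<forall>w\<in>{0..N} \<times> {0..N}. \<bar>F i j (fst w) (snd w)\<bar> \<le> c * maj 1 w" for i j
    by (rule bounded_by_maj[OF _ N]) (auto intro: cont)
  \<comment> \<open>What Fubini and linearity ask for on the full cell. The parameter 1 of
    \<open>maj\<close> is arbitrary, as everything here is bounded on a compact set.\<close>
  define good where "good h \<longleftrightarrow> h \<in> borel_measurable borel \<and> (\<exists>c\<ge>0. \<forall>w\<in>{0..N} \<times> {0..N}. \<bar>h w\<bar> \<le> c * maj 1 w)" for h :: "real \<times> real \<Rightarrow> real"
  have goodF: "good (\<lambda>w. F i j (fst w) (snd w))" for i j
    unfolding good_def using maj by auto
  have good_mult: "good (\<lambda>w. f w * h w)" if h: "good h" and f: "f \<in> borel_measurable borel" "\<And>w. \<bar>f w\<bar> \<le> A" for f h A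
  proof -
    obtain c where c: "c \<ge> 0" "\<And>w. w \<in> {0..N} \<times> {0..N} \<Longrightarrow> \<bar>h w\<bar> \<le> c * maj 1 w" using h by (auto simp: good_def)
    have A: "0 \<le> A" using f(2)[of "(0, 0)"] by linarith
    have "\<bar>f w * h w\<bar> \<le> (A * c) * maj 1 w" if "w \<in> {0..N} \<times> {0..N}" for w
      using mult_mono[OF f(2)[of w] c(2)[OF that]] A by (simp add: abs_mult mult.assoc)
    then show ?thesis unfolding good_def using f(1) h c A
      by (intro conjI exI[of _ "A * c"]) (auto simp: good_def)
  qed
  have good_add: "good (\<lambda>w. f w + h w)" if fh: "good f" "good h" for f h
  proof -
    obtain c d where cd: "c \<ge> 0" "\<And>w. w \<in> {0..N} \<times> {0..N} \<Longrightarrow> \<bar>f w\<bar> \<le> c * maj 1 w"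
      "d \<ge> 0" "\<And>w. w \<in> {0..N} \<times> {0..N} \<Longrightarrow> \<bar>h w\<bar> \<le> d * maj 1 w" using fh by (auto simp: good_def)
    have "\<bar>f w + h w\<bar> \<le> (c + d) * maj 1 w" if "w \<in> {0..N} \<times> {0..N}" for w
      using cd(2,4)[OF that] by (simp add: distrib_right)
    then show ?thesis unfolding good_def using fh cd by (intro conjI exI[of _ "c + d"]) (auto simp: good_def)
  qed
  have nested: "integral {0..R} (\<lambda>y. integral {0..R} (\<lambda>x. h (x, y))) = (LINT w:{0..R} \<times> {0..R}|lborel. h w)"
    and int: "set_integrable lborel ({0..N} \<times> {0..N}) h" if h: "good h" and R: "R \<le> N" for h R
  proof -
    obtain c where c: "c \<ge> 0" "\<And>w. w \<in> {0..N} \<times> {0..N} \<Longrightarrow> \<bar>h w\<bar> \<le> c * maj 1 w" using h by (auto simp: good_def)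
    show "integral {0..R} (\<lambda>y. integral {0..R} (\<lambda>x. h (x, y))) = (LINT w:{0..R} \<times> {0..R}|lborel. h w)"
      by (rule nested_integral_eq[of 1]) (use h R c in \<open>auto simp: good_def\<close>)
    show "set_integrable lborel ({0..N} \<times> {0..N}) h"
      by (rule set_integral_maj_bound(1)[of 1]) (use h c in \<open>auto simp: good_def intro!: borel_closed closed_Times\<close>)
  qed
  define h1 h2 h3 h4 where "h1 w = F 0 0 (fst w) (snd w)" and "h2 w = b (fst w) * F p 0 (fst w) (snd w)"
    and "h3 w = b (snd w) * F 0 p (fst w) (snd w)" and "h4 w = b (fst w) * b (snd w) * F p p (fst w) (snd w)" for w
  have h1: "good h1" unfolding h1_def by (rule goodF)
  have h2: "good h2" unfolding h2_def by (intro good_mult[where A = B] goodF bx B)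
  have h3: "good h3" unfolding h3_def by (intro good_mult[where A = B] goodF bx B)
  have h4: "good h4" unfolding h4_def mult.assoc by (intro good_mult[where A = B] goodF bx B)
  define q where "q = 1 / (fact p :: real)"
  have inner: "((\<lambda>x. F 0 j x y + q * (b x * F p j x y)) has_integral (\<Sum>k1<n. F 0 j (real k1) y)) {0..N}" for j y
    using em_periodic_sum[of "\<lambda>i x. F i j x y" p n] dx per_x p by (simp add: q_def b_def bern_per_def N_def)
  \<comment> \<open>The sum over the first index is itself periodic in y, so the one-variable
    formula applies to it.\<close>
  have "((\<lambda>y. (\<Sum>k1<n. F 0 0 (real k1) y) + q * (b y * (\<Sum>k1<n. F 0 p (real k1) y))) has_integral
      (\<Sum>k2<n. \<Sum>k1<n. F 0 0 (real k1) (real k2))) {0..N}"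
    using em_periodic_sum[of "\<lambda>j y. \<Sum>k1<n. F 0 j (real k1) y" p n] dy per_y p
    by (simp add: q_def b_def bern_per_def N_def DERIV_sum)
  then have "(\<Sum>k2<n. \<Sum>k1<n. F 0 0 (real k1) (real k2)) = integral {0..N} (\<lambda>y. (\<Sum>k1<n. F 0 0 (real k1) y) + q * (b y * (\<Sum>k1<n. F 0 p (real k1) y)))"
    by (simp add: integral_unique)
  also have "\<dots> = integral {0..N} (\<lambda>y. integral {0..N} (\<lambda>x. h1 (x, y) + q * h2 (x, y) + (q * h3 (x, y) + q * (q * h4 (x, y)))))"
  proof (rule integral_cong)
    fix y
    have "((\<lambda>x. (F 0 0 x y + q * (b x * F p 0 x y)) + q * (b y * (F 0 p x y + q * (b x * F p p x y)))) has_integral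
       (\<Sum>k1<n. F 0 0 (real k1) y) + q * (b y * (\<Sum>k1<n. F 0 p (real k1) y))) {0..N}"
      by (intro has_integral_add has_integral_mult_right inner)
    moreover have "(\<lambda>x. (F 0 0 x y + q * (b x * F p 0 x y)) + q * (b y * (F 0 p x y + q * (b x * F p p x y))))
       = (\<lambda>x. h1 (x, y) + q * h2 (x, y) + (q * h3 (x, y) + q * (q * h4 (x, y))))"
      by (simp add: fun_eq_iff h1_def h2_def h3_def h4_def algebra_simps)
    ultimately show "(\<Sum>k1<n. F 0 0 (real k1) y) + q * (b y * (\<Sum>k1<n. F 0 p (real k1) y))
       = integral {0..N} (\<lambda>x. h1 (x, y) + q * h2 (x, y) + (q * h3 (x, y) + q * (q * h4 (x, y))))"
      by (simp add: integral_unique)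
  qed
  also have "\<dots> = (LINT w:{0..N} \<times> {0..N}|lborel. h1 w + q * h2 w + (q * h3 w + q * (q * h4 w)))"
    by (rule nested) (auto intro!: good_add good_mult[where A = "\<bar>q\<bar>"] h1 h2 h3 h4)
  also have "\<dots> = (LINT w:{0..N} \<times> {0..N}|lborel. h1 w) + q * (LINT w:{0..N} \<times> {0..N}|lborel. h2 w)
     + (q * (LINT w:{0..N} \<times> {0..N}|lborel. h3 w) + q * (q * (LINT w:{0..N} \<times> {0..N}|lborel. h4 w)))"
    using int[OF h1 order_refl] int[OF h2 order_refl] int[OF h3 order_refl] int[OF h4 order_refl]
    by (subst set_integral_add, (simp_all add: set_integral_add set_integrable_mult_right)[2])+ simp
  also have "\<dots> = integral {0..N} (\<lambda>y. integral {0..N} (\<lambda>x. F 0 0 x y)) + em_kernel p F (hbox n)"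
  proof -
    \<comment> \<open>Under x \<rightarrow> n - x the periodic Bernoulli function and the p-th
      derivative both change sign for odd p, so the integrands are invariant and one quarter of the
      cell suffices.\<close>
    have half: "(LINT w:{0..N} \<times> {0..N}|lborel. h w) = 4 * (LINT w:hbox n|lborel. h w)"
      if "good h" "\<And>x y. h (N - x, y) = h (x, y)" "\<And>x y. h (x, N - y) = h (x, y)" for h
      unfolding hbox_def N_def[symmetric] using nested_reflect_half[OF N, of "\<lambda>x y. h (x, y)"] that N
      by (simp add: nested)
    have b_refl: "b (N - x) = - b x" for x
      unfolding b_def N_def using p by (rule bern_per_reflect)
    have sgn: "(- 1 :: real) ^ p = - 1" using p by simp
    have 2: "(LINT w:{0..N} \<times> {0..N}|lborel. h2 w) = 4 * (LINT w:hbox n|lborel. h2 w)"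
      by (rule half[OF h2]) (use b_refl refl_x refl_y sgn in \<open>simp_all add: h2_def N_def\<close>)
    have 3: "(LINT w:{0..N} \<times> {0..N}|lborel. h3 w) = 4 * (LINT w:hbox n|lborel. h3 w)"
      by (rule half[OF h3]) (use b_refl refl_x refl_y sgn in \<open>simp_all add: h3_def N_def\<close>)
    have 4: "(LINT w:{0..N} \<times> {0..N}|lborel. h4 w) = 4 * (LINT w:hbox n|lborel. h4 w)"
      by (rule half[OF h4]) (use b_refl refl_x refl_y sgn in \<open>simp_all add: h4_def N_def\<close>)
    have "h3 w = h2 (snd w, fst w)" for w by (simp add: h3_def h2_def swap)
    then have 5: "(LINT w:hbox n|lborel. h3 w) = (LINT w:hbox n|lborel. h2 w)"
      using set_integral_swap[of h2 "{0..real n / 2}"] h2 by (simp add: hbox_def good_def)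
    have 1: "(LINT w:{0..N} \<times> {0..N}|lborel. h1 w) = integral {0..N} (\<lambda>y. integral {0..N} (\<lambda>x. F 0 0 x y))"
      using nested[OF h1 order_refl] by (simp add: h1_def)
    have J: "J1 p F (hbox n) = (LINT w:hbox n|lborel. h2 w)" "J2 p F (hbox n) = (LINT w:hbox n|lborel. h4 w)"
      unfolding J1_def J2_def h2_def h4_def b_def by simp_all
    show ?thesis unfolding 1 2 3 4 5 em_kernel_def J by (simp add: q_def power2_eq_square field_simps)
  qed
  finally show ?thesis by (simp add: N_def)
qed

section \<open>Estimates of the remainder integrals\<close>

text \<open>\<open>JJ p 0\<close> and \<open>JJ p p\<close> are the two integrals in \<open>bcoef\<close>, over \<open>A\<close> instead of the quadrant.\<close>
definition bern_snd :: "nat \<Rightarrow> nat \<Rightarrow> real \<Rightarrow> real" where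
  "bern_snd p q y = (if q = 0 then 1 else bern_per p y)"

definition JJ :: "nat \<Rightarrow> nat \<Rightarrow> (nat \<Rightarrow> nat \<Rightarrow> real \<Rightarrow> real \<Rightarrow> real) \<Rightarrow> (real \<times> real) set \<Rightarrow> real" where
  "JJ p q F A = (LINT w:A|lborel. bern_per p (fst w) * bern_snd p q (snd w) * F p q (fst w) (snd w))"

lemma J1_eq_JJ: "J1 p F A = JJ p 0 F A" and J2_eq_JJ: "p \<noteq> 0 \<Longrightarrow> J2 p F A = JJ p p F A"
  by (simp_all add: J1_def J2_def JJ_def bern_snd_def)

lemma borel_measurable_bern_fst_snd:
  "(\<lambda>w :: real \<times> real. bern_per p (fst w) * bern_snd p q (snd w)) \<in> borel_measurable borel"
  unfolding borel_prod[symmetric] bern_snd_def by (cases "q = 0") simp_all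

lemma bern_fst_snd_bounded: "\<exists>B\<ge>1. \<forall>q x y. \<bar>bern_per p x * bern_snd p q y\<bar> \<le> B"
proof -
  obtain B where B: "1 \<le> B" "\<And>x. \<bar>bern_per p x\<bar> \<le> B" using bern_per_bounded[of p] by auto
  have "\<bar>bern_per p x * bern_snd p q y\<bar> \<le> B * B" for q x y
    unfolding abs_mult using B by (intro mult_mono) (auto simp: bern_snd_def)
  moreover have "1 \<le> B * B" using B(1) mult_mono[of 1 B 1 B] by simp
  ultimately show ?thesis by blast
qed

text \<open>Chosen once, for all q together, so that later constants can refer to it by name;
  \<open>phi_const\<close> and \<open>Rem_const\<close> are chosen in the same way.\<close>

definition bern_bound :: "nat \<Rightarrow> real" where
  "bern_bound p = (SOME B. 1 \<le> B \<and> (\<forall>q x y. \<bar>bern_per p x * bern_snd p q y\<bar> \<le> B))"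

lemma bern_bound: "1 \<le> bern_bound p" "\<bar>bern_per p x * bern_snd p q y\<bar> \<le> bern_bound p"
  using someI_ex[OF bern_fst_snd_bounded[of p, unfolded Bex_def], folded bern_bound_def] by auto

lemma JJ_bound:
  assumes z: "0 < z" and F: "(\<lambda>w. F p q (fst w) (snd w)) \<in> borel_measurable borel"
    and A: "A \<in> sets borel" "A \<subseteq> quadrant" and c: "0 \<le> c"
    and b: "\<And>x y. (x, y) \<in> A \<Longrightarrow> \<bar>F p q x y\<bar> \<le> c * maj z (x, y)"
  shows "set_integrable lborel A (\<lambda>w. bern_per p (fst w) * bern_snd p q (snd w) * F p q (fst w) (snd w))"
    and "\<bar>JJ p q F A\<bar> \<le> bern_bound p * c * (pi / (2 * z))\<^sup>2"
proof -
  have m: "(\<lambda>w. bern_per p (fst w) * bern_snd p q (snd w) * F p q (fst w) (snd w)) \<in> borel_measurable borel"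
    using F borel_measurable_bern_fst_snd by (rule borel_measurable_times[rotated])
  have "\<bar>bern_per p (fst w) * bern_snd p q (snd w) * F p q (fst w) (snd w)\<bar> \<le> bern_bound p * c * maj z w" if "w \<in> A" for w
  proof -
    have "\<bar>bern_per p (fst w) * bern_snd p q (snd w)\<bar> * \<bar>F p q (fst w) (snd w)\<bar> \<le> bern_bound p * (c * maj z w)"
      using b[of "fst w" "snd w"] that bern_bound[of p] by (intro mult_mono) auto
    then show ?thesis by (simp add: abs_mult mult.assoc)
  qed
  note * = set_integral_maj_bound[OF z m A this]
  show "set_integrable lborel A (\<lambda>w. bern_per p (fst w) * bern_snd p q (snd w) * F p q (fst w) (snd w))"
    by (rule *(1)) (use bern_bound[of p] c in auto)
  show "\<bar>JJ p q F A\<bar> \<le> bern_bound p * c * (pi / (2 * z))\<^sup>2"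
    unfolding JJ_def by (rule *(2)) (use bern_bound[of p] c in auto)
qed

abbreviation unit_square :: "(real \<times> real) set" where "unit_square \<equiv> {0..1} \<times> {0..1}"

context even_family
begin

lemma borel_measurable_F: "(\<lambda>w. F i j (fst w) (snd w)) \<in> borel_measurable borel"
  by (intro borel_measurable_continuous_onI cont)

lemma JJ_unit_square:
  "JJ p q F unit_square = integral {0..1} (\<lambda>y. integral {0..1} (\<lambda>x. bern_poly p x * (if q = 0 then 1 else bern_poly p y) * F p q x y))"
proof -
  obtain c where c: "0 \<le> c" "\<And>w. w \<in> {0..1} \<times> {0..1} \<Longrightarrow> \<bar>F p q (fst w) (snd w)\<bar> \<le> c * maj 1 w"
    using bounded_by_maj[of 1 1 "\<lambda>w. F p q (fst w) (snd w)"] cont by auto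
  define h where "h w = bern_per p (fst w) * bern_snd p q (snd w) * F p q (fst w) (snd w)" for w
  have m: "h \<in> borel_measurable borel"
    unfolding h_def using borel_measurable_F borel_measurable_bern_fst_snd by (rule borel_measurable_times[rotated])
  have "\<bar>h w\<bar> \<le> bern_bound p * c * maj 1 w" if "w \<in> {0..1} \<times> {0..1}" for w
  proof -
    have "\<bar>bern_per p (fst w) * bern_snd p q (snd w)\<bar> * \<bar>F p q (fst w) (snd w)\<bar> \<le> bern_bound p * (c * maj 1 w)"
      using c(2)[OF that] bern_bound[of p] by (intro mult_mono) auto
    then show ?thesis by (simp add: abs_mult mult.assoc h_def)
  qed
  then have "integral {0..1} (\<lambda>y. integral {0..1} (\<lambda>x. h (x, y))) = (LINT w:{0..1} \<times> {0..1}|lborel. h w)"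
    using bern_bound[of p] c m by (intro nested_integral_eq[of 1 _ _ _ "bern_bound p * c"]) auto
  moreover have "integral {0..1} (\<lambda>y. integral {0..1} (\<lambda>x. h (x, y)))
    = integral {0..1} (\<lambda>y. integral {0..1} (\<lambda>x. bern_poly p x * (if q = 0 then 1 else bern_poly p y) * F p q x y))"
    using p by (intro integral_cong) (simp add: h_def bern_snd_def bern_per_unit)
  ultimately show ?thesis by (simp add: JJ_def h_def)
qed

context
  fixes K :: real
  assumes K: "\<And>i j x y. i < p \<Longrightarrow> j < p \<Longrightarrow> x \<in> {0..1} \<Longrightarrow> y \<in> {0..1} \<Longrightarrow> x = 1 \<or> y = 1 \<Longrightarrow> \<bar>F i j x y\<bar> \<le> K"
begin

text \<open>The natural bound of \<open>square_single\<close> is coarsened to that of the double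
  integral, so that q = 0 and q = p share their constants from here on.\<close>

lemma JJ_square_single:
  "\<bar>JJ p 0 F unit_square
     - fact p * (integral {0..1} (\<lambda>y. F 0 0 0 y) / 2 - integral {0..1} (\<lambda>y. integral {0..1} (\<lambda>x. F 0 0 x y)))\<bar>
   \<le> (fact p)\<^sup>2 * (5 * (em_weight p)\<^sup>2 * K)"
proof -
  have K0: "0 \<le> K" using K[of 0 0 1 1] p by simp
  have "1 \<le> em_weight p" by (rule em_weight_ge_1)
  then have "em_weight p * 1 \<le> em_weight p * (5 * em_weight p)" by (intro mult_left_mono) auto
  then have "fact p * (em_weight p * K) \<le> (fact p)\<^sup>2 * ((5 * (em_weight p)\<^sup>2) * K)"
    using K0 \<open>1 \<le> em_weight p\<close>
    by (intro mult_mono mult_right_mono mult_nonneg_nonneg) (auto simp: power2_eq_square mult_ac)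
  moreover have "\<bar>JJ p 0 F unit_square
     - fact p * (integral {0..1} (\<lambda>y. F 0 0 0 y) / 2 - integral {0..1} (\<lambda>y. integral {0..1} (\<lambda>x. F 0 0 x y)))\<bar>
   \<le> fact p * (em_weight p * K)"
    unfolding JJ_unit_square using square_single[of K] K p by simp
  ultimately show ?thesis by linarith
qed

lemma JJ_square_double:
  "\<bar>JJ p p F unit_square
     - (fact p)\<^sup>2 * (F 0 0 0 0 / 4 - integral {0..1} (\<lambda>y. F 0 0 0 y) / 2 - integral {0..1} (\<lambda>x. F 0 0 x 0) / 2
          + integral {0..1} (\<lambda>y. integral {0..1} (\<lambda>x. F 0 0 x y)))\<bar>
   \<le> (fact p)\<^sup>2 * (5 * (em_weight p)\<^sup>2 * K)"
  unfolding JJ_unit_square using square_double[of K] K p by simp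

text \<open>The 3 covers 1/4 + 1/2 + 1/2 + 1, the coefficients of corner, axes and square.\<close>

lemma JJ_square_sup:
  assumes "\<And>x y. x \<in> {0..1} \<Longrightarrow> y \<in> {0..1} \<Longrightarrow> \<bar>F 0 0 x y\<bar> \<le> L" "q = 0 \<or> q = p"
  shows "\<bar>JJ p q F unit_square\<bar> \<le> (fact p)\<^sup>2 * (5 * (em_weight p)\<^sup>2 * K + 3 * L)"
proof -
  have 1: "\<bar>integral {0..1} (\<lambda>y. F 0 0 0 y)\<bar> \<le> L" "\<bar>integral {0..1} (\<lambda>x. F 0 0 x 0)\<bar> \<le> L"
    "\<bar>integral {0..1} (\<lambda>y. integral {0..1} (\<lambda>x. F 0 0 x y))\<bar> \<le> L" "\<bar>F 0 0 0 0\<bar> \<le> L"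
    using assms by (auto intro!: integral_abs_le)
  have L: "0 \<le> L" using 1(4) by linarith
  have f: "fact p * a \<le> (fact p)\<^sup>2 * a" if "0 \<le> a" for a :: real
    using that by (intro mult_right_mono) (auto simp: power2_eq_square)
  show ?thesis
  proof (cases "q = 0")
    case True
    have "\<bar>integral {0..1} (\<lambda>y. F 0 0 0 y) / 2 - integral {0..1} (\<lambda>y. integral {0..1} (\<lambda>x. F 0 0 x y))\<bar> \<le> 3 * L"
      using 1 by linarith
    then have "fact p * \<bar>integral {0..1} (\<lambda>y. F 0 0 0 y) / 2 - integral {0..1} (\<lambda>y. integral {0..1} (\<lambda>x. F 0 0 x y))\<bar> \<le> fact p * (3 * L)"
      by (intro mult_left_mono) auto
    also have "\<dots> \<le> (fact p)\<^sup>2 * (3 * L)" using L by (intro f) auto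
    finally have "\<bar>fact p * (integral {0..1} (\<lambda>y. F 0 0 0 y) / 2 - integral {0..1} (\<lambda>y. integral {0..1} (\<lambda>x. F 0 0 x y)))\<bar> \<le> (fact p)\<^sup>2 * (3 * L)"
      by (simp add: abs_mult)
    with JJ_square_single True show ?thesis by (simp only: distrib_left)
  next
    case False
    have "\<bar>F 0 0 0 0 / 4 - integral {0..1} (\<lambda>y. F 0 0 0 y) / 2 - integral {0..1} (\<lambda>x. F 0 0 x 0) / 2
          + integral {0..1} (\<lambda>y. integral {0..1} (\<lambda>x. F 0 0 x y))\<bar> \<le> 3 * L"
      using 1 L by linarith
    then have "(fact p)\<^sup>2 * \<bar>F 0 0 0 0 / 4 - integral {0..1} (\<lambda>y. F 0 0 0 y) / 2 - integral {0..1} (\<lambda>x. F 0 0 x 0) / 2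
          + integral {0..1} (\<lambda>y. integral {0..1} (\<lambda>x. F 0 0 x y))\<bar> \<le> (fact p)\<^sup>2 * (3 * L)"
      by (intro mult_left_mono) auto
    then have "\<bar>(fact p)\<^sup>2 * (F 0 0 0 0 / 4 - integral {0..1} (\<lambda>y. F 0 0 0 y) / 2 - integral {0..1} (\<lambda>x. F 0 0 x 0) / 2
          + integral {0..1} (\<lambda>y. integral {0..1} (\<lambda>x. F 0 0 x y)))\<bar> \<le> (fact p)\<^sup>2 * (3 * L)"
      by (simp add: abs_mult)
    moreover have "\<bar>a\<bar> \<le> c + d" if "\<bar>a - b\<bar> \<le> c" "\<bar>b\<bar> \<le> d" for a b c d :: real
      using that by linarith
    moreover have "q = p" using False assms(2) by simp
    ultimately show ?thesis using JJ_square_double by (subst distrib_left) blast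
  qed
qed

end

end

context star
begin

lemma rad_powi_le_maj:
  assumes "0 < z"
  shows "rad x y z powi (- 4) \<le> maj z (x, y)"
proof -
  have "(z\<^sup>2 + x\<^sup>2) * (z\<^sup>2 + y\<^sup>2) \<le> (x\<^sup>2 + y\<^sup>2 + z\<^sup>2) * (x\<^sup>2 + y\<^sup>2 + z\<^sup>2)"
    by (intro mult_mono) auto
  also have "\<dots> = rad x y z ^ 4"
    using rad_sq[of x y z] by (simp only: power2_eq_square[symmetric] power_mult[symmetric] flip: rad_sq) simp
  finally have "inverse (rad x y z ^ 4) \<le> inverse ((z\<^sup>2 + x\<^sup>2) * (z\<^sup>2 + y\<^sup>2))"
    using assms by (intro le_imp_inverse_le) (auto intro!: mult_pos_pos add_pos_nonneg)
  then show ?thesis by (simp add: maj_def power_int_minus)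
qed

lemma even_family_W:
  assumes "0 < z" "0 \<le> e" "odd p" "p \<ge> 3"
  shows "even_family (\<lambda>i j x y. c * W i j m x y z e) p"
  by unfold_locales (use assms in \<open>auto intro!: DERIV_cmult W_derivative continuous_intros simp: W_odd_at_0\<close>)

lemma even_family_Rem:
  assumes "0 < z" "odd p" "p \<ge> 3"
  shows "even_family (\<lambda>i j x y. Rem M n i j x y z) p"
  by unfold_locales
    (use assms in \<open>auto simp: Rem_def W_odd_at_0 intro!: derivative_eq_intros W_derivative continuous_intros sum.cong\<close>)

end

section \<open>Constants uniform in the order of differentiation\<close>

lemma finite_uniform_bound:
  fixes R :: "'a \<Rightarrow> real \<Rightarrow> bool"
  assumes "finite A" "\<And>a. a \<in> A \<Longrightarrow> \<exists>B\<ge>0. R a B" "\<And>a B B'. R a B \<Longrightarrow> B \<le> B' \<Longrightarrow> R a B'"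
  shows "\<exists>B\<ge>0. \<forall>a\<in>A. R a B"
  using assms(1,2)
proof (induction A rule: finite_induct)
  case (insert a A)
  from insert.IH insert.prems obtain B where "0 \<le> B" "\<forall>a\<in>A. R a B" by auto
  moreover from insert.prems[of a] obtain C where "0 \<le> C" "R a C" by auto
  ultimately show ?case by (intro exI[of _ "max B C"]) (auto intro: assms(3))
qed auto

lemma powi_le_of_ge_1:
  assumes "1 \<le> (a::real)" "d \<le> d'"
  shows "a powi d \<le> a powi d'"
  using assms by (intro power_int_increasing) auto

lemma powi_antimono:
  assumes "0 < (a::real)" "a \<le> b" "d \<le> 0"
  shows "b powi d \<le> a powi d"
  using assms power_int_antimono[of a b d] by (cases "d = 0") auto

context star
begin

definition phi :: "nat \<Rightarrow> real \<Rightarrow> nat \<Rightarrow> nat \<Rightarrow> real \<Rightarrow> real \<Rightarrow> real" where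
  "phi m z i j x y = 1 / fact m * W i j m x y z 0"

lemma rad_le_2:
  assumes "0 \<le> x" "x \<le> 1" "0 \<le> y" "y \<le> 1" "0 \<le> z" "z \<le> 1"
  shows "rad x y z \<le> 2"
proof -
  have "x\<^sup>2 \<le> 1" "y\<^sup>2 \<le> 1" "z\<^sup>2 \<le> 1" using assms by (auto simp: abs_square_le_1)
  then show ?thesis unfolding rad_def by (intro real_le_lsqrt) auto
qed

lemma rad_powi_split: "0 < z \<Longrightarrow> rad x y z powi (d + d') = rad x y z powi d * rad x y z powi d'"
  using rad_pos[of z x y] by (intro power_int_add) auto

lemma borel_measurable_phi: "(\<lambda>w. phi m z i j (fst w) (snd w)) \<in> borel_measurable borel"
  unfolding phi_def borel_prod[symmetric] by measurable

end

text \<open>With p = 2M + 1 every derivative in the kernel has order above 2M, and M \<ge> 1 gives p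
  \<ge> 3.\<close>

locale star_em = star +
  fixes M p :: nat
  assumes M: "1 \<le> M" and p_def: "p = 2 * M + 1"
begin

lemma p_odd: "odd p" "3 \<le> p" "p \<noteq> 0"
  using M by (auto simp: p_def)

lemma phi_bound:
  "\<exists>B\<ge>0. \<forall>i\<le>p. \<forall>j\<le>p. \<forall>m<M. \<forall>x y z. 0 < z \<longrightarrow>
     \<bar>phi m z i j x y\<bar> \<le> B * rad x y z powi (2 * int m - 4 - int i - int j)"
proof -
  have "\<exists>B\<ge>0. \<forall>a\<in>{..p} \<times> {..p} \<times> {..<M}. case a of (i, j, m) \<Rightarrow> \<forall>x y z. 0 < z \<longrightarrow>
     \<bar>phi m z i j x y\<bar> \<le> B * rad x y z powi (2 * int m - 4 - int i - int j)"
  proof (rule finite_uniform_bound, safe)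
    fix i j m
    obtain B where B: "0 \<le> B" "\<And>x y z. 0 < z \<Longrightarrow> \<bar>W i j m x y z 0\<bar> \<le> B * rad x y z powi (2 * int m - 4 - int i - int j)"
      using W_bound_0[of i j m] by auto
    have "\<bar>phi m z i j x y\<bar> \<le> B * rad x y z powi (2 * int m - 4 - int i - int j)" if "0 < z" for x y z
    proof -
      have "\<bar>phi m z i j x y\<bar> = 1 / fact m * \<bar>W i j m x y z 0\<bar>" by (simp add: phi_def abs_mult)
      also have "\<dots> \<le> 1 * \<bar>W i j m x y z 0\<bar>" by (intro mult_right_mono) auto
      finally show ?thesis using B(2)[OF that, of x y] by linarith
    qed
    with B show "\<exists>B\<ge>0. \<forall>x y z. 0 < z \<longrightarrow> \<bar>phi m z i j x y\<bar> \<le> B * rad x y z powi (2 * int m - 4 - int i - int j)" by blast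
  next
    fix i j m B B' x y z
    assume B: "(B::real) \<le> B'" "0 < (z::real)" and *: "\<forall>x y z. 0 < z \<longrightarrow> \<bar>phi m z i j x y\<bar> \<le> B * rad x y z powi (2 * int m - 4 - int i - int j)"
    have "B * rad x y z powi (2 * int m - 4 - int i - int j) \<le> B' * rad x y z powi (2 * int m - 4 - int i - int j)"
      using B rad_pos[of z x y] by (intro mult_right_mono) auto
    with * B(2) show "\<bar>phi m z i j x y\<bar> \<le> B' * rad x y z powi (2 * int m - 4 - int i - int j)" by (meson order_trans)
  qed simp
  then show ?thesis by auto
qed

definition phi_const :: real where
  "phi_const = (SOME B. 0 \<le> B \<and> (\<forall>i\<le>p. \<forall>j\<le>p. \<forall>m<M. \<forall>x y z. 0 < z \<longrightarrow>
     \<bar>phi m z i j x y\<bar> \<le> B * rad x y z powi (2 * int m - 4 - int i - int j)))"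

lemma phi_const: "0 \<le> phi_const"
  "i \<le> p \<Longrightarrow> j \<le> p \<Longrightarrow> m < M \<Longrightarrow> 0 < z \<Longrightarrow> \<bar>phi m z i j x y\<bar> \<le> phi_const * rad x y z powi (2 * int m - 4 - int i - int j)"
  using someI_ex[OF phi_bound[unfolded Bex_def], folded phi_const_def] by auto

lemma Rem_bound_uniform:
  "\<exists>B\<ge>0. \<forall>i\<le>p. \<forall>j\<le>p. \<forall>n x y z. 0 < n \<longrightarrow> 0 < z \<longrightarrow> \<bar>x\<bar> \<le> real n / 2 \<longrightarrow> \<bar>y\<bar> \<le> real n / 2 \<longrightarrow>
     \<bar>Rem M n i j x y z\<bar> \<le> B * ((1 / (real n)\<^sup>2) ^ M *
       (rad x y z powi (- 4) * min (rad x y z) (real n) powi (2 * int M - int i - int j)))"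
proof -
  have "\<exists>B\<ge>0. \<forall>a\<in>{..p} \<times> {..p}. case a of (i, j) \<Rightarrow> \<forall>n x y z. 0 < n \<longrightarrow> 0 < z \<longrightarrow> \<bar>x\<bar> \<le> real n / 2 \<longrightarrow> \<bar>y\<bar> \<le> real n / 2 \<longrightarrow>
     \<bar>Rem M n i j x y z\<bar> \<le> B * ((1 / (real n)\<^sup>2) ^ M *
       (rad x y z powi (- 4) * min (rad x y z) (real n) powi (2 * int M - int i - int j)))"
  proof (rule finite_uniform_bound, safe)
    fix i j
    have "real n powi (- 2 * int M) = (1 / (real n)\<^sup>2) ^ M" for n
    proof -
      have "- 2 * int M = - int (2 * M)" by simp
      then show ?thesis
        by (simp only: power_int_minus power_int_of_nat) (simp add: power_one_over power_mult inverse_eq_divide)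
    qed
    then show "\<exists>B\<ge>0. \<forall>n x y z. 0 < n \<longrightarrow> 0 < z \<longrightarrow> \<bar>x\<bar> \<le> real n / 2 \<longrightarrow> \<bar>y\<bar> \<le> real n / 2 \<longrightarrow>
     \<bar>Rem M n i j x y z\<bar> \<le> B * ((1 / (real n)\<^sup>2) ^ M *
       (rad x y z powi (- 4) * min (rad x y z) (real n) powi (2 * int M - int i - int j)))"
      using Rem_bound[of M i j] M by (simp add: mult.assoc)
  next
    fix i j B B' n x y z
    assume B: "(B::real) \<le> B'" and n: "0 < (n::nat)" "0 < (z::real)" "\<bar>x\<bar> \<le> real n / 2" "\<bar>y\<bar> \<le> real n / 2"
      and *: "\<forall>n x y z. 0 < n \<longrightarrow> 0 < z \<longrightarrow> \<bar>x\<bar> \<le> real n / 2 \<longrightarrow> \<bar>y\<bar> \<le> real n / 2 \<longrightarrow>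
     \<bar>Rem M n i j x y z\<bar> \<le> B * ((1 / (real n)\<^sup>2) ^ M *
       (rad x y z powi (- 4) * min (rad x y z) (real n) powi (2 * int M - int i - int j)))"
    have "B * ((1 / (real n)\<^sup>2) ^ M *
       (rad x y z powi (- 4) * min (rad x y z) (real n) powi (2 * int M - int i - int j))) \<le> B' * ((1 / (real n)\<^sup>2) ^ M *
       (rad x y z powi (- 4) * min (rad x y z) (real n) powi (2 * int M - int i - int j)))"
      using B n rad_pos[of z x y] by (intro mult_right_mono) auto
    with * n show "\<bar>Rem M n i j x y z\<bar> \<le> B' * ((1 / (real n)\<^sup>2) ^ M *
       (rad x y z powi (- 4) * min (rad x y z) (real n) powi (2 * int M - int i - int j)))" by (meson order_trans)
  qed simp
  then show ?thesis by auto
qed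

definition Rem_const :: real where
  "Rem_const = (SOME B. 0 \<le> B \<and> (\<forall>i\<le>p. \<forall>j\<le>p. \<forall>n x y z. 0 < n \<longrightarrow> 0 < z \<longrightarrow> \<bar>x\<bar> \<le> real n / 2 \<longrightarrow> \<bar>y\<bar> \<le> real n / 2 \<longrightarrow>
     \<bar>Rem M n i j x y z\<bar> \<le> B * ((1 / (real n)\<^sup>2) ^ M *
       (rad x y z powi (- 4) * min (rad x y z) (real n) powi (2 * int M - int i - int j)))))"

lemma Rem_const: "0 \<le> Rem_const"
  "i \<le> p \<Longrightarrow> j \<le> p \<Longrightarrow> 0 < n \<Longrightarrow> 0 < z \<Longrightarrow> \<bar>x\<bar> \<le> real n / 2 \<Longrightarrow> \<bar>y\<bar> \<le> real n / 2 \<Longrightarrow>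
     \<bar>Rem M n i j x y z\<bar> \<le> Rem_const * ((1 / (real n)\<^sup>2) ^ M *
       (rad x y z powi (- 4) * min (rad x y z) (real n) powi (2 * int M - int i - int j)))"
  using someI_ex[OF Rem_bound_uniform[unfolded Bex_def], folded Rem_const_def] by auto

lemma even_family_phi: "0 < z \<Longrightarrow> even_family (phi m z) p"
  using even_family_W[of z 0 p "1 / fact m" m] p_odd by (simp add: phi_def[abs_def])

lemma phi_le_maj:
  assumes "0 < z" "m < M" "q \<le> p"
  shows "\<bar>phi m z p q x y\<bar> \<le> phi_const * rad x y z powi (2 * int m - int p - int q) * maj z (x, y)"
proof -
  have "\<bar>phi m z p q x y\<bar> \<le> phi_const * rad x y z powi ((2 * int m - int p - int q) + - 4)"
    using phi_const(2)[of p q m z x y] assms by (simp add: algebra_simps)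
  also have "\<dots> \<le> phi_const * (rad x y z powi (2 * int m - int p - int q) * maj z (x, y))"
    unfolding rad_powi_split[OF assms(1)] using phi_const(1) rad_pos[OF assms(1), of x y] assms
    by (intro mult_left_mono rad_powi_le_maj) auto
  finally show ?thesis by (simp add: mult.assoc)
qed

text \<open>For m < M the exponent 2m - p - q is at most -3, so the power decreases in r and may be
  frozen at any lower bound a for r.\<close>

lemma phi_le_maj_ge:
  assumes "0 < z" "m < M" "q \<le> p" "0 < a" "a \<le> rad x y z"
  shows "\<bar>phi m z p q x y\<bar> \<le> phi_const * a powi (2 * int m - int p - int q) * maj z (x, y)"
proof -
  have "rad x y z powi (2 * int m - int p - int q) \<le> a powi (2 * int m - int p - int q)"
    using assms p_def by (intro powi_antimono) auto
  then have "phi_const * rad x y z powi (2 * int m - int p - int q) * maj z (x, y) \<le> phi_const * a powi (2 * int m - int p - int q) * maj z (x, y)"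
    using phi_const(1) by (intro mult_right_mono mult_left_mono) auto
  with phi_le_maj[OF assms(1-3), of x y] show ?thesis by linarith
qed

section \<open>The coefficient integrals for large and for small z\<close>

lemma phi_integrable:
  assumes "0 < z" "m < M" "q \<le> p" "A \<in> sets borel" "A \<subseteq> quadrant"
  shows "set_integrable lborel A (\<lambda>w. bern_per p (fst w) * bern_snd p q (snd w) * phi m z p q (fst w) (snd w))"
  by (rule JJ_bound(1)[of z _ p q A "phi_const * z powi (2 * int m - int p - int q)"])
    (use assms phi_const(1) rad_ge(3)[of z] in \<open>auto intro!: phi_le_maj_ge borel_measurable_phi\<close>)

lemma JJ_phi_bound_ge:
  assumes "0 < z" "m < M" "q \<le> p" "A \<in> sets borel" "A \<subseteq> quadrant"
    and a: "0 < a" "\<And>x y. (x, y) \<in> A \<Longrightarrow> a \<le> rad x y z"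
  shows "\<bar>JJ p q (phi m z) A\<bar> \<le> bern_bound p * (phi_const * a powi (2 * int m - int p - int q)) * (pi / (2 * z))\<^sup>2"
  by (rule JJ_bound(2))
    (use assms phi_const(1) in \<open>auto intro!: phi_le_maj_ge borel_measurable_phi\<close>)

lemma sets_rect [measurable]: "{a..b} \<times> {c..d} \<in> sets (borel :: (real \<times> real) measure)"
  "quadrant \<in> sets borel" "hbox n \<in> sets borel"
  unfolding hbox_def by (auto intro!: borel_closed closed_Times)

text \<open>Since r \<ge> z \<ge> 1, the excess exponent yields z^-3; the integral of
  \<open>maj\<close> yields the remaining z^-2.\<close>

lemma JJ_phi_large:
  assumes "q \<le> p"
  shows "\<exists>C\<ge>0. \<forall>m<M. \<forall>z\<ge>1. \<bar>JJ p q (phi m z) quadrant\<bar> \<le> C / z ^ 5"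
proof (rule exI[of _ "bern_bound p * phi_const * 4"], intro conjI allI impI)
  fix m z assume m: "m < M" and z: "(1::real) \<le> z"
  have "\<bar>JJ p q (phi m z) quadrant\<bar> \<le> bern_bound p * (phi_const * z powi (2 * int m - int p - int q)) * (pi / (2 * z))\<^sup>2"
    by (rule JJ_phi_bound_ge) (use m z assms rad_ge(3)[of z] in auto)
  also have "\<dots> \<le> bern_bound p * (phi_const * z powi (- 3)) * (4 / z\<^sup>2)"
  proof (intro mult_mono mult_left_mono)
    show "z powi (2 * int m - int p - int q) \<le> z powi (- 3)"
      using m z by (intro powi_le_of_ge_1) (auto simp: p_def)
    have "(pi / (2 * z))\<^sup>2 \<le> (4 / (2 * z))\<^sup>2" using z pi_less_4 by (intro power_mono divide_right_mono) auto
    then show "(pi / (2 * z))\<^sup>2 \<le> 4 / z\<^sup>2" by (simp add: power_divide power_mult_distrib)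
  qed (use bern_bound(1)[of p] phi_const(1) z in auto)
  also have "\<dots> = bern_bound p * phi_const * 4 / z ^ 5"
    using z by (simp add: power_int_minus field_simps eval_nat_numeral)
  finally show "\<bar>JJ p q (phi m z) quadrant\<bar> \<le> bern_bound p * phi_const * 4 / z ^ 5" .
qed (use bern_bound(1)[of p] phi_const(1) in auto)

lemma rad_ge_1_off_unit:
  assumes "(x, y) \<in> quadrant - unit_square"
  shows "1 \<le> rad x y z"
  using assms rad_ge(1)[of x y z] rad_ge(2)[of y x z] by auto

text \<open>Only \<open>Phi 0 = r\<^sup>-\<^sup>4\<close> is singular beyond \<open>z\<^sup>-\<^sup>2\<close>: the corner value is \<open>z\<^sup>-\<^sup>4\<close> and each edge of the quadrant contributes \<open>pi / (4 * z ^ 3)\<close>.\<close>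
definition sing :: "nat \<Rightarrow> nat \<Rightarrow> real \<Rightarrow> real" where
  "sing m q z = (if m \<noteq> 0 then 0 else if q = 0 then fact p * (pi / 8) / z ^ 3
     else (fact p)\<^sup>2 * (1 / (4 * z ^ 4) - pi / (4 * z ^ 3)))"

lemma pi_over_sq:
  assumes "0 < z"
  shows "(pi / (2 * z))\<^sup>2 \<le> 4 / z\<^sup>2"
proof -
  have "(pi / (2 * z))\<^sup>2 \<le> (4 / (2 * z))\<^sup>2" using assms pi_less_4 by (intro power_mono divide_right_mono) auto
  then show ?thesis by (simp add: power_divide power_mult_distrib)
qed

text \<open>On the far edges 1 \<le> r \<le> 2, so each power of r that occurs is at most 2^(2M).
  This is the K of the square estimates.\<close>

lemma phi_edge:
  assumes "i \<le> p" "j \<le> p" "m < M" "0 < z" "z \<le> 1" "x \<in> {0..1}" "y \<in> {0..1}" "x = 1 \<or> y = 1"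
  shows "\<bar>phi m z i j x y\<bar> \<le> phi_const * 4 ^ M"
proof -
  have r: "1 \<le> rad x y z" "rad x y z \<le> 2"
    using assms rad_ge(1)[of x y z] rad_ge(2)[of y x z] by (auto intro!: rad_le_2)
  have "rad x y z powi (2 * int m - 4 - int i - int j) \<le> rad x y z powi (int (2 * M))"
    using assms r by (intro powi_le_of_ge_1) auto
  also have "\<dots> \<le> 2 ^ (2 * M)" unfolding power_int_of_nat using r by (intro power_mono) auto
  also have "\<dots> = 4 ^ M" by (simp add: power_mult)
  finally have "phi_const * rad x y z powi (2 * int m - 4 - int i - int j) \<le> phi_const * 4 ^ M"
    using phi_const(1) by (intro mult_left_mono)
  with phi_const(2)[of i j m z x y] assms show ?thesis by linarith
qed

lemma integral_singular_line:
  assumes "0 < z" "z \<le> 1"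
  shows "\<bar>integral {0..1} (\<lambda>y. inverse ((y\<^sup>2 + z\<^sup>2)\<^sup>2)) - pi / (4 * z ^ 3)\<bar> \<le> 1 / z\<^sup>2"
proof -
  \<comment> \<open>A primitive of (y^2 + z^2)^-2 with limit pi / (4 z^3) at infinity; the error is
    the missing part of the line beyond y = 1.\<close>
  define G where "G y = y / (2 * z\<^sup>2 * (y\<^sup>2 + z\<^sup>2)) + arctan (y / z) / (2 * z ^ 3)" for y
  have d: "(G has_real_derivative inverse ((y\<^sup>2 + z\<^sup>2)\<^sup>2)) (at y)" for y
  proof -
    define s where "s = y\<^sup>2 + z\<^sup>2"
    have s: "0 < s" using assms by (simp add: s_def add_nonneg_pos)
    have "1 + (y / z)\<^sup>2 = s / z\<^sup>2" using assms by (simp add: s_def power_divide add_divide_distrib)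
    then have e1: "inverse (1 + (y / z)\<^sup>2) * (1 / z) / (2 * z ^ 3) = 1 / (2 * z\<^sup>2 * s)"
      using assms s by (simp add: inverse_eq_divide field_simps eval_nat_numeral)
    have e2: "(1 * (2 * z\<^sup>2 * s) - y * (2 * z\<^sup>2 * (2 * y))) / ((2 * z\<^sup>2 * s) * (2 * z\<^sup>2 * s)) + 1 / (2 * z\<^sup>2 * s) = inverse (s\<^sup>2)"
    proof -
      have "(1 * (2 * z\<^sup>2 * s) - y * (2 * z\<^sup>2 * (2 * y))) / ((2 * z\<^sup>2 * s) * (2 * z\<^sup>2 * s)) = (s - 2 * y\<^sup>2) / (2 * z\<^sup>2 * s\<^sup>2)"
        using assms s by (simp add: field_simps power2_eq_square)
      moreover have "1 / (2 * z\<^sup>2 * s) = s / (2 * z\<^sup>2 * s\<^sup>2)" using assms s by (simp add: field_simps power2_eq_square)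
      moreover have "(s - 2 * y\<^sup>2) + s = 2 * z\<^sup>2" by (simp add: s_def)
      ultimately show ?thesis using assms s by (simp add: add_divide_distrib[symmetric] inverse_eq_divide)
    qed
    have d1: "((\<lambda>y. y / (2 * z\<^sup>2 * (y\<^sup>2 + z\<^sup>2))) has_real_derivative
       (1 * (2 * z\<^sup>2 * s) - y * (2 * z\<^sup>2 * (2 * y))) / ((2 * z\<^sup>2 * s) * (2 * z\<^sup>2 * s))) (at y)"
      using s assms unfolding s_def by (intro DERIV_divide) (auto intro!: derivative_eq_intros)
    have d2: "((\<lambda>y. arctan (y / z) / (2 * z ^ 3)) has_real_derivative inverse (1 + (y / z)\<^sup>2) * (1 / z) / (2 * z ^ 3)) (at y)"
      by (intro DERIV_cdivide DERIV_chain2[OF DERIV_arctan] DERIV_ident)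
    show ?thesis unfolding G_def[abs_def] s_def[symmetric]
      by (rule DERIV_cong[OF DERIV_add[OF d1 d2]]) (simp only: e1 e2)
  qed
  have "((\<lambda>y. inverse ((y\<^sup>2 + z\<^sup>2)\<^sup>2)) has_integral G 1 - G 0) {0..1}"
    by (rule fundamental_theorem_of_calculus)
      (auto simp: has_real_derivative_iff_has_vector_derivative[symmetric] intro: has_field_derivative_at_within d)
  then have I: "integral {0..1} (\<lambda>y. inverse ((y\<^sup>2 + z\<^sup>2)\<^sup>2)) = G 1" by (simp add: integral_unique G_def)
  have at: "arctan (1 / z) = pi / 2 - arctan z" using arctan_inverse[of z] assms by (simp add: inverse_eq_divide)
  have "G 1 - pi / (4 * z ^ 3) = 1 / (2 * z\<^sup>2 * (1 + z\<^sup>2)) - arctan z / (2 * z ^ 3)"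
    unfolding G_def at using assms by (simp add: diff_divide_distrib)
  moreover have "0 \<le> 1 / (2 * z\<^sup>2 * (1 + z\<^sup>2))" "1 / (2 * z\<^sup>2 * (1 + z\<^sup>2)) \<le> 1 / z\<^sup>2"
  proof -
    have "1 * z\<^sup>2 \<le> (2 * (1 + z\<^sup>2)) * z\<^sup>2" by (intro mult_right_mono) auto
    then show "1 / (2 * z\<^sup>2 * (1 + z\<^sup>2)) \<le> 1 / z\<^sup>2" using assms by (intro divide_left_mono) (auto simp: algebra_simps intro!: mult_pos_pos add_pos_pos)
  qed auto
  moreover have "0 \<le> arctan z / (2 * z ^ 3)" using assms by (simp add: zero_le_arctan_iff)
  moreover have "arctan z / (2 * z ^ 3) \<le> 1 / z\<^sup>2"
  proof -
    have "arctan z / (2 * z ^ 3) \<le> z / (2 * z ^ 3)" using assms by (intro divide_right_mono arctan_le_self) auto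
    also have "\<dots> \<le> 1 / z\<^sup>2" using assms by (simp add: field_simps eval_nat_numeral)
    finally show ?thesis .
  qed
  ultimately show ?thesis unfolding I by linarith
qed

end

context star_em
begin

lemma JJ_split:
  assumes "A \<in> sets borel" "U \<in> sets borel" "U \<subseteq> A"
    and "set_integrable lborel U (\<lambda>w. bern_per p (fst w) * bern_snd p q (snd w) * F p q (fst w) (snd w))"
    and "set_integrable lborel (A - U) (\<lambda>w. bern_per p (fst w) * bern_snd p q (snd w) * F p q (fst w) (snd w))"
  shows "JJ p q F A = JJ p q F U + JJ p q F (A - U)"
proof -
  have "U \<union> (A - U) = A" using assms by auto
  with set_integral_Un[of U "A - U" lborel "\<lambda>w. bern_per p (fst w) * bern_snd p q (snd w) * F p q (fst w) (snd w)"] assms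
  show ?thesis by (simp add: JJ_def)
qed

text \<open>For m \<ge> 1 the undifferentiated coefficient is of order r^(2m-4), hence at most a
  constant times z^-2 on the unit square, and that is all the backward formula looks at near the
  origin.\<close>

lemma JJ_phi_small_regular:
  assumes q: "q = 0 \<or> q = p" and m: "0 < m" "m < M" and z: "0 < z" "z \<le> 1"
  shows "\<bar>JJ p q (phi m z) unit_square\<bar> \<le> ((fact p)\<^sup>2 * (5 * (em_weight p)\<^sup>2 * (phi_const * 4 ^ M) + 3 * (phi_const * 4 ^ M))) / z\<^sup>2"
proof -
  interpret even_family "phi m z" p using z by (intro even_family_phi)
  have L: "\<bar>phi m z 0 0 x y\<bar> \<le> phi_const * 4 ^ M / z\<^sup>2" if "x \<in> {0..1}" "y \<in> {0..1}" for x y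
  proof -
    have r: "z \<le> rad x y z" "rad x y z \<le> 2" "0 < rad x y z"
      using z that rad_ge(3)[of z x y] rad_pos[OF z(1), of x y] by (auto intro!: rad_le_2)
    have "rad x y z powi (2 * int m - 4 - int 0 - int 0) = rad x y z powi (int (2 * m - 2) + - 2)"
      using m by (intro arg_cong[where f = "power_int (rad x y z)"]) auto
    also have "\<dots> = rad x y z ^ (2 * m - 2) * rad x y z powi (- 2)"
      unfolding rad_powi_split[OF z(1)] by simp
    also have "\<dots> \<le> 2 ^ (2 * m - 2) * z powi (- 2)"
      using r z by (intro mult_mono power_mono powi_antimono) auto
    also have "\<dots> \<le> 2 ^ (2 * M) * z powi (- 2)"
      using m z by (intro mult_right_mono power_increasing) auto
    also have "(2 :: real) ^ (2 * M) * z powi (- 2) = 4 ^ M / z\<^sup>2"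
      by (simp only: power_mult) (simp add: power_int_minus field_simps)
    finally have "phi_const * rad x y z powi (2 * int m - 4 - int 0 - int 0) \<le> phi_const * (4 ^ M / z\<^sup>2)"
      using phi_const(1) by (intro mult_left_mono)
    with phi_const(2)[of 0 0 m z x y] m z show ?thesis by simp
  qed
  have "\<bar>JJ p q (phi m z) unit_square\<bar> \<le> (fact p)\<^sup>2 * (5 * (em_weight p)\<^sup>2 * (phi_const * 4 ^ M) + 3 * (phi_const * 4 ^ M / z\<^sup>2))"
    by (rule JJ_square_sup[OF _ L q]) (use m z in \<open>auto intro!: phi_edge\<close>)
  also have "\<dots> \<le> (fact p)\<^sup>2 * (5 * (em_weight p)\<^sup>2 * (phi_const * 4 ^ M) / z\<^sup>2 + 3 * (phi_const * 4 ^ M / z\<^sup>2))"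
  proof -
    have "a \<le> a / z\<^sup>2" if "0 \<le> a" for a
      using that z mult_left_mono[of "z\<^sup>2" 1 a] by (simp add: pos_le_divide_eq power_le_one)
    then show ?thesis using phi_const(1) by (intro mult_left_mono add_right_mono) auto
  qed
  finally show ?thesis by (simp add: add_divide_distrib algebra_simps)
qed

text \<open>For m = 0 the corner value and the axis integrals are computed up to z^-2 and give
  \<open>sing\<close>; the integral over the square is itself of order z^-2. The 6 leaves room for 4
  from the square and 1 from the axes.\<close>

lemma JJ_phi_small_singular:
  assumes q: "q = 0 \<or> q = p" and M0: "0 < M" and z: "0 < z" "z \<le> 1"
  shows "\<bar>JJ p q (phi 0 z) unit_square - sing 0 q z\<bar> \<le> ((fact p)\<^sup>2 * (5 * (em_weight p)\<^sup>2 * (phi_const * 4 ^ M) + 6)) / z\<^sup>2"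
proof -
  interpret even_family "phi 0 z" p using z by (intro even_family_phi)
  have F: "phi 0 z 0 0 x y = inverse ((x\<^sup>2 + y\<^sup>2 + z\<^sup>2)\<^sup>2)" for x y by (simp add: phi_def W_Phi0)
  define a where "a = integral {0..1} (\<lambda>y. phi 0 z 0 0 0 y)"
  define I where "I = integral {0..1} (\<lambda>y. integral {0..1} (\<lambda>x. phi 0 z 0 0 x y))"
  have a: "\<bar>a - pi / (4 * z ^ 3)\<bar> \<le> 1 / z\<^sup>2" unfolding a_def F using integral_singular_line[OF z] by simp
  have a': "integral {0..1} (\<lambda>x. phi 0 z 0 0 x 0) = a" unfolding a_def F by simp
  have I: "\<bar>I\<bar> \<le> 4 / z\<^sup>2"
  proof -
    have b: "\<bar>phi 0 z 0 0 x y\<bar> \<le> 1 * maj z (x, y)" for x y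
    proof -
      have "phi 0 z 0 0 x y = inverse (((rad x y z)\<^sup>2)\<^sup>2)" by (simp add: F)
      also have "\<dots> = rad x y z powi (- 4)" unfolding power_mult[symmetric] by (simp add: power_int_minus)
      finally show ?thesis using rad_powi_le_maj[OF z(1), of x y] rad_pos[OF z(1), of x y] by simp
    qed
    have "I = (LINT w:unit_square|lborel. phi 0 z 0 0 (fst w) (snd w))"
      unfolding I_def using nested_integral_eq[OF z(1) borel_measurable_phi[of 0 z 0 0], of "{0..1}" "{0..1}" 1] b by simp
    moreover have "\<bar>\<dots>\<bar> \<le> 1 * (pi / (2 * z))\<^sup>2"
      by (rule set_integral_maj_bound(2)[OF z(1) borel_measurable_phi]) (use b in auto)
    ultimately show ?thesis using pi_over_sq[OF z(1)] by linarith
  qed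
  have K: "\<bar>phi 0 z i j x y\<bar> \<le> phi_const * 4 ^ M"
    if "i < p" "j < p" "x \<in> {0..1}" "y \<in> {0..1}" "x = 1 \<or> y = 1" for i j x y
    using that M0 z by (intro phi_edge) auto
  have tri: "\<bar>u - w\<bar> \<le> c + d" if "\<bar>u - v\<bar> \<le> c" "\<bar>v - w\<bar> \<le> d" for u v w c d :: real
    using that by linarith
  have f1: "1 \<le> (fact p :: real)" by (rule fact_ge_1)
  have zz: "x \<le> x / z\<^sup>2" if "0 \<le> x" for x
    using that z mult_left_mono[of "z\<^sup>2" 1 x] by (simp add: pos_le_divide_eq power_le_one)
  have "\<bar>JJ p q (phi 0 z) unit_square - sing 0 q z\<bar> \<le> (fact p)\<^sup>2 * (5 * (em_weight p)\<^sup>2 * (phi_const * 4 ^ M)) + (fact p)\<^sup>2 * (6 / z\<^sup>2)"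
  proof (cases "q = 0")
    case True
    have "\<bar>JJ p 0 (phi 0 z) unit_square - fact p * (a / 2 - I)\<bar> \<le> (fact p)\<^sup>2 * (5 * (em_weight p)\<^sup>2 * (phi_const * 4 ^ M))"
      unfolding a_def I_def by (rule JJ_square_single) (rule K)
    moreover have "\<bar>fact p * (a / 2 - I) - sing 0 0 z\<bar> \<le> (fact p)\<^sup>2 * (6 / z\<^sup>2)"
    proof -
      have "fact p * (a / 2 - I) - sing 0 0 z = fact p * ((a - pi / (4 * z ^ 3)) / 2 - I)"
        by (simp add: sing_def field_simps)
      moreover have "\<bar>(a - pi / (4 * z ^ 3)) / 2 - I\<bar> \<le> 6 / z\<^sup>2"
      proof -
        have "\<bar>u / 2 - I\<bar> \<le> 6 / z\<^sup>2" if "\<bar>u\<bar> \<le> 1 / z\<^sup>2" for u using that I by linarith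
        then show ?thesis using a by blast
      qed
      then have "fact p * \<bar>(a - pi / (4 * z ^ 3)) / 2 - I\<bar> \<le> (fact p)\<^sup>2 * (6 / z\<^sup>2)"
        using f1 by (intro mult_mono) (auto simp: power2_eq_square)
      ultimately show ?thesis by (simp add: abs_mult)
    qed
    ultimately show ?thesis using True tri by blast
  next
    case False
    have "\<bar>JJ p p (phi 0 z) unit_square - (fact p)\<^sup>2 * (phi 0 z 0 0 0 0 / 4 - a / 2 - a / 2 + I)\<bar> \<le> (fact p)\<^sup>2 * (5 * (em_weight p)\<^sup>2 * (phi_const * 4 ^ M))"
      using JJ_square_double[OF K] unfolding a' unfolding a_def I_def by simp
    moreover have "\<bar>(fact p)\<^sup>2 * (phi 0 z 0 0 0 0 / 4 - a / 2 - a / 2 + I) - sing 0 p z\<bar> \<le> (fact p)\<^sup>2 * (6 / z\<^sup>2)"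
    proof -
      have F00: "phi 0 z 0 0 0 0 = 1 / z ^ 4" unfolding F by (simp add: inverse_eq_divide flip: power_mult)
      have "(fact p)\<^sup>2 * (phi 0 z 0 0 0 0 / 4 - a / 2 - a / 2 + I) - sing 0 p z = (fact p)\<^sup>2 * (I - (a - pi / (4 * z ^ 3)))"
        using p_odd by (simp add: sing_def F00 algebra_simps)
      moreover have "\<bar>I - (a - pi / (4 * z ^ 3))\<bar> \<le> 6 / z\<^sup>2" using a I by linarith
      then have "(fact p)\<^sup>2 * \<bar>I - (a - pi / (4 * z ^ 3))\<bar> \<le> (fact p)\<^sup>2 * (6 / z\<^sup>2)" by (intro mult_left_mono) auto
      ultimately show ?thesis by (simp add: abs_mult)
    qed
    moreover have "q = p" using False q by simp
    ultimately show ?thesis using tri by blast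
  qed
  also have "\<dots> \<le> ((fact p)\<^sup>2 * (5 * (em_weight p)\<^sup>2 * (phi_const * 4 ^ M))) / z\<^sup>2 + (fact p)\<^sup>2 * (6 / z\<^sup>2)"
    using phi_const(1) by (intro add_right_mono zz) auto
  finally show ?thesis by (simp add: add_divide_distrib algebra_simps)
qed

lemma JJ_phi_small:
  assumes q: "q = 0 \<or> q = p"
  shows "\<exists>C\<ge>0. \<forall>m<M. \<forall>z. 0 < z \<and> z \<le> 1 \<longrightarrow> \<bar>JJ p q (phi m z) quadrant - sing m q z\<bar> \<le> C / z\<^sup>2"
proof -
  define C where "C = (fact p)\<^sup>2 * (5 * (em_weight p)\<^sup>2 * (phi_const * 4 ^ M) + 3 * (phi_const * 4 ^ M) + 6) + 4 * bern_bound p * phi_const"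
  have C0: "0 \<le> C" unfolding C_def using phi_const(1) bern_bound(1)[of p] by simp
  have "\<bar>JJ p q (phi m z) quadrant - sing m q z\<bar> \<le> C / z\<^sup>2" if m: "m < M" and z: "0 < z" "z \<le> 1" for m z
  proof -
    have qp: "q \<le> p" using q by auto
    have s: "quadrant - unit_square \<in> sets borel" by (intro sets.Diff) auto
    have sp: "JJ p q (phi m z) quadrant = JJ p q (phi m z) unit_square + JJ p q (phi m z) (quadrant - unit_square)"
      by (rule JJ_split) (use z m qp s in \<open>auto intro!: phi_integrable\<close>)
    have "\<bar>JJ p q (phi m z) (quadrant - unit_square)\<bar> \<le> bern_bound p * (phi_const * 1 powi (2 * int m - int p - int q)) * (pi / (2 * z))\<^sup>2"
      by (rule JJ_phi_bound_ge) (use z m qp s rad_ge_1_off_unit in auto)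
    also have "\<dots> \<le> bern_bound p * phi_const * (4 / z\<^sup>2)"
      unfolding power_int_1_left mult_1_right using phi_const(1) bern_bound(1)[of p]
      by (intro mult_left_mono pi_over_sq[OF z(1)]) auto
    finally have off: "\<bar>JJ p q (phi m z) (quadrant - unit_square)\<bar> \<le> bern_bound p * phi_const * (4 / z\<^sup>2)" .
    have on: "\<bar>JJ p q (phi m z) unit_square - sing m q z\<bar> \<le> ((fact p)\<^sup>2 * (5 * (em_weight p)\<^sup>2 * (phi_const * 4 ^ M) + 3 * (phi_const * 4 ^ M) + 6)) / z\<^sup>2"
    proof (cases "m = 0")
      case True
      have "((fact p)\<^sup>2 * (5 * (em_weight p)\<^sup>2 * (phi_const * 4 ^ M) + 6)) / z\<^sup>2 \<le> ((fact p)\<^sup>2 * (5 * (em_weight p)\<^sup>2 * (phi_const * 4 ^ M) + 3 * (phi_const * 4 ^ M) + 6)) / z\<^sup>2"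
        using phi_const(1) by (intro divide_right_mono mult_left_mono) auto
      with JJ_phi_small_singular[OF q _ z] m True show ?thesis by simp
    next
      case False
      have "((fact p)\<^sup>2 * (5 * (em_weight p)\<^sup>2 * (phi_const * 4 ^ M) + 3 * (phi_const * 4 ^ M))) / z\<^sup>2 \<le> ((fact p)\<^sup>2 * (5 * (em_weight p)\<^sup>2 * (phi_const * 4 ^ M) + 3 * (phi_const * 4 ^ M) + 6)) / z\<^sup>2"
        using phi_const(1) by (intro divide_right_mono mult_left_mono) auto
      with JJ_phi_small_regular[OF q _ m z] False show ?thesis by (simp add: sing_def)
    qed
    have "C / z\<^sup>2 = ((fact p)\<^sup>2 * (5 * (em_weight p)\<^sup>2 * (phi_const * 4 ^ M) + 3 * (phi_const * 4 ^ M) + 6)) / z\<^sup>2 + bern_bound p * phi_const * (4 / z\<^sup>2)"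
      by (simp add: C_def add_divide_distrib)
    with on off show ?thesis unfolding sp by linarith
  qed
  with C0 show ?thesis by blast
qed

section \<open>The error of the truncated expansion\<close>

lemma borel_measurable_Rem: "(\<lambda>w. Rem M n i j (fst w) (snd w) z) \<in> borel_measurable borel"
  unfolding Rem_def borel_prod[symmetric] by measurable

text \<open>Here the order of differentiation exceeds 2M, so the exponent of min r n is negative
  while min r n \<ge> 1: that factor is at most 1 and plain r^-4 remains.\<close>

lemma Rem_far:
  assumes n: "2 \<le> n" and z: "0 < z" and xy: "(x, y) \<in> hbox n" and r: "1 \<le> rad x y z" and q: "q \<le> p"
  shows "\<bar>Rem M n p q x y z\<bar> \<le> Rem_const * (1 / (real n)\<^sup>2) ^ M * rad x y z powi (- 4)"
proof -
  have "min (rad x y z) (real n) powi (2 * int M - int p - int q) \<le> min (rad x y z) (real n) powi 0"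
    using r n p_def by (intro powi_le_of_ge_1) auto
  then have "Rem_const * ((1 / (real n)\<^sup>2) ^ M * (rad x y z powi (- 4) * min (rad x y z) (real n) powi (2 * int M - int p - int q)))
    \<le> Rem_const * ((1 / (real n)\<^sup>2) ^ M * (rad x y z powi (- 4) * 1))"
    using Rem_const(1) r by (intro mult_left_mono) auto
  moreover have "\<bar>Rem M n p q x y z\<bar> \<le> Rem_const * ((1 / (real n)\<^sup>2) ^ M * (rad x y z powi (- 4) * min (rad x y z) (real n) powi (2 * int M - int p - int q)))"
    using xy n z q by (intro Rem_const(2)) (auto simp: hbox_def)
  ultimately show ?thesis by (simp add: mult.assoc)
qed

text \<open>In the unit cube r \<le> 2 \<le> n, so min r n is r. The undifferentiated remainder is
  of order r^(2M-4), and since M \<ge> 1 this is at most z^-2 up to a constant: the remainder has no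
  analogue of \<open>sing\<close>.\<close>

lemma Rem_near:
  assumes n: "2 \<le> n" and z: "0 < z" "z \<le> 1" and xy: "x \<in> {0..1}" "y \<in> {0..1}"
  shows "i \<le> p \<Longrightarrow> j \<le> p \<Longrightarrow> x = 1 \<or> y = 1 \<Longrightarrow> \<bar>Rem M n i j x y z\<bar> \<le> Rem_const * (1 / (real n)\<^sup>2) ^ M * 4 ^ M"
    and "\<bar>Rem M n 0 0 x y z\<bar> \<le> Rem_const * (1 / (real n)\<^sup>2) ^ M * 4 ^ M / z\<^sup>2"
proof -
  have r: "z \<le> rad x y z" "rad x y z \<le> 2" "0 < rad x y z"
    using z xy rad_ge(3)[of z x y] rad_pos[OF z(1), of x y] by (auto intro!: rad_le_2)
  have n2: "2 \<le> real n" using n by simp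
  then have mn: "min (rad x y z) (real n) = rad x y z" using r by simp
  have le: "Rem_const * ((1 / (real n)\<^sup>2) ^ M * u) \<le> Rem_const * (1 / (real n)\<^sup>2) ^ M * v" if "u \<le> v" for u v
    using that Rem_const(1) by (auto simp: mult.assoc intro!: mult_left_mono)
  have four: "(2 :: real) ^ (2 * M) = 4 ^ M" by (simp add: power_mult)
  {
    assume ij: "i \<le> p" "j \<le> p" and e: "x = 1 \<or> y = 1"
    have r1: "1 \<le> rad x y z" using e rad_ge(1)[of x y z] rad_ge(2)[of y x z] by auto
    have "rad x y z powi (- 4) * rad x y z powi (2 * int M - int i - int j) = rad x y z powi (- 4 + (2 * int M - int i - int j))"
      by (rule rad_powi_split[OF z(1), symmetric])
    also have "\<dots> \<le> rad x y z powi (int (2 * M))" using r1 by (intro powi_le_of_ge_1) auto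
    also have "\<dots> \<le> 2 ^ (2 * M)" unfolding power_int_of_nat using r by (intro power_mono) auto
    finally have "rad x y z powi (- 4) * rad x y z powi (2 * int M - int i - int j) \<le> 4 ^ M" unfolding four .
    moreover have "\<bar>Rem M n i j x y z\<bar> \<le> Rem_const * ((1 / (real n)\<^sup>2) ^ M * (rad x y z powi (- 4) * min (rad x y z) (real n) powi (2 * int M - int i - int j)))"
      using ij xy n2 z n by (intro Rem_const(2)) auto
    ultimately show "\<bar>Rem M n i j x y z\<bar> \<le> Rem_const * (1 / (real n)\<^sup>2) ^ M * 4 ^ M"
      using le unfolding mn by (meson order_trans)
  }
  have "rad x y z powi (- 4) * rad x y z powi (2 * int M - int 0 - int 0) = rad x y z powi (- 4 + (2 * int M - int 0 - int 0))"
    by (rule rad_powi_split[OF z(1), symmetric])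
  also have "\<dots> = rad x y z powi (int (2 * M - 2) + - 2)"
    using M by (intro arg_cong[where f = "power_int (rad x y z)"]) auto
  also have "\<dots> = rad x y z ^ (2 * M - 2) * rad x y z powi (- 2)"
    unfolding rad_powi_split[OF z(1)] by simp
  also have "\<dots> \<le> 2 ^ (2 * M - 2) * z powi (- 2)"
    using r z by (intro mult_mono power_mono powi_antimono) auto
  also have "\<dots> \<le> 2 ^ (2 * M) * z powi (- 2)"
    using z by (intro mult_right_mono power_increasing) auto
  also have "\<dots> = 4 ^ M / z\<^sup>2" unfolding four by (simp add: power_int_minus field_simps)
  finally have "rad x y z powi (- 4) * rad x y z powi (2 * int M - int 0 - int 0) \<le> 4 ^ M / z\<^sup>2" .
  moreover have "\<bar>Rem M n 0 0 x y z\<bar> \<le> Rem_const * ((1 / (real n)\<^sup>2) ^ M * (rad x y z powi (- 4) * min (rad x y z) (real n) powi (2 * int M - int 0 - int 0)))"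
    using xy n2 z n by (intro Rem_const(2)) auto
  ultimately have "\<bar>Rem M n 0 0 x y z\<bar> \<le> Rem_const * (1 / (real n)\<^sup>2) ^ M * (4 ^ M / z\<^sup>2)"
    using le unfolding mn by (meson order_trans)
  then show "\<bar>Rem M n 0 0 x y z\<bar> \<le> Rem_const * (1 / (real n)\<^sup>2) ^ M * 4 ^ M / z\<^sup>2" by simp
qed

abbreviation rem_fam :: "nat \<Rightarrow> real \<Rightarrow> nat \<Rightarrow> nat \<Rightarrow> real \<Rightarrow> real \<Rightarrow> real" where
  "rem_fam n z \<equiv> \<lambda>i j x y. Rem M n i j x y z"

text \<open>For z > 1 the whole box satisfies r \<ge> 1 and \<open>Rem_far\<close> applies. For z
  \<le> 1 it applies off the unit square, and on the square the backward Euler-Maclaurin bound takes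
  over.\<close>

lemma JJ_rem_box:
  assumes q: "q = 0 \<or> q = p" and n: "2 \<le> n" and z: "0 < z"
  shows "\<bar>JJ p q (rem_fam n z) (hbox n)\<bar>
     \<le> ((fact p)\<^sup>2 * (5 * (em_weight p)\<^sup>2 * 4 ^ M + 3 * 4 ^ M) + 4 * bern_bound p) * Rem_const * (1 / (real n)\<^sup>2) ^ M / z\<^sup>2"
proof -
  define h where "h = (1 / (real n)\<^sup>2) ^ M"
  have h: "0 < h" using n by (simp add: h_def)
  have qp: "q \<le> p" using q by auto
  have maj: "\<bar>Rem M n p q x y z\<bar> \<le> Rem_const * h * maj z (x, y)" if "(x, y) \<in> hbox n" "1 \<le> rad x y z" for x y
  proof -
    have "Rem_const * h * rad x y z powi (- 4) \<le> Rem_const * h * maj z (x, y)"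
      using Rem_const(1) h rad_powi_le_maj[OF z] by (intro mult_left_mono) auto
    with Rem_far[OF n z that qp] show ?thesis unfolding h_def by linarith
  qed
  have boxq: "hbox n \<subseteq> quadrant" by (auto simp: hbox_def)
  have est: "bern_bound p * (Rem_const * h) * (pi / (2 * z))\<^sup>2 \<le> 4 * bern_bound p * Rem_const * h / z\<^sup>2"
  proof -
    have "bern_bound p * (Rem_const * h) * (pi / (2 * z))\<^sup>2 \<le> bern_bound p * (Rem_const * h) * (4 / z\<^sup>2)"
      using Rem_const(1) bern_bound(1)[of p] h pi_over_sq[OF z] by (intro mult_left_mono mult_nonneg_nonneg) auto
    then show ?thesis by (simp add: mult_ac)
  qed
  show ?thesis
  proof (cases "z \<le> 1")
    case False
    have far: "\<bar>Rem M n p q x y z\<bar> \<le> Rem_const * h * maj z (x, y)" if "(x, y) \<in> hbox n" for x y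
      using rad_ge(3)[of z x y] False that by (intro maj) auto
    have Rh: "0 \<le> Rem_const * h" using Rem_const(1) h by simp
    have "\<bar>JJ p q (rem_fam n z) (hbox n)\<bar> \<le> bern_bound p * (Rem_const * h) * (pi / (2 * z))\<^sup>2"
      by (rule JJ_bound(2)[where F = "rem_fam n z", OF z borel_measurable_Rem sets_rect(3) boxq Rh]) (rule far)
    also note est
    also have "4 * bern_bound p * Rem_const * h / z\<^sup>2 \<le> ((fact p)\<^sup>2 * (5 * (em_weight p)\<^sup>2 * 4 ^ M + 3 * 4 ^ M) + 4 * bern_bound p) * Rem_const * h / z\<^sup>2"
      using Rem_const(1) h by (intro divide_right_mono mult_right_mono) auto
    finally show ?thesis unfolding h_def .
  next
    case True
    interpret even_family "rem_fam n z" p using z p_odd by (intro even_family_Rem)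
    have ub: "unit_square \<subseteq> hbox n" using n by (auto simp: hbox_def)
    have s: "hbox n - unit_square \<in> sets borel" by (intro sets.Diff) auto
    have off_maj: "\<bar>Rem M n p q x y z\<bar> \<le> Rem_const * h * maj z (x, y)" if "(x, y) \<in> hbox n - unit_square" for x y
      using that boxq by (intro maj rad_ge_1_off_unit) auto
    have Rh: "0 \<le> Rem_const * h" using Rem_const(1) h by simp
    have sq: "hbox n - unit_square \<subseteq> quadrant" using boxq by auto
    have off: "set_integrable lborel (hbox n - unit_square) (\<lambda>w. bern_per p (fst w) * bern_snd p q (snd w) * Rem M n p q (fst w) (snd w) z)"
      "\<bar>JJ p q (rem_fam n z) (hbox n - unit_square)\<bar> \<le> bern_bound p * (Rem_const * h) * (pi / (2 * z))\<^sup>2"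
      by (rule JJ_bound[where F = "rem_fam n z", OF z borel_measurable_Rem s sq Rh], erule off_maj)+
    obtain c where c: "0 \<le> c" "\<And>w. w \<in> unit_square \<Longrightarrow> \<bar>Rem M n p q (fst w) (snd w) z\<bar> \<le> c * maj z w"
      using bounded_by_maj[OF z, of 1 "\<lambda>w. Rem M n p q (fst w) (snd w) z"] cont by auto
    have uq: "unit_square \<subseteq> quadrant" by auto
    have c': "\<bar>Rem M n p q x y z\<bar> \<le> c * maj z (x, y)" if "(x, y) \<in> unit_square" for x y
      using c(2)[OF that] by simp
    have on_int: "set_integrable lborel unit_square (\<lambda>w. bern_per p (fst w) * bern_snd p q (snd w) * Rem M n p q (fst w) (snd w) z)"
      by (rule JJ_bound(1)[where F = "rem_fam n z", OF z borel_measurable_Rem sets_rect(1) uq c(1)]) (rule c')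
    have sp: "JJ p q (rem_fam n z) (hbox n) = JJ p q (rem_fam n z) unit_square + JJ p q (rem_fam n z) (hbox n - unit_square)"
      by (rule JJ_split[where F = "rem_fam n z", OF _ _ ub]) (use on_int off(1) in auto)
    have "\<bar>JJ p q (rem_fam n z) unit_square\<bar> \<le> (fact p)\<^sup>2 * (5 * (em_weight p)\<^sup>2 * (Rem_const * h * 4 ^ M) + 3 * (Rem_const * h * 4 ^ M / z\<^sup>2))"
      by (rule JJ_square_sup[OF _ _ q]) (use n z True in \<open>auto simp: h_def intro!: Rem_near\<close>)
    also have "\<dots> \<le> (fact p)\<^sup>2 * (5 * (em_weight p)\<^sup>2 * (Rem_const * h * 4 ^ M) / z\<^sup>2 + 3 * (Rem_const * h * 4 ^ M / z\<^sup>2))"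
    proof -
      have "a \<le> a / z\<^sup>2" if "0 \<le> a" for a
        using that z True mult_left_mono[of "z\<^sup>2" 1 a] by (simp add: pos_le_divide_eq power_le_one)
      then show ?thesis using Rh by (intro mult_left_mono add_right_mono) auto
    qed
    also have "\<dots> = (fact p)\<^sup>2 * (5 * (em_weight p)\<^sup>2 * 4 ^ M + 3 * 4 ^ M) * Rem_const * h / z\<^sup>2"
      by (simp add: add_divide_distrib algebra_simps)
    finally have on: "\<bar>JJ p q (rem_fam n z) unit_square\<bar> \<le> (fact p)\<^sup>2 * (5 * (em_weight p)\<^sup>2 * 4 ^ M + 3 * 4 ^ M) * Rem_const * h / z\<^sup>2" .
    have "((fact p)\<^sup>2 * (5 * (em_weight p)\<^sup>2 * 4 ^ M + 3 * 4 ^ M) + 4 * bern_bound p) * Rem_const * h / z\<^sup>2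
      = (fact p)\<^sup>2 * (5 * (em_weight p)\<^sup>2 * 4 ^ M + 3 * 4 ^ M) * Rem_const * h / z\<^sup>2 + 4 * bern_bound p * Rem_const * h / z\<^sup>2"
      by (simp add: add_divide_distrib distrib_right)
    with on off(2) est show ?thesis unfolding sp h_def[symmetric] by linarith
  qed
qed

end

context star_em
begin

lemma JJ_rem_box_large:
  assumes q: "q = 0 \<or> q = p" and n: "2 \<le> n" and z: "real n \<le> z"
  shows "\<bar>JJ p q (rem_fam n z) (hbox n)\<bar>
     \<le> 16 * bern_bound p * Rem_const * (1 / (real n)\<^sup>2) ^ M * (real n)\<^sup>2 / z ^ 4"
proof -
  define h where "h = (1 / (real n)\<^sup>2) ^ M"
  have h: "0 < h" using n by (simp add: h_def)
  have n0: "0 < real n" and z0: "0 < z" using n z by auto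
  have qp: "q \<le> p" using q by auto
  \<comment> \<open>On the box \<open>maj (real n)\<close> is at least (2 n^2)^-2, so the constant
    bound z^-4 is at most 4 n^4 / z^4 times it. Integrating \<open>maj (real n)\<close> costs only
    n^-2, which leaves n^2 z^-4, essentially area times height.\<close>
  define c where "c = Rem_const * h * (4 * real n ^ 4 / z ^ 4)"
  have c: "0 \<le> c" using Rem_const(1) h by (simp add: c_def)
  have "\<bar>Rem M n p q x y z\<bar> \<le> c * maj (real n) (x, y)" if xy: "(x, y) \<in> hbox n" for x y
  proof -
    have r: "z \<le> rad x y z" using rad_ge(3)[of z x y] z0 by simp
    have "\<bar>Rem M n p q x y z\<bar> \<le> Rem_const * h * rad x y z powi (- 4)"
      unfolding h_def using z n r by (intro Rem_far z0 xy qp) auto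
    also have "\<dots> \<le> Rem_const * h * z powi (- 4)"
      using Rem_const(1) h by (intro mult_left_mono powi_antimono z0 r) auto
    also have "\<dots> = c * inverse (2 * (real n)\<^sup>2) * inverse (2 * (real n)\<^sup>2)"
      using n0 z0 by (simp add: c_def power_int_minus field_simps eval_nat_numeral)
    also have "\<dots> \<le> c * inverse ((real n)\<^sup>2 + x\<^sup>2) * inverse ((real n)\<^sup>2 + y\<^sup>2)"
    proof -
      have "inverse (2 * (real n)\<^sup>2) \<le> inverse ((real n)\<^sup>2 + v\<^sup>2)" if "0 \<le> v" "v \<le> real n / 2" for v
      proof (rule le_imp_inverse_le)
        have "v\<^sup>2 \<le> (real n)\<^sup>2" using that n0 by (intro power_mono) auto
        then show "(real n)\<^sup>2 + v\<^sup>2 \<le> 2 * (real n)\<^sup>2" by simp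
      qed (use n0 in \<open>simp add: add_pos_nonneg\<close>)
      then show ?thesis using xy c n0 by (intro mult_mono) (auto simp: hbox_def)
    qed
    finally show ?thesis by (simp add: maj_def mult.assoc)
  qed
  then have "\<bar>JJ p q (rem_fam n z) (hbox n)\<bar> \<le> bern_bound p * c * (pi / (2 * real n))\<^sup>2"
    by (intro JJ_bound(2)[where F = "rem_fam n z", OF n0 borel_measurable_Rem sets_rect(3) _ c]) (auto simp: hbox_def)
  also have "\<dots> \<le> bern_bound p * c * (4 / (real n)\<^sup>2)"
    using c bern_bound(1)[of p] by (intro mult_left_mono pi_over_sq n0) auto
  also have "\<dots> = 16 * bern_bound p * Rem_const * h * (real n)\<^sup>2 / z ^ 4"
    using n0 by (simp add: c_def field_simps eval_nat_numeral)
  finally show ?thesis by (simp add: h_def)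
qed

text \<open>Outside the half cell r \<ge> n/2, and 2(M - m) of the surplus negative powers of r are
  traded for (n/2)^(-2(M-m)); the halves are absorbed in 4^M. In the second bound two of these
  powers are spent on z^-2 instead, at the price of n^2.\<close>

lemma phi_outside:
  assumes q: "q = 0 \<or> q = p" and n: "2 \<le> n" and z: "0 < z" and m: "m < M" and xy: "(x, y) \<in> quadrant - hbox n"
  shows "(1 / (real n)\<^sup>2) ^ m * \<bar>phi m z p q x y\<bar> \<le> phi_const * 4 ^ M * (1 / (real n)\<^sup>2) ^ M * maj z (x, y)"
    and "(1 / (real n)\<^sup>2) ^ m * \<bar>phi m z p q x y\<bar> \<le> phi_const * 4 ^ M * (1 / (real n)\<^sup>2) ^ M * (real n)\<^sup>2 / z\<^sup>2 * maj z (x, y)"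
proof -
  define h where "h = 1 / (real n)\<^sup>2"
  define r where "r = rad x y z"
  have n0: "0 < real n" using n by simp
  have h: "0 < h" using n0 by (simp add: h_def)
  have r: "real n / 2 \<le> r" "z \<le> r"
    using xy rad_ge(1)[of x y z] rad_ge(2)[of y x z] rad_ge(3)[of z x y] z by (auto simp: r_def hbox_def)
  have r1: "1 \<le> r" using r(1) n by linarith
  have half: "(real n / 2) powi (- int (2 * k)) = (4 * h) ^ k" for k
  proof -
    have "inverse ((real n / 2)\<^sup>2) = 4 * h" by (simp add: h_def power_divide)
    then show ?thesis by (simp only: power_int_minus power_int_of_nat power_mult power_inverse[symmetric])
  qed
  have qp: "q \<le> p" using q by auto
  have four: "(4 * h) ^ k * h ^ m \<le> 4 ^ M * h ^ (k + m)" if "k \<le> M" for k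
  proof -
    have "(4::real) ^ k * h ^ (k + m) \<le> 4 ^ M * h ^ (k + m)" using that h by (intro mult_right_mono power_increasing) auto
    then show ?thesis by (simp add: power_mult_distrib power_add mult_ac)
  qed
  have base: "h ^ m * \<bar>phi m z p q x y\<bar> \<le> phi_const * (b * h ^ m) * maj z (x, y)"
    if "r powi (2 * int m - int p - int q) \<le> b" for b
  proof -
    have "phi_const * r powi (2 * int m - int p - int q) * maj z (x, y) \<le> phi_const * b * maj z (x, y)"
      using that phi_const(1) by (intro mult_right_mono mult_left_mono) auto
    with phi_le_maj[OF z m qp, of x y] have "\<bar>phi m z p q x y\<bar> \<le> phi_const * b * maj z (x, y)" by (simp add: r_def)
    from mult_left_mono[OF this, of "h ^ m"] h show ?thesis by (simp add: mult_ac)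
  qed
  have 1: "r powi (2 * int m - int p - int q) \<le> (4 * h) ^ (M - m)"
  proof -
    have "r powi (2 * int m - int p - int q) \<le> r powi (- int (2 * (M - m)))"
      using r1 m by (intro powi_le_of_ge_1) (auto simp: p_def)
    also have "\<dots> \<le> (real n / 2) powi (- int (2 * (M - m)))" using r n0 by (intro powi_antimono) auto
    finally show ?thesis unfolding half .
  qed
  have "phi_const * ((4 * h) ^ (M - m) * h ^ m) * maj z (x, y) \<le> phi_const * (4 ^ M * h ^ (M - m + m)) * maj z (x, y)"
    using phi_const(1) by (intro mult_right_mono mult_left_mono four) auto
  with base[OF 1] m have "h ^ m * \<bar>phi m z p q x y\<bar> \<le> phi_const * (4 ^ M * h ^ M) * maj z (x, y)" by simp
  then show "(1 / (real n)\<^sup>2) ^ m * \<bar>phi m z p q x y\<bar> \<le> phi_const * 4 ^ M * (1 / (real n)\<^sup>2) ^ M * maj z (x, y)"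
    by (simp add: h_def mult.assoc)
  have 2: "r powi (2 * int m - int p - int q) \<le> (4 * h) ^ (M - m - 1) / z\<^sup>2"
  proof -
    have "r powi (2 * int m - int p - int q) \<le> r powi (- int (2 * (M - m - 1)) + - 2)"
      using r1 m by (intro powi_le_of_ge_1) (auto simp: p_def)
    also have "\<dots> = r powi (- int (2 * (M - m - 1))) * r powi (- 2)"
      using r1 by (intro power_int_add) auto
    also have "\<dots> \<le> (real n / 2) powi (- int (2 * (M - m - 1))) * z powi (- 2)"
      using r n0 z by (intro mult_mono powi_antimono) auto
    finally show ?thesis unfolding half by (simp add: power_int_minus divide_inverse)
  qed
  have "phi_const * ((4 * h) ^ (M - m - 1) / z\<^sup>2 * h ^ m) * maj z (x, y) = phi_const * ((4 * h) ^ (M - m - 1) * h ^ m) / z\<^sup>2 * maj z (x, y)"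
    by simp
  also have "\<dots> \<le> phi_const * (4 ^ M * h ^ (M - m - 1 + m)) / z\<^sup>2 * maj z (x, y)"
    using phi_const(1) by (intro mult_right_mono divide_right_mono mult_left_mono four) auto
  also have "h ^ (M - m - 1 + m) = h ^ M * (real n)\<^sup>2"
  proof -
    have "M = Suc (M - m - 1 + m)" using m by simp
    then have "h ^ M = h * h ^ (M - m - 1 + m)" by (metis power_Suc)
    then show ?thesis using n0 by (simp add: h_def)
  qed
  finally have "phi_const * ((4 * h) ^ (M - m - 1) / z\<^sup>2 * h ^ m) * maj z (x, y) \<le> phi_const * (4 ^ M * (h ^ M * (real n)\<^sup>2)) / z\<^sup>2 * maj z (x, y)" .
  with base[OF 2] show "(1 / (real n)\<^sup>2) ^ m * \<bar>phi m z p q x y\<bar> \<le> phi_const * 4 ^ M * (1 / (real n)\<^sup>2) ^ M * (real n)\<^sup>2 / z\<^sup>2 * maj z (x, y)"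
    unfolding h_def by (simp add: mult.assoc)
qed

lemma JJ_phi_outside:
  assumes q: "q = 0 \<or> q = p" and n: "2 \<le> n" and z: "0 < z" and m: "m < M"
  shows "(1 / (real n)\<^sup>2) ^ m * \<bar>JJ p q (phi m z) (quadrant - hbox n)\<bar> \<le> 4 * bern_bound p * phi_const * 4 ^ M * (1 / (real n)\<^sup>2) ^ M / z\<^sup>2"
    and "(1 / (real n)\<^sup>2) ^ m * \<bar>JJ p q (phi m z) (quadrant - hbox n)\<bar> \<le> 4 * bern_bound p * phi_const * 4 ^ M * (1 / (real n)\<^sup>2) ^ M * (real n)\<^sup>2 / z ^ 4"
proof -
  define h where "h = 1 / (real n)\<^sup>2"
  have h: "0 < h" using n by (simp add: h_def)
  have s: "quadrant - hbox n \<in> sets borel" by (intro sets.Diff) auto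
  have key: "h ^ m * \<bar>JJ p q (phi m z) (quadrant - hbox n)\<bar> \<le> bern_bound p * c * (4 / z\<^sup>2)"
    if c: "0 \<le> c" "\<And>x y. (x, y) \<in> quadrant - hbox n \<Longrightarrow> h ^ m * \<bar>phi m z p q x y\<bar> \<le> c * maj z (x, y)" for c
  proof -
    have "\<bar>JJ p q (phi m z) (quadrant - hbox n)\<bar> \<le> bern_bound p * (c / h ^ m) * (pi / (2 * z))\<^sup>2"
      by (rule JJ_bound(2)[OF z borel_measurable_phi s]) (use c h in \<open>auto simp: field_simps\<close>)
    also have "\<dots> \<le> bern_bound p * (c / h ^ m) * (4 / z\<^sup>2)"
      using c h bern_bound(1)[of p] by (intro mult_left_mono pi_over_sq z) auto
    finally have "h ^ m * \<bar>JJ p q (phi m z) (quadrant - hbox n)\<bar> \<le> h ^ m * (bern_bound p * (c / h ^ m) * (4 / z\<^sup>2))"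
      using h by (intro mult_left_mono) auto
    then show ?thesis using h by simp
  qed
  have "h ^ m * \<bar>JJ p q (phi m z) (quadrant - hbox n)\<bar> \<le> bern_bound p * (phi_const * 4 ^ M * h ^ M) * (4 / z\<^sup>2)"
    by (rule key) (use phi_outside(1)[OF q n z m] phi_const(1) h in \<open>auto simp: h_def\<close>)
  then show "(1 / (real n)\<^sup>2) ^ m * \<bar>JJ p q (phi m z) (quadrant - hbox n)\<bar> \<le> 4 * bern_bound p * phi_const * 4 ^ M * (1 / (real n)\<^sup>2) ^ M / z\<^sup>2"
    by (simp add: h_def mult_ac)
  have "h ^ m * \<bar>JJ p q (phi m z) (quadrant - hbox n)\<bar> \<le> bern_bound p * (phi_const * 4 ^ M * h ^ M * (real n)\<^sup>2 / z\<^sup>2) * (4 / z\<^sup>2)"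
    by (rule key) (use phi_outside(2)[OF q n z m] phi_const(1) h in \<open>auto simp: h_def\<close>)
  also have "\<dots> = 4 * bern_bound p * phi_const * 4 ^ M * h ^ M * (real n)\<^sup>2 / z ^ 4"
    using z by (simp add: field_simps eval_nat_numeral)
  finally show "(1 / (real n)\<^sup>2) ^ m * \<bar>JJ p q (phi m z) (quadrant - hbox n)\<bar> \<le> 4 * bern_bound p * phi_const * 4 ^ M * (1 / (real n)\<^sup>2) ^ M * (real n)\<^sup>2 / z ^ 4"
    by (simp add: h_def)
qed

abbreviation lat_fam :: "nat \<Rightarrow> real \<Rightarrow> nat \<Rightarrow> nat \<Rightarrow> real \<Rightarrow> real \<Rightarrow> real" where
  "lat_fam n z \<equiv> \<lambda>i j x y. W i j 0 x y z (1 / (real n)\<^sup>2)"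

definition err :: "nat \<Rightarrow> nat \<Rightarrow> real \<Rightarrow> real" where
  "err q n z = JJ p q (lat_fam n z) (hbox n) - (\<Sum>m<M. (1 / (real n)\<^sup>2) ^ m * JJ p q (phi m z) quadrant)"

text \<open>The coefficients in the expansion are integrals over the full quadrant, the lattice
  kernel only one over the half cell. The error is thus the Taylor remainder inside the cell minus
  the tails of the coefficients outside.\<close>

lemma err_eq:
  assumes q: "q = 0 \<or> q = p" and n: "2 \<le> n" and z: "0 < z"
  shows "err q n z = JJ p q (rem_fam n z) (hbox n) - (\<Sum>m<M. (1 / (real n)\<^sup>2) ^ m * JJ p q (phi m z) (quadrant - hbox n))"
proof -
  define h where "h = 1 / (real n)\<^sup>2"
  define b where "b w = bern_per p (fst w) * bern_snd p q (snd w)" for w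
  have qp: "q \<le> p" using q by auto
  have hq: "hbox n \<subseteq> quadrant" by (auto simp: hbox_def)
  interpret even_family "rem_fam n z" p using z p_odd by (intro even_family_Rem)
  obtain c where c: "0 \<le> c" "\<And>w. w \<in> hbox n \<Longrightarrow> \<bar>Rem M n p q (fst w) (snd w) z\<bar> \<le> c * maj z w"
    using bounded_by_maj[OF z, of "real n / 2" "\<lambda>w. Rem M n p q (fst w) (snd w) z"] cont by (auto simp: hbox_def)
  have R: "set_integrable lborel (hbox n) (\<lambda>w. b w * Rem M n p q (fst w) (snd w) z)"
    unfolding b_def
    by (rule JJ_bound(1)[where F = "rem_fam n z", OF z borel_measurable_Rem sets_rect(3) hq c(1)]) (use c(2) in auto)
  have F: "set_integrable lborel (hbox n) (\<lambda>w. h ^ m * (b w * phi m z p q (fst w) (snd w)))" if "m < M" for m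
    unfolding b_def by (intro set_integrable_mult_right phi_integrable z that qp sets_rect hq)
  have "JJ p q (lat_fam n z) (hbox n) = (LINT w:hbox n|lborel. b w * Rem M n p q (fst w) (snd w) z
      + (\<Sum>m<M. h ^ m * (b w * phi m z p q (fst w) (snd w))))"
    unfolding JJ_def b_def[symmetric]
    by (intro arg_cong[where f = "\<lambda>f. set_lebesgue_integral lborel (hbox n) f"] ext)
      (simp add: Rem_def phi_def h_def right_diff_distrib sum_distrib_left mult_ac)
  also have "\<dots> = (LINT w:hbox n|lborel. b w * Rem M n p q (fst w) (snd w) z)
      + (\<Sum>m<M. (LINT w:hbox n|lborel. h ^ m * (b w * phi m z p q (fst w) (snd w))))"
  proof -
    have "(LINT w:hbox n|lborel. \<Sum>m<M. h ^ m * (b w * phi m z p q (fst w) (snd w)))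
        = (\<Sum>m<M. (LINT w:hbox n|lborel. h ^ m * (b w * phi m z p q (fst w) (snd w))))"
      using F unfolding set_lebesgue_integral_def set_integrable_def scaleR_sum_right
      by (intro Bochner_Integration.integral_sum) auto
    moreover have "set_integrable lborel (hbox n) (\<lambda>w. \<Sum>m<M. h ^ m * (b w * phi m z p q (fst w) (snd w)))"
      using F unfolding set_integrable_def scaleR_sum_right by (intro Bochner_Integration.integrable_sum) auto
    ultimately show ?thesis using R by (simp add: set_integral_add)
  qed
  also have "\<dots> = JJ p q (rem_fam n z) (hbox n) + (\<Sum>m<M. h ^ m * JJ p q (phi m z) (hbox n))"
    by (simp add: JJ_def b_def)
  finally have 1: "JJ p q (lat_fam n z) (hbox n) = JJ p q (rem_fam n z) (hbox n) + (\<Sum>m<M. h ^ m * JJ p q (phi m z) (hbox n))" .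
  have 2: "JJ p q (phi m z) quadrant = JJ p q (phi m z) (hbox n) + JJ p q (phi m z) (quadrant - hbox n)" if "m < M" for m
  proof -
    have "quadrant - hbox n \<in> sets borel" by (intro sets.Diff) auto
    then show ?thesis using hq by (intro JJ_split phi_integrable z that qp) auto
  qed
  show ?thesis unfolding err_def 1 unfolding h_def[symmetric]
    by (simp add: 2 distrib_left sum.distrib)
qed

text \<open>Two bounds that meet at z = n. The first is integrable against z^(3 - 2 Re s) at 0, the
  second at infinity.\<close>

lemma err_bound:
  assumes q: "q = 0 \<or> q = p"
  shows "\<exists>C\<ge>0. \<forall>n\<ge>2. \<forall>z>0. \<bar>err q n z\<bar> \<le> C * (1 / (real n)\<^sup>2) ^ M / z\<^sup>2 \<and>
     (real n \<le> z \<longrightarrow> \<bar>err q n z\<bar> \<le> C * (1 / (real n)\<^sup>2) ^ M * (real n)\<^sup>2 / z ^ 4)"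
proof -
  define A where "A = ((fact p)\<^sup>2 * (5 * (em_weight p)\<^sup>2 * 4 ^ M + 3 * 4 ^ M) + 4 * bern_bound p) * Rem_const"
  define A' where "A' = 16 * bern_bound p * Rem_const"
  define B where "B = 4 * bern_bound p * phi_const * 4 ^ M"
  define C where "C = A + A' + real M * B"
  have nn: "0 \<le> A" "0 \<le> A'" "0 \<le> B"
    unfolding A_def A'_def B_def using Rem_const(1) phi_const(1) bern_bound(1)[of p] by auto
  have "\<bar>err q n z\<bar> \<le> C * (1 / (real n)\<^sup>2) ^ M / z\<^sup>2 \<and>
     (real n \<le> z \<longrightarrow> \<bar>err q n z\<bar> \<le> C * (1 / (real n)\<^sup>2) ^ M * (real n)\<^sup>2 / z ^ 4)" if n: "2 \<le> n" and z: "0 < z" for n z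
  proof -
    define h where "h = 1 / (real n)\<^sup>2"
    have h: "0 < h" using n by (simp add: h_def)
    have tri: "\<bar>err q n z\<bar> \<le> (A + A') * t + real M * (B * t)"
      if a: "\<bar>JJ p q (rem_fam n z) (hbox n)\<bar> \<le> A * t \<or> \<bar>JJ p q (rem_fam n z) (hbox n)\<bar> \<le> A' * t"
        and b: "\<And>m. m < M \<Longrightarrow> h ^ m * \<bar>JJ p q (phi m z) (quadrant - hbox n)\<bar> \<le> B * t" and t: "0 \<le> t" for t
    proof -
      have "\<bar>\<Sum>m<M. h ^ m * JJ p q (phi m z) (quadrant - hbox n)\<bar> \<le> (\<Sum>m<M. h ^ m * \<bar>JJ p q (phi m z) (quadrant - hbox n)\<bar>)"
        using h by (intro order_trans[OF sum_abs] sum_mono) (simp add: abs_mult)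
      also have "\<dots> \<le> (\<Sum>m<M. B * t)" by (intro sum_mono b) auto
      finally have "\<bar>\<Sum>m<M. h ^ m * JJ p q (phi m z) (quadrant - hbox n)\<bar> \<le> real M * (B * t)" by simp
      moreover have "A * t \<le> (A + A') * t" "A' * t \<le> (A + A') * t" using nn t by (auto intro!: mult_right_mono)
      ultimately show ?thesis unfolding err_eq[OF q n z] h_def[symmetric] using a by linarith
    qed
    have tot: "(A + A') * t + real M * (B * t) = C * t" for t by (simp add: C_def algebra_simps)
    have "\<bar>err q n z\<bar> \<le> (A + A') * (h ^ M / z\<^sup>2) + real M * (B * (h ^ M / z\<^sup>2))"
      by (rule tri) (use JJ_rem_box[OF q n z] JJ_phi_outside(1)[OF q n z] h in \<open>auto simp: A_def B_def h_def\<close>)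
    then have 1: "\<bar>err q n z\<bar> \<le> C * (h ^ M / z\<^sup>2)" by (simp only: tot)
    have "\<bar>err q n z\<bar> \<le> (A + A') * (h ^ M * (real n)\<^sup>2 / z ^ 4) + real M * (B * (h ^ M * (real n)\<^sup>2 / z ^ 4))" if "real n \<le> z"
      by (rule tri) (use JJ_rem_box_large[OF q n that] JJ_phi_outside(2)[OF q n z] h in \<open>auto simp: A'_def B_def h_def mult.assoc\<close>)
    then have 2: "\<bar>err q n z\<bar> \<le> C * (h ^ M * (real n)\<^sup>2 / z ^ 4)" if "real n \<le> z" using that by (simp only: tot)
    show ?thesis using 1 2 by (simp add: h_def mult.assoc)
  qed
  moreover have "0 \<le> C" using nn by (simp add: C_def)
  ultimately show ?thesis by blast
qed

lemma borel_measurable_JJ: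
  assumes "(\<lambda>(z, w). F z p q (fst w) (snd w)) \<in> borel_measurable (borel \<Otimes>\<^sub>M (borel :: (real \<times> real) measure))"
    and A: "A \<in> sets borel"
  shows "(\<lambda>z::real. JJ p q (F z) A) \<in> borel_measurable borel"
proof -
  note [measurable] = assms borel_measurable_bern_fst_snd
  show ?thesis unfolding JJ_def set_lebesgue_integral_def
    by (rule lborel.borel_measurable_lebesgue_integral) (use A in measurable)
qed

lemma borel_measurable_JJ_phi: "(\<lambda>z. JJ p q (phi m z) quadrant) \<in> borel_measurable borel"
  by (rule borel_measurable_JJ) (auto simp: phi_def borel_prod[symmetric])

lemma borel_measurable_err: "(\<lambda>z. err q n z) \<in> borel_measurable borel"
proof -
  have "(\<lambda>z. JJ p q (lat_fam n z) (hbox n)) \<in> borel_measurable borel"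
    by (rule borel_measurable_JJ) (auto simp: borel_prod[symmetric] hbox_def)
  then show ?thesis unfolding err_def using borel_measurable_JJ_phi by measurable
qed

end

section \<open>Hadamard regularisation\<close>

lemma degree_shift_diff:
  fixes r :: "complex poly"
  assumes "pcompose r [:h, 1:] - r \<noteq> 0"
  shows "degree (pcompose r [:h, 1:] - r) < degree r"
proof (rule degree_less_if_less_eqI)
  show "degree (pcompose r [:h, 1:] - r) \<le> degree r"
    by (rule degree_diff_le) (simp_all add: degree_pcompose)
  show "coeff (pcompose r [:h, 1:] - r) (degree r) = 0"
    using lead_coeff_comp[of "[:h, 1:]" r] by (simp add: degree_pcompose)
qed (use assms in simp)

text \<open>The shift operators \<open>f(t + h) - e\<^sup>\<gamma>\<^sup>h f(t)\<close> lower the degree of the coefficient of \<open>e\<^sup>\<gamma>\<^sup>t\<close> and, for small \<open>h\<close>,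
  act injectively on the polynomial part.\<close>
lemma exp_poly_tendsto_0:
  fixes q :: "complex \<Rightarrow> complex poly"
  assumes F: "F = at_top \<or> F = (at_bot :: real filter)"
    and "finite \<Gamma>" "0 \<notin> \<Gamma>"
    and "((\<lambda>t. poly r (of_real t) + (\<Sum>\<gamma>\<in>\<Gamma>. exp (\<gamma> * of_real t) * poly (q \<gamma>) (of_real t))) \<longlongrightarrow> 0) F"
  shows "r = 0"
  using assms(2-)
proof (induction \<Gamma> arbitrary: q r rule: finite_induct)
  case empty
  then have lim: "((\<lambda>t. poly r (complex_of_real t)) \<longlongrightarrow> 0) F" by simp
  have F0: "F \<noteq> bot" using F by (elim disjE) simp_all
  show ?case
  proof (cases "degree r = 0")
    case True
    then obtain c where c: "r = [:c:]" by (metis degree_eq_zeroE)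
    with lim have "((\<lambda>_. c) \<longlongrightarrow> 0) F" by simp
    then have "c = 0" using F0 tendsto_const tendsto_unique by blast
    with c show ?thesis by simp
  next
    case False
    then obtain a r' where r: "r = pCons a r'" "r' \<noteq> 0" by (metis degree_pCons_0 pCons_cases)
    obtain R where R: "\<And>z. R \<le> norm z \<Longrightarrow> 1 \<le> norm (poly r z)"
      using poly_infinity[OF r(2), of 1 a] r(1) by auto
    have "eventually (\<lambda>t. R \<le> \<bar>t\<bar>) F"
      using F
    proof
      assume F: "F = at_top"
      show ?thesis unfolding F using eventually_ge_at_top[of R] by eventually_elim auto
    next
      assume F: "F = at_bot"
      show ?thesis unfolding F using eventually_le_at_bot[of "- R"] by eventually_elim auto
    qed
    moreover have "eventually (\<lambda>t. norm (poly r (complex_of_real t)) < 1) F"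
      using tendstoD[OF lim, of 1] by (simp add: dist_norm)
    ultimately have "eventually (\<lambda>t. False) F"
    proof eventually_elim
      case (elim t)
      then show ?case using R[of "complex_of_real t"] by simp
    qed
    with F0 show ?thesis by (simp add: eventually_False)
  qed
next
  case (insert \<gamma> \<Gamma>)
  have \<gamma>: "\<gamma> \<noteq> 0" using insert.prems by auto
  \<comment> \<open>The step is small enough for |\<gamma> h| < 1 < 2 pi, which keeps exp (\<gamma>
    h) away from 1.\<close>
  define h where "h = 1 / (1 + norm \<gamma>)"
  have h: "0 < h" by (simp add: h_def add_pos_nonneg)
  define E where "E \<delta> = exp (\<delta> * complex_of_real h)" for \<delta>
  have E1: "E \<gamma> \<noteq> 1"
  proof
    assume "E \<gamma> = 1"
    then obtain k where k: "Re (\<gamma> * h) = 0" "Im (\<gamma> * h) = of_int (2 * k) * pi"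
      unfolding E_def exp_eq_1 by blast
    have "norm (\<gamma> * complex_of_real h) = norm \<gamma> / (1 + norm \<gamma>)"
      using h unfolding norm_mult norm_of_real by (simp add: h_def)
    also have "\<dots> < 1" by (subst divide_less_eq_1_pos) (simp_all add: add_pos_nonneg)
    finally have small: "norm (\<gamma> * complex_of_real h) < 1" .
    have "k = 0"
    proof (rule ccontr)
      assume "k \<noteq> 0"
      then have "1 \<le> \<bar>real_of_int k\<bar>" by linarith
      then have "2 * pi \<le> \<bar>real_of_int (2 * k) * pi\<bar>" by (simp add: abs_mult)
      then have "2 * pi < 1" using abs_Im_le_cmod[of "\<gamma> * complex_of_real h"] small k(2) by linarith
      with pi_gt3 show False by linarith
    qed
    with k have "\<gamma> * complex_of_real h = 0" by (intro complex_eqI) auto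
    with \<gamma> h show False by simp
  qed
  define sh where "sh r = pcompose r [:complex_of_real h, 1:]" for r
  have sh: "poly (sh r) (of_real t) = poly r (of_real (t + h))" for r t
    by (simp add: sh_def poly_pcompose add.commute)
  show ?case using insert.prems(2)
  \<comment> \<open>The measure puts the zero polynomial below the nonzero constants, since one last
    shift turns a constant coefficient into zero; then \<gamma> drops out and the outer induction
    applies.\<close>
  proof (induction "if q \<gamma> = 0 then 0 else Suc (degree (q \<gamma>))" arbitrary: q r rule: less_induct)
    case less
    show ?case
    proof (cases "q \<gamma> = 0")
      case True
      then show ?thesis using less.prems insert by simp
    next
      case False
      define f where "f t = poly r (of_real t) + (\<Sum>\<delta>\<in>insert \<gamma> \<Gamma>. exp (\<delta> * of_real t) * poly (q \<delta>) (of_real t))" for t :: real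
      define r' where "r' = sh r - smult (E \<gamma>) r"
      define q' where "q' \<delta> = smult (E \<delta>) (sh (q \<delta>)) - smult (E \<gamma>) (q \<delta>)" for \<delta>
      have fl: "filterlim (\<lambda>t. t + h) F F"
        using F
      proof
        assume F: "F = at_top"
        show ?thesis unfolding F filterlim_at_top
        proof
          fix Z show "\<forall>\<^sub>F t in at_top. Z \<le> t + h"
            using eventually_ge_at_top[of "Z - h"] by eventually_elim simp
        qed
      next
        assume F: "F = at_bot"
        show ?thesis unfolding F filterlim_at_bot
        proof
          fix Z show "\<forall>\<^sub>F t in at_bot. t + h \<le> Z"
            using eventually_le_at_bot[of "Z - h"] by eventually_elim simp
        qed
      qed
      have lim: "(f \<longlongrightarrow> 0) F" using less.prems by (simp add: f_def[abs_def])
      have "((\<lambda>t. f (t + h) - E \<gamma> * f t) \<longlongrightarrow> 0 - E \<gamma> * 0) F"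
        by (intro tendsto_intros lim filterlim_compose[OF lim fl])
      moreover have "f (t + h) - E \<gamma> * f t = poly r' (of_real t) + (\<Sum>\<delta>\<in>insert \<gamma> \<Gamma>. exp (\<delta> * of_real t) * poly (q' \<delta>) (of_real t))" for t
      proof -
        have "exp (\<delta> * of_real (t + h)) * poly (q \<delta>) (of_real (t + h)) - E \<gamma> * (exp (\<delta> * of_real t) * poly (q \<delta>) (of_real t))
          = exp (\<delta> * of_real t) * poly (q' \<delta>) (of_real t)" for \<delta>
          unfolding q'_def poly_diff poly_smult sh by (simp add: E_def exp_add algebra_simps)
        then have "(\<Sum>\<delta>\<in>insert \<gamma> \<Gamma>. exp (\<delta> * of_real t) * poly (q' \<delta>) (of_real t))
          = (\<Sum>\<delta>\<in>insert \<gamma> \<Gamma>. exp (\<delta> * of_real (t + h)) * poly (q \<delta>) (of_real (t + h)))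
            - E \<gamma> * (\<Sum>\<delta>\<in>insert \<gamma> \<Gamma>. exp (\<delta> * of_real t) * poly (q \<delta>) (of_real t))"
          unfolding sum_distrib_left sum_subtractf[symmetric] by (intro sum.cong) auto
        then show ?thesis unfolding f_def r'_def poly_diff poly_smult sh by (simp only:) (simp only: algebra_simps)
      qed
      ultimately have lim': "((\<lambda>t. poly r' (of_real t) + (\<Sum>\<delta>\<in>insert \<gamma> \<Gamma>. exp (\<delta> * of_real t) * poly (q' \<delta>) (of_real t))) \<longlongrightarrow> 0) F"
        by simp
      have q\<gamma>: "q' \<gamma> = smult (E \<gamma>) (sh (q \<gamma>) - q \<gamma>)" by (simp add: q'_def smult_diff_right)
      have "E \<gamma> \<noteq> 0" by (simp add: E_def)
      then have "(if q' \<gamma> = 0 then 0 else Suc (degree (q' \<gamma>))) < (if q \<gamma> = 0 then 0 else Suc (degree (q \<gamma>)))"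
        using False degree_shift_diff[of "q \<gamma>" "of_real h"] by (auto simp: q\<gamma> sh_def)
      from less.hyps[OF this lim'] have r0: "r' = 0" .
      \<comment> \<open>The shift operator multiplies the leading coefficient of r by 1 - exp
        (\<gamma> h), which is nonzero; hence r' = 0 forces r = 0.\<close>
      have "coeff r' (degree r) = (1 - E \<gamma>) * lead_coeff r"
        using lead_coeff_comp[of "[:complex_of_real h, 1:]" r] by (simp add: r'_def sh_def degree_pcompose algebra_simps)
      with r0 E1 show ?thesis by simp
    qed
  qed
qed

text \<open>Terms are grouped by exponent into polynomials. The group of exponent 0 contains no
  constant term, because (0,0) is excluded, so c is the constant coefficient of a polynomial that
  must vanish.\<close>

lemma exp_sum_tendsto_0:
  fixes d :: "complex \<times> nat \<Rightarrow> complex"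
  assumes F: "F = at_top \<or> F = (at_bot :: real filter)" and U: "finite U" "(0, 0) \<notin> U"
    and lim: "((\<lambda>t. c + (\<Sum>p\<in>U. d p * exp (fst p * of_real t) * of_real t ^ snd p)) \<longlongrightarrow> 0) F"
  shows "c = 0"
proof -
  define q where "q \<gamma> = (\<Sum>p\<in>{p\<in>U. fst p = \<gamma>}. monom (d p) (snd p))" for \<gamma>
  define \<Gamma> where "\<Gamma> = fst ` U - {0}"
  have poly_q: "exp (\<gamma> * of_real t) * poly (q \<gamma>) (of_real t) = (\<Sum>p\<in>{p\<in>U. fst p = \<gamma>}. d p * exp (fst p * of_real t) * of_real t ^ snd p)" for \<gamma> and t :: real
    unfolding q_def poly_sum sum_distrib_left by (intro sum.cong) (auto simp: poly_monom mult_ac)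
  have "c + (\<Sum>p\<in>U. d p * exp (fst p * of_real t) * of_real t ^ snd p)
     = poly ([:c:] + q 0) (of_real t) + (\<Sum>\<gamma>\<in>\<Gamma>. exp (\<gamma> * of_real t) * poly (q \<gamma>) (of_real t))" for t :: real
  proof -
    have "(\<Sum>p\<in>U. d p * exp (fst p * of_real t) * of_real t ^ snd p) = (\<Sum>\<gamma>\<in>insert 0 \<Gamma>. exp (\<gamma> * of_real t) * poly (q \<gamma>) (of_real t))"
      unfolding poly_q using U by (intro sum.group[symmetric]) (auto simp: \<Gamma>_def)
    also have "\<dots> = poly (q 0) (of_real t) + (\<Sum>\<gamma>\<in>\<Gamma>. exp (\<gamma> * of_real t) * poly (q \<gamma>) (of_real t))"
      using U by (subst sum.insert) (auto simp: \<Gamma>_def)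
    finally show ?thesis by simp
  qed
  with lim have "((\<lambda>t. poly ([:c:] + q 0) (of_real t) + (\<Sum>\<gamma>\<in>\<Gamma>. exp (\<gamma> * of_real t) * poly (q \<gamma>) (of_real t))) \<longlongrightarrow> 0) F"
    by simp
  then have "[:c:] + q 0 = 0" using U by (intro exp_poly_tendsto_0[OF F]) (auto simp: \<Gamma>_def)
  then have "coeff ([:c:] + q 0) 0 = 0" by simp
  moreover have "coeff (q 0) 0 = 0"
    using U unfolding q_def coeff_sum by (intro sum.neutral) (auto simp: coeff_monom)
  ultimately show ?thesis by simp
qed

text \<open>With z = e^t the terms become e^(\<beta> t) t^k, and the limits z \<rightarrow> 0 and z
  \<rightarrow> \<infinity> are the two ends of one real line. The boundedness hypotheses reduce
  both remainders to o(1), and subtraction leaves an exponential sum with constant c' - c.\<close>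

lemma expansion_constant_unique:
  fixes d d' :: "complex \<times> nat \<Rightarrow> complex" and r r' :: real
  assumes F: "F = at_top \<or> F = (at_bot :: real filter)"
    and B: "finite B" "(0, 0) \<notin> B" "finite B'" "(0, 0) \<notin> B'"
    and v: "((\<lambda>t. norm (v (exp t) - c - (\<Sum>p\<in>B. d p * (complex_of_real (exp t)) powr (fst p) * (complex_of_real (ln (exp t))) ^ (snd p))) / exp t powr r) \<longlongrightarrow> 0) F"
    and v': "((\<lambda>t. norm (v (exp t) - c' - (\<Sum>p\<in>B'. d' p * (complex_of_real (exp t)) powr (fst p) * (complex_of_real (ln (exp t))) ^ (snd p))) / exp t powr r') \<longlongrightarrow> 0) F"
    and bd: "eventually (\<lambda>t. exp t powr r \<le> 1) F" "eventually (\<lambda>t. exp t powr r' \<le> 1) F"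
  shows "c = c'"
proof -
  have small: "(w \<longlongrightarrow> 0) F" if w: "((\<lambda>t. norm (w t) / exp t powr \<rho>) \<longlongrightarrow> 0) F" and "eventually (\<lambda>t. exp t powr \<rho> \<le> 1) F"
    for w :: "real \<Rightarrow> complex" and \<rho>
  proof (rule Lim_null_comparison[OF _ w])
    show "\<forall>\<^sub>F t in F. norm (w t) \<le> norm (w t) / exp t powr \<rho>"
      using that(2)
    proof eventually_elim
      case (elim t)
      have "norm (w t) * exp t powr \<rho> \<le> norm (w t) * 1" using elim by (intro mult_left_mono) auto
      then show ?case by (subst pos_le_divide_eq) auto
    qed
  qed
  define U where "U = B \<union> B'"
  define e where "e p = (if p \<in> B' then d' p else 0) - (if p \<in> B then d p else 0)" for p
  define X where "X p t = exp (fst p * complex_of_real t) * of_real t ^ snd p" for p :: "complex \<times> nat" and t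
  have pw: "(complex_of_real (exp t)) powr w = exp (w * of_real t)" for t w
    by (simp add: powr_def Ln_of_real)
  have "((\<lambda>t. (v (exp t) - c - (\<Sum>p\<in>B. d p * X p t)) - (v (exp t) - c' - (\<Sum>p\<in>B'. d' p * X p t))) \<longlongrightarrow> 0 - 0) F"
    using small[OF v bd(1)] small[OF v' bd(2)] unfolding pw X_def by (intro tendsto_diff) (simp_all add: mult.assoc)
  moreover have "(v (exp t) - c - (\<Sum>p\<in>B. d p * X p t)) - (v (exp t) - c' - (\<Sum>p\<in>B'. d' p * X p t))
     = (c' - c) + (\<Sum>p\<in>U. e p * exp (fst p * of_real t) * of_real t ^ snd p)" for t
  proof -
    have "(\<Sum>p\<in>B. d p * X p t) = (\<Sum>p\<in>U. (if p \<in> B then d p else 0) * X p t)"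
      using B by (intro sum.mono_neutral_cong_left) (auto simp: U_def)
    moreover have "(\<Sum>p\<in>B'. d' p * X p t) = (\<Sum>p\<in>U. (if p \<in> B' then d' p else 0) * X p t)"
      using B by (intro sum.mono_neutral_cong_left) (auto simp: U_def)
    ultimately show ?thesis by (simp add: e_def X_def sum_subtractf left_diff_distrib mult.assoc)
  qed
  ultimately have "((\<lambda>t. (c' - c) + (\<Sum>p\<in>U. e p * exp (fst p * of_real t) * of_real t ^ snd p)) \<longlongrightarrow> 0) F" by simp
  then have "c' - c = 0" using B by (intro exp_sum_tendsto_0[OF F]) (auto simp: U_def)
  then show ?thesis by simp
qed

lemma exp_at_right_0: "filterlim exp (at_right (0::real)) at_bot"
  using exp_at_bot by (auto simp: filterlim_at intro!: always_eventually)

lemma LIM0_eqI: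
  assumes "has_hexp_at_0 v c"
  shows "LIM0 v = c"
  unfolding LIM0_def
proof (rule the_equality, rule assms)
  fix c' assume "has_hexp_at_0 v c'"
  then obtain B d r where 1: "finite B" "(0, 0) \<notin> B" "r > 0"
    "((\<lambda>z. norm (v z - c' - (\<Sum>p\<in>B. d p * (complex_of_real z) powr (fst p) * (complex_of_real (ln z)) ^ (snd p))) / z powr r) \<longlongrightarrow> 0) (at_right 0)"
    unfolding has_hexp_at_0_def by blast
  obtain B' d' r' where 2: "finite B'" "(0, 0) \<notin> B'" "r' > 0"
    "((\<lambda>z. norm (v z - c - (\<Sum>p\<in>B'. d' p * (complex_of_real z) powr (fst p) * (complex_of_real (ln z)) ^ (snd p))) / z powr r') \<longlongrightarrow> 0) (at_right 0)"
    using assms unfolding has_hexp_at_0_def by blast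
  have bd: "eventually (\<lambda>t. exp t powr \<rho> \<le> 1) at_bot" if "\<rho> > 0" for \<rho> :: real
    using eventually_le_at_bot[of 0] by eventually_elim (use that in \<open>simp add: powr_def mult_nonneg_nonpos\<close>)
  show "c' = c"
    by (rule expansion_constant_unique[OF _ 1(1,2) 2(1,2) filterlim_compose[OF 1(4) exp_at_right_0] filterlim_compose[OF 2(4) exp_at_right_0] bd bd])
      (use 1 2 in auto)
qed

lemma LIMinf_eqI:
  assumes "has_hexp_at_inf v c"
  shows "LIMinf v = c"
  unfolding LIMinf_def
proof (rule the_equality, rule assms)
  fix c' assume "has_hexp_at_inf v c'"
  then obtain B d r where 1: "finite B" "(0, 0) \<notin> B" "r < 0"
    "((\<lambda>z. norm (v z - c' - (\<Sum>p\<in>B. d p * (complex_of_real z) powr (fst p) * (complex_of_real (ln z)) ^ (snd p))) / z powr r) \<longlongrightarrow> 0) at_top"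
    unfolding has_hexp_at_inf_def by blast
  obtain B' d' r' where 2: "finite B'" "(0, 0) \<notin> B'" "r' < 0"
    "((\<lambda>z. norm (v z - c - (\<Sum>p\<in>B'. d' p * (complex_of_real z) powr (fst p) * (complex_of_real (ln z)) ^ (snd p))) / z powr r') \<longlongrightarrow> 0) at_top"
    using assms unfolding has_hexp_at_inf_def by blast
  have bd: "eventually (\<lambda>t. exp t powr \<rho> \<le> 1) at_top" if "\<rho> < 0" for \<rho> :: real
    using eventually_ge_at_top[of 0] by eventually_elim (use that in \<open>simp add: powr_def mult_nonpos_nonneg\<close>)
  show "c' = c"
    by (rule expansion_constant_unique[OF _ 1(1,2) 2(1,2) filterlim_compose[OF 1(4) exp_at_top] filterlim_compose[OF 2(4) exp_at_top] bd bd])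
      (use 1 2 in auto)
qed

lemma set_integrable_of_has_integral:
  fixes f :: "real \<Rightarrow> real"
  assumes f: "f \<in> borel_measurable borel" "S \<in> sets borel" "(f has_integral I) S" "\<And>x. x \<in> S \<Longrightarrow> 0 \<le> f x"
  shows "set_integrable lborel S f" "(LINT x:S|lborel. f x) = I"
proof -
  have "f absolutely_integrable_on S"
    using assms by (intro nonnegative_absolutely_integrable_1) auto
  moreover have "(\<lambda>x. indicator S x *\<^sub>R f x) \<in> borel_measurable lborel"
    using f by measurable
  ultimately show i: "set_integrable lborel S f"
    unfolding set_integrable_def using integrable_completion by blast
  show "(LINT x:S|lborel. f x) = I"
    using set_borel_integral_eq_integral(2)[OF i] f(3) by (simp add: integral_unique)
qed

section \<open>Integrals against the Mellin weight\<close>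

locale strip =
  fixes s :: complex
  assumes s: "0 < Re s" "Re s < 1"
begin

definition u :: "real \<Rightarrow> complex" where
  "u z = complex_of_real z powr (3 - 2 * s)"

lemma norm_u: "0 < z \<Longrightarrow> norm (u z) = z powr (3 - 2 * Re s)"
  by (simp add: u_def norm_powr_real_powr)

lemma borel_measurable_u: "(\<lambda>z. indicator {0<..} z *\<^sub>R u z) \<in> borel_measurable borel"
  unfolding u_def by (intro borel_measurable_continuous_on_indicator continuous_intros) (auto simp: complex_nonpos_Reals_iff)

lemma u_dominated:
  assumes A: "A \<in> sets borel" "A \<subseteq> {0<..}" and F: "F \<in> borel_measurable borel"
    and G: "set_integrable lborel A G" "\<And>z. z \<in> A \<Longrightarrow> z powr (3 - 2 * Re s) * \<bar>F z\<bar> \<le> G z"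
  shows "set_integrable lborel A (\<lambda>z. u z * of_real (F z))"
    and "norm (LINT z:A|lborel. u z * of_real (F z)) \<le> (LINT z:A|lborel. G z)"
proof -
  have [measurable]: "A \<in> sets borel" "F \<in> borel_measurable borel" using assms by auto
  note [measurable] = borel_measurable_u
  have eq: "indicator A z *\<^sub>R (u z * of_real (F z)) = indicator A z *\<^sub>R ((indicator {0<..} z *\<^sub>R u z) * of_real (F z))" for z
    using A by (auto simp: indicator_def)
  have m: "(\<lambda>z. indicator A z *\<^sub>R (u z * of_real (F z))) \<in> borel_measurable lborel"
    unfolding eq by measurable
  have le: "norm (indicator A z *\<^sub>R (u z * of_real (F z))) \<le> indicator A z *\<^sub>R G z" for z
    using G(2)[of z] A norm_u[of z] by (auto simp: indicator_def norm_mult)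
  show i: "set_integrable lborel A (\<lambda>z. u z * of_real (F z))"
    unfolding set_integrable_def
  proof (rule Bochner_Integration.integrable_bound[OF G(1)[unfolded set_integrable_def] m])
    show "AE z in lborel. norm (indicator A z *\<^sub>R (u z * of_real (F z))) \<le> norm (indicator A z *\<^sub>R G z)"
      using le order_trans[OF le abs_ge_self] by auto
  qed
  show "norm (LINT z:A|lborel. u z * of_real (F z)) \<le> (LINT z:A|lborel. G z)"
    unfolding set_lebesgue_integral_def
    by (rule order_trans[OF integral_norm_bound], rule integral_mono)
      (use integrable_norm[OF i[unfolded set_integrable_def]] G(1) le in \<open>auto simp: set_integrable_def\<close>)
qed

lemma powr_near:
  assumes "0 \<le> T"
  shows "set_integrable lborel {0<..T} (\<lambda>z. C * z powr (1 - 2 * Re s))"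
    and "(LINT z:{0<..T}|lborel. C * z powr (1 - 2 * Re s)) = C * (T powr (2 - 2 * Re s) / (2 - 2 * Re s))"
proof -
  have "((\<lambda>z. z powr (1 - 2 * Re s)) has_integral (T powr (2 - 2 * Re s) / (2 - 2 * Re s))) {0..T}"
    using has_integral_powr_from_0[of "1 - 2 * Re s" T] s assms by simp
  from set_integrable_of_has_integral[OF _ _ this]
  have "set_integrable lborel {0..T} (\<lambda>z. z powr (1 - 2 * Re s))"
    "(LINT z:{0..T}|lborel. z powr (1 - 2 * Re s)) = T powr (2 - 2 * Re s) / (2 - 2 * Re s)" by auto
  moreover have "(\<lambda>z. indicator {0..T} z *\<^sub>R z powr (1 - 2 * Re s)) = (\<lambda>z. indicator {0<..T} z *\<^sub>R z powr (1 - 2 * Re s))"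
    by (auto simp: indicator_def fun_eq_iff)
  ultimately have "set_integrable lborel {0<..T} (\<lambda>z. z powr (1 - 2 * Re s))"
    "(LINT z:{0<..T}|lborel. z powr (1 - 2 * Re s)) = T powr (2 - 2 * Re s) / (2 - 2 * Re s)"
    unfolding set_integrable_def set_lebesgue_integral_def by (simp_all only:)
  then show "set_integrable lborel {0<..T} (\<lambda>z. C * z powr (1 - 2 * Re s))"
    "(LINT z:{0<..T}|lborel. C * z powr (1 - 2 * Re s)) = C * (T powr (2 - 2 * Re s) / (2 - 2 * Re s))"
    by auto
qed

lemma powr_far:
  assumes "0 < T"
  shows "set_integrable lborel {T..} (\<lambda>z. D * z powr (- 1 - 2 * Re s))"
    and "(LINT z:{T..}|lborel. D * z powr (- 1 - 2 * Re s)) = D * (T powr (- 2 * Re s) / (2 * Re s))"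
proof -
  have "((\<lambda>z. z powr (- 1 - 2 * Re s)) has_integral - (T powr (- 1 - 2 * Re s + 1)) / (- 1 - 2 * Re s + 1)) {T..}"
    using s assms by (intro has_integral_powr_to_inf) auto
  then have "((\<lambda>z. z powr (- 1 - 2 * Re s)) has_integral (T powr (- 2 * Re s) / (2 * Re s))) {T..}"
    by (simp add: field_simps)
  from set_integrable_of_has_integral[OF _ _ this]
  show "set_integrable lborel {T..} (\<lambda>z. D * z powr (- 1 - 2 * Re s))"
    "(LINT z:{T..}|lborel. D * z powr (- 1 - 2 * Re s)) = D * (T powr (- 2 * Re s) / (2 * Re s))" by auto
qed

lemma u_near:
  assumes T: "0 \<le> T" and A: "A \<in> sets borel" "A \<subseteq> {0<..T}" and F: "F \<in> borel_measurable borel"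
    and C: "\<And>z. z \<in> A \<Longrightarrow> \<bar>F z\<bar> \<le> C / z\<^sup>2" "0 \<le> C"
  shows "set_integrable lborel A (\<lambda>z. u z * of_real (F z))"
    and "norm (LINT z:A|lborel. u z * of_real (F z)) \<le> C * (T powr (2 - 2 * Re s) / (2 - 2 * Re s))"
proof -
  have i: "set_integrable lborel A (\<lambda>z. C * z powr (1 - 2 * Re s))"
    by (rule set_integrable_subset[OF powr_near(1)[OF T]]) (use A in auto)
  have le: "z powr (3 - 2 * Re s) * \<bar>F z\<bar> \<le> C * z powr (1 - 2 * Re s)" if z: "z \<in> A" for z
  proof -
    have z0: "0 < z" using z A by auto
    have "z powr (3 - 2 * Re s) * \<bar>F z\<bar> \<le> z powr ((1 - 2 * Re s) + 2) * (C / z\<^sup>2)"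
      using C(1)[OF z] by (intro mult_mono) auto
    also have "\<dots> = C * z powr (1 - 2 * Re s)" unfolding powr_add using z0 by simp
    finally show ?thesis .
  qed
  have A0: "A \<subseteq> {0<..}" using A by auto
  note * = u_dominated[OF A(1) A0 F i le]
  show "set_integrable lborel A (\<lambda>z. u z * of_real (F z))" by (rule *(1))
  have "(LINT z:A|lborel. C * z powr (1 - 2 * Re s)) \<le> (LINT z:{0<..T}|lborel. C * z powr (1 - 2 * Re s))"
    unfolding set_lebesgue_integral_def
    by (rule integral_mono) (use i powr_near(1)[OF T] A C in \<open>auto simp: set_integrable_def indicator_def\<close>)
  with *(2) show "norm (LINT z:A|lborel. u z * of_real (F z)) \<le> C * (T powr (2 - 2 * Re s) / (2 - 2 * Re s))"
    unfolding powr_near(2)[OF T] by linarith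
qed

lemma u_far:
  assumes T: "0 < T" and A: "A \<in> sets borel" "A \<subseteq> {T..}" and F: "F \<in> borel_measurable borel"
    and D: "\<And>z. z \<in> A \<Longrightarrow> \<bar>F z\<bar> \<le> D / z ^ 4" "0 \<le> D"
  shows "set_integrable lborel A (\<lambda>z. u z * of_real (F z))"
    and "norm (LINT z:A|lborel. u z * of_real (F z)) \<le> D * (T powr (- 2 * Re s) / (2 * Re s))"
proof -
  have i: "set_integrable lborel A (\<lambda>z. D * z powr (- 1 - 2 * Re s))"
    by (rule set_integrable_subset[OF powr_far(1)[OF T]]) (use A in auto)
  have le: "z powr (3 - 2 * Re s) * \<bar>F z\<bar> \<le> D * z powr (- 1 - 2 * Re s)" if z: "z \<in> A" for z
  proof -
    have z0: "0 < z" using z A T by auto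
    have "z powr (3 - 2 * Re s) * \<bar>F z\<bar> \<le> z powr ((- 1 - 2 * Re s) + 4) * (D / z ^ 4)"
      using D(1)[OF z] by (intro mult_mono) auto
    also have "\<dots> = D * z powr (- 1 - 2 * Re s)" unfolding powr_add using z0 by simp
    finally show ?thesis .
  qed
  have A0: "A \<subseteq> {0<..}" using A T by auto
  note * = u_dominated[OF A(1) A0 F i le]
  show "set_integrable lborel A (\<lambda>z. u z * of_real (F z))" by (rule *(1))
  have "(LINT z:A|lborel. D * z powr (- 1 - 2 * Re s)) \<le> (LINT z:{T..}|lborel. D * z powr (- 1 - 2 * Re s))"
    unfolding set_lebesgue_integral_def
    by (rule integral_mono) (use i powr_far(1)[OF T] A D in \<open>auto simp: set_integrable_def indicator_def\<close>)
  with *(2) show "norm (LINT z:A|lborel. u z * of_real (F z)) \<le> D * (T powr (- 2 * Re s) / (2 * Re s))"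
    unfolding powr_far(2)[OF T] by linarith
qed

text \<open>A bound z^-2 is integrable at 0 because Re s < 1, a bound z^-4 at infinity because Re s
  > 0. Used with T = 1 for the coefficients and with T = n for the error.\<close>

lemma u_integrable:
  assumes T: "0 < T" and F: "F \<in> borel_measurable borel"
    and C: "\<And>z. 0 < z \<Longrightarrow> z \<le> T \<Longrightarrow> \<bar>F z\<bar> \<le> C / z\<^sup>2" "0 \<le> C"
    and D: "\<And>z. T < z \<Longrightarrow> \<bar>F z\<bar> \<le> D / z ^ 4" "0 \<le> D"
  shows "set_integrable lborel {0<..} (\<lambda>z. u z * of_real (F z))"
    and "(LINT z:{0<..}|lborel. u z * of_real (F z)) = (LINT z:{0<..T}|lborel. u z * of_real (F z)) + (LINT z:{T<..}|lborel. u z * of_real (F z))"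
    and "norm (LINT z:{0<..}|lborel. u z * of_real (F z)) \<le> C * (T powr (2 - 2 * Re s) / (2 - 2 * Re s)) + D * (T powr (- 2 * Re s) / (2 * Re s))"
proof -
  have 1: "set_integrable lborel {0<..T} (\<lambda>z. u z * of_real (F z))"
    "norm (LINT z:{0<..T}|lborel. u z * of_real (F z)) \<le> C * (T powr (2 - 2 * Re s) / (2 - 2 * Re s))"
    by (rule u_near[where T = T and C = C]; use T C F in auto)+
  have 2: "set_integrable lborel {T<..} (\<lambda>z. u z * of_real (F z))"
    "norm (LINT z:{T<..}|lborel. u z * of_real (F z)) \<le> D * (T powr (- 2 * Re s) / (2 * Re s))"
    by (rule u_far[where T = T and D = D]; use T D F in auto)+
  have un: "{0<..} = {0<..T} \<union> {T<..}" using T by auto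
  show "set_integrable lborel {0<..} (\<lambda>z. u z * of_real (F z))"
    unfolding un by (intro set_integrable_Un 1 2) auto
  show *: "(LINT z:{0<..}|lborel. u z * of_real (F z)) = (LINT z:{0<..T}|lborel. u z * of_real (F z)) + (LINT z:{T<..}|lborel. u z * of_real (F z))"
    unfolding un by (intro set_integral_Un 1 2) auto
  show "norm (LINT z:{0<..}|lborel. u z * of_real (F z)) \<le> C * (T powr (2 - 2 * Re s) / (2 - 2 * Re s)) + D * (T powr (- 2 * Re s) / (2 * Re s))"
    unfolding * by (rule order_trans[OF norm_triangle_ineq]) (intro add_mono 1(2) 2(2))
qed

lemma of_real_powr_integral:
  assumes "0 < a" "a \<le> b" "w \<noteq> 0"
  shows "((\<lambda>z. complex_of_real z powr (w - 1)) has_integral (complex_of_real b powr w / w - complex_of_real a powr w / w)) {a..b}"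
proof (rule fundamental_theorem_of_calculus)
  fix x assume x: "x \<in> {a..b}"
  have "((\<lambda>z. z powr w / w) has_field_derivative (w * complex_of_real x powr (w - 1)) / w) (at (complex_of_real x))"
    using x assms by (intro DERIV_cdivide has_field_derivative_powr) (auto simp: complex_nonpos_Reals_iff)
  then have "((\<lambda>z. z powr w / w) has_field_derivative complex_of_real x powr (w - 1)) (at (complex_of_real x))"
    using assms by simp
  from has_vector_derivative_real_field[OF this]
  show "((\<lambda>z. complex_of_real z powr w / w) has_vector_derivative complex_of_real x powr (w - 1)) (at x within {a..b})" .
qed (use assms in auto)

lemma of_real_inverse_integral:
  assumes "0 < a" "a \<le> b"
  shows "((\<lambda>z. complex_of_real z powr (- 1)) has_integral complex_of_real (ln b - ln a)) {a..b}"
proof -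
  have "((\<lambda>z. 1 / z) has_integral (ln b - ln a)) {a..b}"
    using assms by (intro fundamental_theorem_of_calculus)
      (auto simp: has_real_derivative_iff_has_vector_derivative[symmetric] intro!: derivative_eq_intros)
  from has_integral_of_real[OF this]
  have "((\<lambda>z. complex_of_real (1 / z)) has_integral complex_of_real (ln b - ln a)) {a..b}" .
  then show ?thesis
    by (rule has_integral_eq[rotated]) (use assms in \<open>auto simp: powr_minus divide_inverse\<close>)
qed

lemma u_mult_inverse_power:
  assumes "0 < z"
  shows "u z * complex_of_real (1 / z ^ k) = complex_of_real z powr (3 - 2 * s - of_nat k)"
  using assms by (simp add: u_def powr_diff powr_nat' divide_inverse)

text \<open>Finite part of \<open>\<integral> z powr (- 2 * s) dz\<close> over \<open>{e..1}\<close> as \<open>e \<rightarrow> 0\<close>; at \<open>s = 1 / 2\<close> the integral is a pure logarithm.\<close>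
definition L3 :: complex where
  "L3 = (if s = 1 / 2 then 0 else 1 / (1 - 2 * s))"

text \<open>The singular part is removed on (0,1] only; beyond 1 the function decays by itself, and
  subtracting z^-3 there would destroy integrability for small Re s.\<close>

definition g_reg :: "(real \<Rightarrow> real) \<Rightarrow> real \<Rightarrow> real \<Rightarrow> real \<Rightarrow> real" where
  "g_reg g c4 c3 z = g z - (if z \<le> 1 then c4 / z ^ 4 + c3 / z ^ 3 else 0)"

text \<open>Only the explicit powers need regularisation. The finite part of the integral of
  z^(-1-2s) over [e,1] is -1/(2s), that of z^(-2s) is \<open>L3\<close>, and at infinity there is an
  ordinary limit.\<close>

lemma hfint_eval:
  assumes g: "g \<in> borel_measurable borel"
    and C: "\<And>z. 0 < z \<Longrightarrow> z \<le> 1 \<Longrightarrow> \<bar>g z - (c4 / z ^ 4 + c3 / z ^ 3)\<bar> \<le> C / z\<^sup>2" "0 \<le> C"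
    and D: "\<And>z. 1 \<le> z \<Longrightarrow> \<bar>g z\<bar> \<le> D / z ^ 4" "0 \<le> D"
    and v: "\<And>z. 0 < z \<Longrightarrow> v z = u z * of_real (g z)"
  shows "set_integrable lborel {0<..} (\<lambda>z. u z * of_real (g_reg g c4 c3 z))"
    and "hfint v = (LINT z:{0<..}|lborel. u z * of_real (g_reg g c4 c3 z)) - of_real c4 / (2 * s) + of_real c3 * L3"
proof -
  define \<rho> where "\<rho> = g_reg g c4 c3"
  have \<rho>m: "\<rho> \<in> borel_measurable borel" unfolding \<rho>_def g_reg_def using g by measurable
  have \<rho>C: "\<bar>\<rho> z\<bar> \<le> C / z\<^sup>2" if "0 < z" "z \<le> 1" for z using C(1)[OF that] that by (simp add: \<rho>_def g_reg_def)
  have \<rho>D: "\<bar>\<rho> z\<bar> \<le> D / z ^ 4" if "1 < z" for z using D(1)[of z] that by (simp add: \<rho>_def g_reg_def)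
  note I = u_integrable[of 1, OF _ \<rho>m \<rho>C C(2) \<rho>D D(2)]
  show "set_integrable lborel {0<..} (\<lambda>z. u z * of_real (g_reg g c4 c3 z))"
    using I(1) by (simp add: \<rho>_def)
  define N where "N = (LINT z:{0<..1}|lborel. u z * of_real (\<rho> z))"
  define X where "X = (LINT z:{1<..}|lborel. u z * of_real (\<rho> z))"
  have tot: "(LINT z:{0<..}|lborel. u z * of_real (g_reg g c4 c3 z)) = N + X"
    using I(2) by (simp add: \<rho>_def N_def X_def)
  have i1: "set_integrable lborel {0<..1} (\<lambda>z. u z * of_real (\<rho> z))"
    by (rule u_near(1)[of 1 _ _ C]) (use \<rho>m \<rho>C C in auto)
  have i2: "set_integrable lborel {1<..} (\<lambda>z. u z * of_real (\<rho> z))"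
    by (rule u_far(1)[of 1 _ _ D]) (use \<rho>m \<rho>D D in auto)
  have s0: "s \<noteq> 0" using s by auto
  have near: "has_hexp_at_0 (\<lambda>e. integral {e..1} v) (N - of_real c4 / (2 * s) + of_real c3 * L3)"
  proof -
    \<comment> \<open>The divergent terms as e \<rightarrow> 0: e^(-2s) from z^-4 and e^(1-2s) from
      z^-3. For s = 1/2 the latter becomes the pure logarithm, with index (0,1).\<close>
    define B :: "(complex \<times> nat) set" where "B = (if s = 1 / 2 then {(- 2 * s, 0), (0, 1)} else {(- 2 * s, 0), (1 - 2 * s, 0)})"
    define d where "d p = (if p = (- 2 * s, 0) then of_real c4 / (2 * s) else if s = 1 / 2 then - of_real c3 else - of_real c3 / (1 - 2 * s))" for p :: "complex \<times> nat"
    have ne: "- 2 * s \<noteq> 1 - 2 * s" by simp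
    have eq: "integral {e..1} v - (N - of_real c4 / (2 * s) + of_real c3 * L3)
        - (\<Sum>p\<in>B. d p * complex_of_real e powr fst p * complex_of_real (ln e) ^ snd p) = - (LINT z:{0<..<e}|lborel. u z * of_real (\<rho> z))"
      if e: "0 < e" "e < 1" for e
    proof -
      have ie: "set_integrable lborel {e..1} (\<lambda>z. u z * of_real (\<rho> z))" "set_integrable lborel {0<..<e} (\<lambda>z. u z * of_real (\<rho> z))"
        by (rule set_integrable_subset[OF i1]; use e in auto)+
      have un: "{0<..1} = {0<..<e} \<union> {e..1}" using e by auto
      have N: "N = (LINT z:{0<..<e}|lborel. u z * of_real (\<rho> z)) + (LINT z:{e..1}|lborel. u z * of_real (\<rho> z))"
        unfolding N_def un by (rule set_integral_Un) (use ie in auto)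
      have h0: "((\<lambda>z. u z * of_real (\<rho> z)) has_integral (LINT z:{e..1}|lborel. u z * of_real (\<rho> z))) {e..1}"
        using set_borel_integral_eq_integral[OF ie(1)] by (simp add: has_integral_iff)
      have h4: "((\<lambda>z. of_real c4 * complex_of_real z powr (- 2 * s - 1)) has_integral
          of_real c4 * (complex_of_real 1 powr (- 2 * s) / (- 2 * s) - complex_of_real e powr (- 2 * s) / (- 2 * s))) {e..1}"
        by (intro has_integral_mult_right of_real_powr_integral) (use e s0 in auto)
      have h3: "((\<lambda>z. of_real c3 * complex_of_real z powr (- 2 * s)) has_integral
          of_real c3 * L3 + of_real c3 * (if s = 1 / 2 then - of_real (ln e) else - (complex_of_real e powr (1 - 2 * s) / (1 - 2 * s)))) {e..1}"
      proof (cases "s = 1 / 2")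
        case True
        have "((\<lambda>z. of_real c3 * complex_of_real z powr (- 1)) has_integral of_real c3 * complex_of_real (ln 1 - ln e)) {e..1}"
          by (intro has_integral_mult_right of_real_inverse_integral) (use e in auto)
        moreover have e2: "- 2 * s = - 1" by (simp only: True) simp
        ultimately show ?thesis unfolding e2 using True by (simp add: L3_def)
      next
        case False
        then have "1 - 2 * s \<noteq> 0" by (auto simp: mult.commute)
        then have "((\<lambda>z. of_real c3 * complex_of_real z powr ((1 - 2 * s) - 1)) has_integral
           of_real c3 * (complex_of_real 1 powr (1 - 2 * s) / (1 - 2 * s) - complex_of_real e powr (1 - 2 * s) / (1 - 2 * s))) {e..1}"
          by (intro has_integral_mult_right of_real_powr_integral) (use e in auto)
        then show ?thesis using False by (simp add: L3_def algebra_simps)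
      qed
      have "(v has_integral ((LINT z:{e..1}|lborel. u z * of_real (\<rho> z))
          + of_real c4 * (complex_of_real 1 powr (- 2 * s) / (- 2 * s) - complex_of_real e powr (- 2 * s) / (- 2 * s))
          + (of_real c3 * L3 + of_real c3 * (if s = 1 / 2 then - of_real (ln e) else - (complex_of_real e powr (1 - 2 * s) / (1 - 2 * s)))))) {e..1}"
      proof (rule has_integral_eq[OF _ has_integral_add[OF has_integral_add[OF h0 h4] h3]])
        fix z assume "z \<in> {e..1}"
        then have z: "0 < z" "z \<le> 1" using e by auto
        have "g z = \<rho> z + c4 * (1 / z ^ 4) + c3 * (1 / z ^ 3)" using z by (simp add: \<rho>_def g_reg_def)
        then have "v z = u z * of_real (\<rho> z) + of_real c4 * (u z * of_real (1 / z ^ 4)) + of_real c3 * (u z * of_real (1 / z ^ 3))"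
          unfolding v[OF z(1)] by (simp add: algebra_simps)
        moreover have "3 - 2 * s - of_nat 4 = - 2 * s - 1" "3 - 2 * s - of_nat 3 = - 2 * s" by simp_all
        ultimately show "u z * of_real (\<rho> z) + of_real c4 * complex_of_real z powr (- 2 * s - 1) + of_real c3 * complex_of_real z powr (- 2 * s) = v z"
          unfolding u_mult_inverse_power[OF z(1)] by (simp only:)
      qed
      then have v_eq: "integral {e..1} v = (LINT z:{e..1}|lborel. u z * of_real (\<rho> z))
          + of_real c4 * (1 / (- 2 * s) - complex_of_real e powr (- 2 * s) / (- 2 * s))
          + (of_real c3 * L3 + of_real c3 * (if s = 1 / 2 then - of_real (ln e) else - (complex_of_real e powr (1 - 2 * s) / (1 - 2 * s))))"
        by (simp add: integral_unique)
      have "(\<Sum>p\<in>B. d p * complex_of_real e powr fst p * complex_of_real (ln e) ^ snd p)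
         = of_real c4 / (2 * s) * complex_of_real e powr (- 2 * s) + of_real c3 * (if s = 1 / 2 then - of_real (ln e) else - (complex_of_real e powr (1 - 2 * s) / (1 - 2 * s)))"
        using e by (auto simp: B_def d_def)
      then show ?thesis unfolding v_eq N using s0 by (simp add: algebra_simps)
    qed
    \<comment> \<open>The remainder is of order e^(2 - 2 Re s); dividing by half of that power
      leaves a factor that still tends to 0.\<close>
    have lim: "((\<lambda>z. norm (integral {z..1} v - (N - of_real c4 / (2 * s) + of_real c3 * L3)
        - (\<Sum>p\<in>B. d p * complex_of_real z powr fst p * complex_of_real (ln z) ^ snd p)) / z powr (1 - Re s)) \<longlongrightarrow> 0) (at_right 0)"
    proof (rule Lim_null_comparison)
      show "\<forall>\<^sub>F z in at_right 0. norm (norm (integral {z..1} v - (N - of_real c4 / (2 * s) + of_real c3 * L3)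
        - (\<Sum>p\<in>B. d p * complex_of_real z powr fst p * complex_of_real (ln z) ^ snd p)) / z powr (1 - Re s)) \<le> C / (2 - 2 * Re s) * z powr (1 - Re s)"
        using eventually_at_right_real[OF zero_less_one]
      proof eventually_elim
        case (elim e)
        then have e: "0 < e" "e < 1" by auto
        have "norm (LINT z:{0<..<e}|lborel. u z * of_real (\<rho> z)) \<le> C * (e powr (2 - 2 * Re s) / (2 - 2 * Re s))"
          by (rule u_near(2)) (use e \<rho>m \<rho>C C in auto)
        also have "\<dots> = C / (2 - 2 * Re s) * e powr ((1 - Re s) + (1 - Re s))" by simp
        also have "\<dots> = C / (2 - 2 * Re s) * e powr (1 - Re s) * e powr (1 - Re s)" unfolding powr_add by simp
        finally show ?case unfolding eq[OF e] using e by (simp add: divide_le_eq)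
      qed
      have "((\<lambda>z. z powr (1 - Re s)) \<longlongrightarrow> 0) (at_right (0::real))"
        using s tendsto_powr'[of "\<lambda>z. z" 0 "at_right 0" "\<lambda>_. 1 - Re s" "1 - Re s"]
        by (auto simp: eventually_at_right_less eventually_mono[OF eventually_at_right_less])
      from tendsto_mult_left[OF this, of "C / (2 - 2 * Re s)"]
      show "((\<lambda>z. C / (2 - 2 * Re s) * z powr (1 - Re s)) \<longlongrightarrow> 0) (at_right 0)" by simp
    qed
    have "finite B" "(0, 0) \<notin> B" using s0 by (auto simp: B_def mult.commute)
    then show ?thesis unfolding has_hexp_at_0_def using lim s by (intro exI[of _ B] exI[of _ d] exI[of _ "1 - Re s"]) auto
  qed
  have far: "has_hexp_at_inf (\<lambda>R. integral {1..R} v) X"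
  proof -
    have eq: "integral {1..R} v - X = - (LINT z:{R<..}|lborel. u z * of_real (\<rho> z))" if R: "1 \<le> R" for R
    proof -
      have ie: "set_integrable lborel {1<..R} (\<lambda>z. u z * of_real (\<rho> z))" "set_integrable lborel {R<..} (\<lambda>z. u z * of_real (\<rho> z))"
        by (rule set_integrable_subset[OF i2]; use R in auto)+
      have un: "{1<..} = {1<..R} \<union> {R<..}" using R by auto
      have X: "X = (LINT z:{1<..R}|lborel. u z * of_real (\<rho> z)) + (LINT z:{R<..}|lborel. u z * of_real (\<rho> z))"
        unfolding X_def un by (rule set_integral_Un) (use ie in auto)
      have "((\<lambda>z. u z * of_real (\<rho> z)) has_integral (LINT z:{1<..R}|lborel. u z * of_real (\<rho> z))) {1<..R}"
        using set_borel_integral_eq_integral[OF ie(1)] by (simp add: has_integral_iff)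
      then have "(v has_integral (LINT z:{1<..R}|lborel. u z * of_real (\<rho> z))) {1<..R}"
        by (rule has_integral_eq[rotated]) (auto simp: v \<rho>_def g_reg_def)
      then have "integral {1<..R} v = (LINT z:{1<..R}|lborel. u z * of_real (\<rho> z))" by (rule integral_unique)
      moreover have "integral {1..R} v = integral {1<..R} v"
      proof (rule integral_spike_set)
        show "negligible {x \<in> {1..R} - {1<..R}. v x \<noteq> 0}"
          by (rule negligible_subset[OF negligible_sing[of 1]]) auto
        have "{x \<in> {1<..R} - {1..R}. v x \<noteq> 0} = {}" by auto
        then show "negligible {x \<in> {1<..R} - {1..R}. v x \<noteq> 0}" by (simp only: negligible_empty)
      qed
      ultimately show ?thesis using X by simp
    qed
    \<comment> \<open>No expansion terms at infinity: the tail is of order R^(-2 Re s), and half of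
      that exponent is kept for the remainder.\<close>
    have lim: "((\<lambda>z. norm (integral {1..z} v - X - (\<Sum>p\<in>{}. (\<lambda>_. 0) p * complex_of_real z powr fst p * complex_of_real (ln z) ^ snd p)) / z powr (- Re s)) \<longlongrightarrow> 0) at_top"
    proof (rule Lim_null_comparison)
      show "\<forall>\<^sub>F z in at_top. norm (norm (integral {1..z} v - X - (\<Sum>p\<in>{}. (\<lambda>_. 0) p * complex_of_real z powr fst p * complex_of_real (ln z) ^ snd p)) / z powr (- Re s)) \<le> D / (2 * Re s) * z powr (- Re s)"
        using eventually_ge_at_top[of 1]
      proof eventually_elim
        case (elim R)
        have "norm (LINT z:{R<..}|lborel. u z * of_real (\<rho> z)) \<le> D * (R powr (- 2 * Re s) / (2 * Re s))"
          by (rule u_far(2)) (use elim \<rho>m \<rho>D D in auto)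
        also have "\<dots> = D / (2 * Re s) * R powr ((- Re s) + (- Re s))" by simp
        also have "\<dots> = D / (2 * Re s) * R powr (- Re s) * R powr (- Re s)" unfolding powr_add by simp
        finally show ?case using eq[OF elim] elim by (simp add: divide_le_eq)
      qed
      have "((\<lambda>z::real. z powr (- Re s)) \<longlongrightarrow> 0) at_top"
        using s by (intro tendsto_neg_powr filterlim_ident) auto
      from tendsto_mult_left[OF this, of "D / (2 * Re s)"]
      show "((\<lambda>z. D / (2 * Re s) * z powr (- Re s)) \<longlongrightarrow> 0) at_top" by simp
    qed
    then show ?thesis unfolding has_hexp_at_inf_def using s
      by (intro exI[of _ "{}"] exI[of _ "\<lambda>_. 0"] exI[of _ "- Re s"]) auto
  qed
  show "hfint v = (LINT z:{0<..}|lborel. u z * of_real (g_reg g c4 c3 z)) - of_real c4 / (2 * s) + of_real c3 * L3"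
    unfolding hfint_def LIM0_eqI[OF near] LIMinf_eqI[OF far] tot by simp
qed

end

section \<open>The Mellin integral\<close>

lemma of_real_powr_exp: "0 < x \<Longrightarrow> complex_of_real x powr w = exp (w * of_real (ln x))"
  by (simp add: powr_def Ln_of_real)

lemma laplace_identity:
  fixes c :: real
  assumes "0 < c"
  shows "set_integrable lborel {0<..} (\<lambda>v. v * exp (- (c * v)))"
    and "(LINT v:{0<..}|lborel. v * exp (- (c * v))) = 1 / c\<^sup>2"
proof -
  define F where "F v = - (v / c + 1 / c\<^sup>2) * exp (- (c * v))" for v :: real
  have d: "(F has_real_derivative v * exp (- (c * v))) (at v)" for v
    unfolding F_def using assms by (auto intro!: derivative_eq_intros simp: field_simps power2_eq_square)
  have "((\<lambda>v. - ((1 / c\<^sup>2) * ((c * v) ^ 1 / exp (c * v)) + (1 / c\<^sup>2) * ((c * v) ^ 0 / exp (c * v)))) \<longlongrightarrow> - ((1 / c\<^sup>2) * 0 + (1 / c\<^sup>2) * 0)) at_top"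
    by (intro tendsto_intros filterlim_compose[OF tendsto_power_div_exp_0] filterlim_tendsto_pos_mult_at_top[OF tendsto_const assms filterlim_ident])
  moreover have "- ((1 / c\<^sup>2) * ((c * v) ^ 1 / exp (c * v)) + (1 / c\<^sup>2) * ((c * v) ^ 0 / exp (c * v))) = F v" for v
    using assms by (simp add: F_def exp_minus field_simps power2_eq_square)
  ultimately have lim: "(F \<longlongrightarrow> 0) at_top" by simp
  have "((\<lambda>v. v * exp (- (c * v))) has_integral 0 - F 0) {0..}"
  proof (rule has_integral_to_inf)
    show "(\<lambda>v. v * exp (- (c * v))) integrable_on {0..y}" for y
      by (intro integrable_continuous_real continuous_intros)
    have "integral {0..y} (\<lambda>v. v * exp (- (c * v))) = F y - F 0" if "0 \<le> y" for y
      by (intro integral_unique fundamental_theorem_of_calculus)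
        (auto simp: that has_real_derivative_iff_has_vector_derivative[symmetric] intro: has_field_derivative_at_within d)
    then have "\<forall>\<^sub>F y in at_top. F y - F 0 = integral {0..y} (\<lambda>v. v * exp (- (c * v)))"
      by (intro eventually_mono[OF eventually_ge_at_top[of 0]]) simp
    moreover have "((\<lambda>y. F y - F 0) \<longlongrightarrow> 0 - F 0) at_top" by (intro tendsto_intros lim)
    ultimately show "((\<lambda>y. integral {0..y} (\<lambda>v. v * exp (- (c * v)))) \<longlongrightarrow> 0 - F 0) at_top"
      by (rule Lim_transform_eventually[rotated])
  qed auto
  then have h: "((\<lambda>v. v * exp (- (c * v))) has_integral 1 / c\<^sup>2) {0..}" by (simp add: F_def)
  have "(\<lambda>v. indicator {0..} v *\<^sub>R (v * exp (- (c * v)))) = (\<lambda>v. indicator {0<..} v *\<^sub>R (v * exp (- (c * v))))"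
    by (auto simp: indicator_def fun_eq_iff)
  moreover have "set_integrable lborel {0..} (\<lambda>v. v * exp (- (c * v)))" "(LINT v:{0..}|lborel. v * exp (- (c * v))) = 1 / c\<^sup>2"
    using set_integrable_of_has_integral[OF _ _ h] by auto
  ultimately show "set_integrable lborel {0<..} (\<lambda>v. v * exp (- (c * v)))"
    "(LINT v:{0<..}|lborel. v * exp (- (c * v))) = 1 / c\<^sup>2"
    unfolding set_integrable_def set_lebesgue_integral_def by (simp_all only:)
qed

context strip
begin

lemma u_scale: "0 < c \<Longrightarrow> 0 < z \<Longrightarrow> u (c * z) = of_real c powr (3 - 2 * s) * u z"
  unfolding u_def of_real_powr_exp[of c] of_real_powr_exp[of z] of_real_powr_exp[OF mult_pos_pos]
  by (simp add: ln_mult exp_add[symmetric] algebra_simps)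

lemma u_integral_scale:
  assumes c: "0 < c"
  shows "(LINT z:{0<..}|lborel. u z * f z) = of_real c powr (4 - 2 * s) * (LINT z:{0<..}|lborel. u z * f (c * z))"
    and "set_integrable lborel {0<..} (\<lambda>z. u z * f z) \<longleftrightarrow> set_integrable lborel {0<..} (\<lambda>z. u z * f (c * z))"
proof -
  define G where "G z = indicator {0<..} z *\<^sub>R (u z * f z)" for z
  have G: "G (0 + c * z) = of_real c powr (3 - 2 * s) * (indicator {0<..} z *\<^sub>R (u z * f (c * z)))" for z
    using c u_scale[OF c, of z] by (auto simp: G_def indicator_def zero_less_mult_iff)
  have cc: "complex_of_real c * of_real c powr (3 - 2 * s) = of_real c powr (4 - 2 * s)"
    using c powr_add[of "complex_of_real c" 1 "3 - 2 * s"] by (simp add: algebra_simps)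
  have "integral\<^sup>L lborel G = \<bar>c\<bar> *\<^sub>R (LINT z|lborel. G (0 + c * z))"
    using c by (intro lborel_integral_real_affine) auto
  also have "\<dots> = of_real c powr (4 - 2 * s) * (LINT z:{0<..}|lborel. u z * f (c * z))"
    unfolding G set_lebesgue_integral_def using c by (simp add: scaleR_conv_of_real cc[symmetric] mult.assoc)
  finally show "(LINT z:{0<..}|lborel. u z * f z) = of_real c powr (4 - 2 * s) * (LINT z:{0<..}|lborel. u z * f (c * z))"
    by (simp add: G_def[abs_def] set_lebesgue_integral_def)
  have "integrable lborel G \<longleftrightarrow> integrable lborel (\<lambda>z. G (0 + c * z))"
    using c by (intro lborel_integrable_real_affine_iff[symmetric]) auto
  also have "\<dots> \<longleftrightarrow> integrable lborel (\<lambda>z. indicator {0<..} z *\<^sub>R (u z * f (c * z)))"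
  proof -
    have iff: "integrable lborel (\<lambda>z. k * g z) \<longleftrightarrow> integrable lborel g" if "k \<noteq> 0" for g :: "real \<Rightarrow> complex" and k
      using integrable_mult_right[of "1 / k" lborel "\<lambda>z. k * g z"] integrable_mult_right[of k lborel g] that by auto
    show ?thesis unfolding G by (rule iff) (use c in simp)
  qed
  finally show "set_integrable lborel {0<..} (\<lambda>z. u z * f z) \<longleftrightarrow> set_integrable lborel {0<..} (\<lambda>z. u z * f (c * z))"
    by (simp add: G_def[abs_def] set_integrable_def)
qed

text \<open>The substitution t = z^2 in the integral for \<Gamma>(2 - s).\<close>

lemma u_gauss:
  shows "set_integrable lborel {0<..} (\<lambda>z. u z * of_real (exp (- z\<^sup>2)))"
    and "(LINT z:{0<..}|lborel. u z * of_real (exp (- z\<^sup>2))) = Gamma (2 - s) / 2"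
proof -
  show i: "set_integrable lborel {0<..} (\<lambda>z. u z * of_real (exp (- z\<^sup>2)))"
  proof (rule u_integrable(1)[of 1 _ 1 2])
    fix z :: real assume "1 < z"
    have "z ^ 4 = (z\<^sup>2)\<^sup>2" by simp
    then have "z ^ 4 / 2 \<le> exp (z\<^sup>2)" using exp_lower_Taylor_quadratic[of "z\<^sup>2"] zero_le_power2[of z] by linarith
    then show "\<bar>exp (- z\<^sup>2)\<bar> \<le> 2 / z ^ 4" using \<open>1 < z\<close> by (simp add: exp_minus field_simps)
  next
    fix z :: real assume z: "0 < z" "z \<le> 1"
    have "exp (- z\<^sup>2) * z\<^sup>2 \<le> 1 * 1" using z by (intro mult_mono) (auto simp: power_le_one)
    then show "\<bar>exp (- z\<^sup>2)\<bar> \<le> 1 / z\<^sup>2" using z by (simp add: field_simps)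
  qed auto
  define f where "f t = complex_of_real t powr (2 - s - 1) / of_real (exp t)" for t
  have R: "Re (2 - s) > 0" using s by simp
  have [measurable]: "(\<lambda>t. indicator {0<..} t *\<^sub>R f t) \<in> borel_measurable borel"
    unfolding f_def by (intro borel_measurable_continuous_on_indicator continuous_intros) (auto simp: complex_nonpos_Reals_iff)
  have f_int: "set_integrable lborel {0<..} f"
    using absolutely_integrable_Gamma_integral'[OF R] unfolding set_integrable_def f_def[symmetric]
    by (subst (asm) integrable_completion) auto
  have sq: "(2 * z) *\<^sub>R f (z\<^sup>2) = 2 * (u z * of_real (exp (- z\<^sup>2)))" if "0 < z" for z
  proof -
    have "complex_of_real (z\<^sup>2) powr (2 - s - 1) = complex_of_real z powr (2 * (1 - s))"
      using that by (simp add: of_real_powr_exp ln_realpow algebra_simps flip: of_real_power)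
    moreover have "complex_of_real z * complex_of_real z powr (2 * (1 - s)) = u z"
      using that powr_add[of "complex_of_real z" 1 "2 * (1 - s)"] by (simp add: u_def algebra_simps)
    ultimately show ?thesis by (simp add: f_def scaleR_conv_of_real exp_minus field_simps)
  qed
  have ei: "einterval 0 \<infinity> = {0<..}" by (auto simp: einterval_def zero_ereal_def)
  have "(LBINT x=0..\<infinity>. f x) = (LBINT x=0..\<infinity>. (2 * x) *\<^sub>R f (x\<^sup>2))"
  proof (rule interval_integral_substitution_integrable)
    show "((ereal \<circ> (\<lambda>x. x\<^sup>2) \<circ> real_of_ereal) \<longlongrightarrow> 0) (at_right 0)"
      unfolding zero_ereal_def ereal_tendsto_simps by (auto intro!: tendsto_eq_intros)
    show "((ereal \<circ> (\<lambda>x. x\<^sup>2) \<circ> real_of_ereal) \<longlongrightarrow> \<infinity>) (at_left \<infinity>)"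
      unfolding ereal_tendsto_simps by (auto intro!: filterlim_pow_at_top filterlim_ident simp: tendsto_PInfty_eq_at_top)
    show "set_integrable lborel (einterval 0 \<infinity>) f" unfolding ei by (rule f_int)
    have "set_integrable lborel {0<..} (\<lambda>z. 2 * (u z * of_real (exp (- z\<^sup>2))))"
      using i by simp
    then show "set_integrable lborel (einterval 0 \<infinity>) (\<lambda>x. (2 * x) *\<^sub>R f (x\<^sup>2))"
      unfolding ei by (rule set_integrable_cong[THEN iffD1, rotated 3]) (use sq in auto)
  next
    fix x assume "0 < ereal x" 
    then have x: "0 < x" by (simp add: zero_ereal_def)
    show "isCont f (x\<^sup>2)" unfolding f_def using x by (intro continuous_intros) (auto simp: complex_nonpos_Reals_iff)
  qed (auto intro!: derivative_eq_intros simp: zero_ereal_def)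
  then have "(LINT z:{0<..}|lborel. f z) = (LINT z:{0<..}|lborel. (2 * z) *\<^sub>R f (z\<^sup>2))"
    by (simp add: interval_lebesgue_integral_def ei)
  also have "\<dots> = (LINT z:{0<..}|lborel. 2 * (u z * of_real (exp (- z\<^sup>2))))"
    by (rule set_lebesgue_integral_cong) (use sq in auto)
  also have "\<dots> = 2 * (LINT z:{0<..}|lborel. u z * of_real (exp (- z\<^sup>2)))" by simp
  finally have "(LINT z:{0<..}|lborel. f z) = 2 * (LINT z:{0<..}|lborel. u z * of_real (exp (- z\<^sup>2)))" .
  moreover have "(LINT z:{0<..}|lborel. f z) = Gamma (2 - s)"
    using set_borel_integral_eq_integral(2)[OF f_int] Gamma_integral_complex'[OF R] by (simp add: f_def[abs_def] integral_unique)
  ultimately show "(LINT z:{0<..}|lborel. u z * of_real (exp (- z\<^sup>2))) = Gamma (2 - s) / 2" by simp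
qed

lemma u_rational_integrable:
  assumes "0 < \<mu>"
  shows "set_integrable lborel {0<..} (\<lambda>z. u z * of_real (1 / (\<mu> + z\<^sup>2)\<^sup>2))"
proof (rule u_integrable(1)[of 1 _ "1 / \<mu>" 1])
  fix z :: real assume z: "0 < z" "z \<le> 1"
  have "\<mu> * z\<^sup>2 \<le> (\<mu> + z\<^sup>2) * (\<mu> + z\<^sup>2)" using assms by (intro mult_mono) auto
  then show "\<bar>1 / (\<mu> + z\<^sup>2)\<^sup>2\<bar> \<le> 1 / \<mu> / z\<^sup>2"
    using assms z by (simp add: power2_eq_square) (intro divide_left_mono mult_pos_pos, auto simp: mult.commute add_pos_pos)
next
  fix z :: real assume z: "1 < z"
  have "z\<^sup>2 * z\<^sup>2 \<le> (\<mu> + z\<^sup>2) * (\<mu> + z\<^sup>2)" using assms by (intro mult_mono) auto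
  then have "z ^ 4 \<le> (\<mu> + z\<^sup>2)\<^sup>2" by (simp add: power2_eq_square eval_nat_numeral)
  then show "\<bar>1 / (\<mu> + z\<^sup>2)\<^sup>2\<bar> \<le> 1 / z ^ 4"
    using assms z by (simp, intro divide_left_mono) (auto intro!: mult_pos_pos add_pos_pos)
qed (use assms in auto)

text \<open>A Beta integral by Fubini: (1 + w^2)^-2 is the Laplace integral of v e^(-v) e^(-v w^2).
  The Gaussian w-integral, rescaled by the root of v, gives \<Gamma>(2 - s) / 2 times v^(s-2), and
  the v-integral is \<Gamma>(s).\<close>

lemma u_rational_1: "(LINT z:{0<..}|lborel. u z * of_real (1 / (1 + z\<^sup>2)\<^sup>2)) = Gamma s * Gamma (2 - s) / 2"
proof -
  define k where "k v = indicator {0<..} v * (v * exp (- v))" for v :: real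
  define f where "f w v = (indicator {0<..} w *\<^sub>R u w) * of_real (indicator {0<..} v * (v * exp (- ((1 + w\<^sup>2) * v))))" for w v :: real
  note [measurable] = borel_measurable_u
  have m: "(\<lambda>(w, v). f w v) \<in> borel_measurable (lborel \<Otimes>\<^sub>M lborel)" unfolding f_def by measurable
  have lap: "integrable lborel (\<lambda>v. indicator {0<..} v * (v * exp (- ((1 + w\<^sup>2) * v))))"
     "(LINT v|lborel. indicator {0<..} v * (v * exp (- ((1 + w\<^sup>2) * v)))) = 1 / (1 + w\<^sup>2)\<^sup>2" for w :: real
  proof -
    have "0 < 1 + w\<^sup>2" by (simp add: add_pos_nonneg)
    from laplace_identity[OF this]
    show "integrable lborel (\<lambda>v. indicator {0<..} v * (v * exp (- ((1 + w\<^sup>2) * v))))"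
     "(LINT v|lborel. indicator {0<..} v * (v * exp (- ((1 + w\<^sup>2) * v)))) = 1 / (1 + w\<^sup>2)\<^sup>2"
      by (simp_all add: set_integrable_def set_lebesgue_integral_def)
  qed
  have inner_v: "(LINT v|lborel. f w v) = indicator {0<..} w *\<^sub>R (u w * of_real (1 / (1 + w\<^sup>2)\<^sup>2))" for w
    unfolding f_def by (simp only: integral_mult_right_zero integral_complex_of_real lap(2)) (simp add: scaleR_conv_of_real)
  have norm_v: "(LINT v|lborel. norm (f w v)) = norm (indicator {0<..} w *\<^sub>R (u w * of_real (1 / (1 + w\<^sup>2)\<^sup>2)))" for w
  proof -
    have "norm (f w v) = norm (indicator {0<..} w *\<^sub>R u w) * (indicator {0<..} v * (v * exp (- ((1 + w\<^sup>2) * v))))" for v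
      unfolding f_def norm_mult norm_of_real by (auto simp: indicator_def abs_mult)
    then show ?thesis
      by (simp only: integral_mult_right_zero lap(2) norm_scaleR norm_mult norm_of_real) (simp add: abs_mult)
  qed
  have int_w: "integrable lborel (\<lambda>w. indicator {0<..} w *\<^sub>R (u w * of_real (1 / (1 + w\<^sup>2)\<^sup>2)))"
    using u_rational_integrable[of 1] by (simp add: set_integrable_def)
  have I: "integrable (lborel \<Otimes>\<^sub>M lborel) (\<lambda>(w, v). f w v)"
  proof (rule lborel_pair.Fubini_integrable[OF m])
    show "integrable lborel (\<lambda>x. LINT y|lborel. norm (case (x, y) of (w, v) \<Rightarrow> f w v))"
      using integrable_norm[OF int_w] by (simp only: prod.case norm_v)
    have "integrable lborel (f w)" for w
      unfolding f_def by (intro integrable_mult_right integrable_of_real lap(1))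
    then show "AE x in lborel. integrable lborel (\<lambda>y. case (x, y) of (w, v) \<Rightarrow> f w v)" by simp
  qed
  have inner_w: "(LINT w|lborel. f w v) = indicator {0<..} v *\<^sub>R (Gamma (2 - s) / 2 * (of_real v powr (s - 1) / of_real (exp v)))" for v
  proof (cases "0 < v")
    case True
    have "(LINT w|lborel. f w v) = of_real (v * exp (- v)) * (LINT w:{0<..}|lborel. u w * of_real (exp (- (sqrt v * w)\<^sup>2)))"
    proof -
      have "f w v = of_real (v * exp (- v)) * (indicator {0<..} w *\<^sub>R (u w * of_real (exp (- (sqrt v * w)\<^sup>2))))" for w
        using True by (simp add: f_def power_mult_distrib exp_add[symmetric] algebra_simps flip: of_real_mult)
      then show ?thesis by (simp only: set_lebesgue_integral_def integral_mult_right_zero)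
    qed
    moreover have "Gamma (2 - s) / 2 = of_real (sqrt v) powr (4 - 2 * s) * (LINT w:{0<..}|lborel. u w * of_real (exp (- (sqrt v * w)\<^sup>2)))"
      using u_integral_scale(1)[of "sqrt v" "\<lambda>w. of_real (exp (- w\<^sup>2))"] True by (simp add: u_gauss(2))
    moreover have "of_real (sqrt v) powr (4 - 2 * s) = of_real v powr (2 - s)"
      using True by (simp add: of_real_powr_exp ln_sqrt algebra_simps)
    moreover have "of_real v powr (2 - s) \<noteq> 0" using True by simp
    ultimately have e1: "(LINT w|lborel. f w v) = of_real (v * exp (- v)) * (Gamma (2 - s) / 2 / of_real v powr (2 - s))"
      by (simp add: field_simps)
    have e2: "of_real v / of_real v powr (2 - s) = of_real v powr (s - 1)"
      using True powr_diff[of "complex_of_real v" 1 "2 - s"] by simp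
    have e3: "complex_of_real (exp (- v)) = 1 / of_real (exp v)"
      by (simp only: exp_minus inverse_eq_divide of_real_divide of_real_1)
    have "(LINT w|lborel. f w v) = (of_real v / of_real v powr (2 - s)) * of_real (exp (- v)) * (Gamma (2 - s) / 2)"
      unfolding e1 by simp
    then show ?thesis unfolding e2 e3 using True by (simp add: mult.commute)
  qed (simp add: f_def)
  have R: "Re s > 0" using s by simp
  have G: "(LINT v:{0<..}|lborel. of_real v powr (s - 1) / complex_of_real (exp v)) = Gamma s"
  proof -
    have [measurable]: "(\<lambda>t. indicator {0<..} t *\<^sub>R (of_real t powr (s - 1) / complex_of_real (exp t))) \<in> borel_measurable borel"
      by (intro borel_measurable_continuous_on_indicator continuous_intros) (auto simp: complex_nonpos_Reals_iff)
    have "set_integrable lborel {0<..} (\<lambda>v. of_real v powr (s - 1) / complex_of_real (exp v))"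
      using absolutely_integrable_Gamma_integral'[OF R] unfolding set_integrable_def
      by (subst (asm) integrable_completion) auto
    from set_borel_integral_eq_integral(2)[OF this] Gamma_integral_complex'[OF R] show ?thesis by (simp add: integral_unique)
  qed
  have "(LINT z:{0<..}|lborel. u z * of_real (1 / (1 + z\<^sup>2)\<^sup>2)) = (LINT w|lborel. LINT v|lborel. f w v)"
    unfolding inner_v set_lebesgue_integral_def by simp
  also have "\<dots> = (LINT v|lborel. LINT w|lborel. f w v)"
    using lborel_pair.integral_fst[OF I] lborel_pair.integral_snd[OF I] by simp
  also have "\<dots> = Gamma (2 - s) / 2 * (LINT v:{0<..}|lborel. of_real v powr (s - 1) / complex_of_real (exp v))"
    unfolding inner_w set_lebesgue_integral_def by (simp flip: integral_mult_right_zero)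
  finally show ?thesis unfolding G by simp
qed

text \<open>The reflection formula for \<Gamma>(s) \<Gamma>(1 - s) shows that \<open>V2\<close> is
  the reciprocal of the integral in \<open>u_rational_1\<close>.\<close>

lemma V2_eq: "V2 s = 2 / (Gamma s * Gamma (2 - s))" and V2_nonzero: "V2 s \<noteq> 0"
proof -
  have nz: "Gamma w \<noteq> 0" if "0 < Re w" for w :: complex
    using that by (auto simp: Gamma_eq_zero_iff nonpos_Ints_def)
  have g: "Gamma s \<noteq> 0" "Gamma (1 - s) \<noteq> 0" "Gamma (2 - s) \<noteq> 0" by (rule nz, use s in simp)+
  have refl: "Gamma s * Gamma (1 - s) = of_real pi / sin (of_real pi * s)" by (rule Gamma_reflection_complex)
  then have sin: "sin (of_real pi * s) \<noteq> 0" using g by auto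
  have G2: "Gamma (2 :: complex) = 1" using Gamma_fact[of 1, where 'a = complex] by (simp add: numeral_2_eq_2)
  have "sin (of_real pi * s) = of_real pi / (Gamma s * Gamma (1 - s))"
    using refl g sin by (simp add: field_simps)
  then show "V2 s = 2 / (Gamma s * Gamma (2 - s))"
    unfolding V2_def G2 using g by simp
  then show "V2 s \<noteq> 0" using g by simp
qed

lemma u_rational:
  assumes "0 < \<mu>"
  shows "V2 s * (LINT z:{0<..}|lborel. u z * of_real (1 / (\<mu> + z\<^sup>2)\<^sup>2)) = complex_of_real \<mu> powr (- s)"
proof -
  have "1 / (\<mu> + (sqrt \<mu> * z)\<^sup>2)\<^sup>2 = (1 / \<mu>\<^sup>2) * (1 / (1 + z\<^sup>2)\<^sup>2)" for z
  proof -
    have "\<mu> + (sqrt \<mu> * z)\<^sup>2 = \<mu> * (1 + z\<^sup>2)" using assms by (simp add: power_mult_distrib algebra_simps)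
    then show ?thesis by (simp add: power_mult_distrib)
  qed
  then have "(LINT z:{0<..}|lborel. u z * of_real (1 / (\<mu> + z\<^sup>2)\<^sup>2))
     = of_real (sqrt \<mu>) powr (4 - 2 * s) * (LINT z:{0<..}|lborel. u z * of_real ((1 / \<mu>\<^sup>2) * (1 / (1 + z\<^sup>2)\<^sup>2)))"
    using u_integral_scale(1)[of "sqrt \<mu>" "\<lambda>z. of_real (1 / (\<mu> + z\<^sup>2)\<^sup>2)"] assms by simp
  also have "(LINT z:{0<..}|lborel. u z * of_real ((1 / \<mu>\<^sup>2) * (1 / (1 + z\<^sup>2)\<^sup>2)))
     = of_real (1 / \<mu>\<^sup>2) * (LINT z:{0<..}|lborel. u z * of_real (1 / (1 + z\<^sup>2)\<^sup>2))"
  proof -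
    have "(\<lambda>z. indicator {0<..} z *\<^sub>R (u z * complex_of_real (a * b z))) = (\<lambda>z. of_real a * (indicator {0<..} z *\<^sub>R (u z * of_real (b z))))"
      for a b by (auto simp: fun_eq_iff)
    then show ?thesis unfolding set_lebesgue_integral_def by (simp only: integral_mult_right_zero)
  qed
  also have "of_real (sqrt \<mu>) powr (4 - 2 * s) = complex_of_real \<mu> powr (- s) * of_real (\<mu>\<^sup>2)"
  proof -
    have "complex_of_real \<mu> powr (- s) * of_real (\<mu>\<^sup>2) = of_real \<mu> powr (- s) * of_real \<mu> powr of_nat 2"
      using assms by (subst powr_nat') auto
    also have "\<dots> = of_real \<mu> powr (- s + of_nat 2)" by (rule powr_add[symmetric])
    finally show ?thesis using assms by (simp add: of_real_powr_exp ln_sqrt algebra_simps)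
  qed
  finally have X: "(LINT z:{0<..}|lborel. u z * of_real (1 / (\<mu> + z\<^sup>2)\<^sup>2)) = complex_of_real \<mu> powr (- s) * (Gamma s * Gamma (2 - s) / 2)"
    unfolding u_rational_1 using assms by simp
  have "Gamma s * Gamma (2 - s) \<noteq> 0" using V2_nonzero by (auto simp: V2_eq)
  then show ?thesis unfolding X V2_eq by simp
qed

end

section \<open>The asymptotic expansion\<close>

lemma integral_scale_unit:
  fixes f :: "real \<Rightarrow> real"
  assumes "0 < c"
  shows "integral {0..c} (\<lambda>x. f (x / c)) = c * integral {0..1} f"
proof -
  have *: "((\<lambda>x. f (x / c)) has_integral (I * c)) {0..c} \<longleftrightarrow> (f has_integral I) {0..1}" for I
    using has_integral_affinity_iff[of "1 / c" f 0 I 0 1] assms by (simp add: field_simps)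
  show ?thesis
  proof (cases "f integrable_on {0..1}")
    case True
    then show ?thesis using *[of "integral {0..1} f"] by (simp add: integral_unique integrable_integral mult.commute)
  next
    case False
    have "\<not> (\<lambda>x. f (x / c)) integrable_on {0..c}"
    proof
      assume "(\<lambda>x. f (x / c)) integrable_on {0..c}"
      then obtain J where "((\<lambda>x. f (x / c)) has_integral J) {0..c}" by (auto simp: integrable_on_def)
      then have "(f has_integral (J / c)) {0..1}" using *[of "J / c"] assms by simp
      with False show False by (auto simp: integrable_on_def)
    qed
    with False show ?thesis by (simp add: not_integrable_integral)
  qed
qed

context strip
begin

text \<open>The counterpart at infinity of the term -c4 / (2s) in \<open>hfint_eval\<close>:
  together they make the regularised integral of z^(3-2s) z^-4 zero.\<close>

lemma u_inverse_4_tail: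
  shows "set_integrable lborel {1<..} (\<lambda>z. u z * of_real (1 / z ^ 4))"
    and "(LINT z:{1<..}|lborel. u z * of_real (1 / z ^ 4)) = 1 / (2 * s)"
proof -
  have i: "set_integrable lborel {1..} (\<lambda>z. u z * of_real (1 / z ^ 4))"
    by (rule u_far(1)[of 1 _ _ 1]) auto
  show j: "set_integrable lborel {1<..} (\<lambda>z. u z * of_real (1 / z ^ 4))"
    by (rule set_integrable_subset[OF i]) auto
  have s0: "s \<noteq> 0" using s by auto
  have "(LINT z:{1..R}|lborel. u z * of_real (1 / z ^ 4)) = 1 / (2 * s) - complex_of_real R powr (- 2 * s) / (2 * s)" if R: "1 \<le> R" for R
  proof -
    have "set_integrable lborel {1..R} (\<lambda>z. u z * of_real (1 / z ^ 4))"
      by (rule set_integrable_subset[OF i]) auto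
    then have "(LINT z:{1..R}|lborel. u z * of_real (1 / z ^ 4)) = integral {1..R} (\<lambda>z. u z * of_real (1 / z ^ 4))"
      by (rule set_borel_integral_eq_integral(2))
    also have "\<dots> = integral {1..R} (\<lambda>z. complex_of_real z powr (- 2 * s - 1))"
    proof (rule integral_cong)
      fix z assume "z \<in> {1..R}"
      then have z: "0 < z" by simp
      have "3 - 2 * s - of_nat 4 = - 2 * s - 1" by simp
      with u_mult_inverse_power[OF z, of 4] show "u z * of_real (1 / z ^ 4) = complex_of_real z powr (- 2 * s - 1)"
        by (simp only:)
    qed
    also have "\<dots> = complex_of_real R powr (- 2 * s) / (- 2 * s) - complex_of_real 1 powr (- 2 * s) / (- 2 * s)"
      by (intro integral_unique of_real_powr_integral) (use R s0 in auto)
    finally show ?thesis by simp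
  qed
  then have ev: "\<forall>\<^sub>F R in at_top. 1 / (2 * s) - complex_of_real R powr (- 2 * s) / (2 * s) = (LINT z:{1..R}|lborel. u z * of_real (1 / z ^ 4))"
    by (intro eventually_mono[OF eventually_ge_at_top[of 1]]) simp
  have "((\<lambda>R. complex_of_real R powr (- 2 * s)) \<longlongrightarrow> 0) at_top"
  proof (rule tendsto_norm_zero_cancel)
    have "((\<lambda>R::real. R powr (- 2 * Re s)) \<longlongrightarrow> 0) at_top"
      using s by (intro tendsto_neg_powr filterlim_ident) auto
    then show "((\<lambda>R. norm (complex_of_real R powr (- 2 * s))) \<longlongrightarrow> 0) at_top"
    proof (rule Lim_transform_eventually)
      show "\<forall>\<^sub>F R in at_top. R powr (- 2 * Re s) = norm (complex_of_real R powr (- 2 * s))"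
        by (intro eventually_mono[OF eventually_gt_at_top[of 0]]) (simp add: norm_powr_real_powr)
    qed
  qed
  then have "((\<lambda>R. 1 / (2 * s) - complex_of_real R powr (- 2 * s) / (2 * s)) \<longlongrightarrow> 1 / (2 * s) - 0 / (2 * s)) at_top"
    using s0 by (intro tendsto_intros) auto
  then have l1: "((\<lambda>R. (LINT z:{1..R}|lborel. u z * of_real (1 / z ^ 4))) \<longlongrightarrow> 1 / (2 * s)) at_top"
    using Lim_transform_eventually[OF _ ev] by simp
  have l2: "((\<lambda>R. (LINT z:{1..R}|lborel. u z * of_real (1 / z ^ 4))) \<longlongrightarrow> (LINT z:{1..}|lborel. u z * of_real (1 / z ^ 4))) at_top"
    by (rule tendsto_set_lebesgue_integral_at_top[OF _ i]) auto
  have "(LINT z:{1..}|lborel. u z * of_real (1 / z ^ 4)) = 1 / (2 * s)"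
    using tendsto_unique[OF _ l2 l1] by simp
  moreover have "(LINT z:{1<..}|lborel. u z * of_real (1 / z ^ 4)) = (LINT z:{1..}|lborel. u z * of_real (1 / z ^ 4))"
  proof (rule set_integral_cong_set[symmetric])
    show "set_borel_measurable lborel {1..} (\<lambda>z. u z * of_real (1 / z ^ 4))"
      "set_borel_measurable lborel {1<..} (\<lambda>z. u z * of_real (1 / z ^ 4))"
      using borel_measurable_integrable[OF i[unfolded set_integrable_def]] borel_measurable_integrable[OF j[unfolded set_integrable_def]]
      unfolding set_borel_measurable_def by auto
    show "AE x in lborel. (x \<in> {1<..}) = (x \<in> {1::real..})"
      by (rule AE_I'[of "{1}"]) (auto simp: less_le)
  qed
  ultimately show "(LINT z:{1<..}|lborel. u z * of_real (1 / z ^ 4)) = 1 / (2 * s)" by simp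
qed

end

locale asym = star_em + strip
begin

text \<open>The coefficient of n^(-2m) in \<open>em_kernel\<close>, once the half cell has grown to
  the whole quadrant.\<close>

definition Rm :: "nat \<Rightarrow> real \<Rightarrow> real" where
  "Rm m z = 8 / fact p * JJ p 0 (phi m z) quadrant + 4 / (fact p)\<^sup>2 * JJ p p (phi m z) quadrant"

text \<open>The summand of the lattice point 0, whose eigenvalue is 0, as a power series in n^-2: it
  has a term of order 0 only.\<close>

definition delta4 :: "nat \<Rightarrow> real \<Rightarrow> real" where
  "delta4 m z = (if m = 0 then 1 / z ^ 4 else 0)"

lemma nested_phi:
  assumes z: "0 < z" and m: "m < M" and q: "q \<le> p"
  shows "integral {0..} (\<lambda>y. integral {0..} (\<lambda>x. bern_per p x * bern_snd p q y * phi m z p q x y)) = JJ p q (phi m z) quadrant"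
proof -
  define c where "c = bern_bound p * (phi_const * z powi (2 * int m - int p - int q))"
  define h where "h w = bern_per p (fst w) * bern_snd p q (snd w) * phi m z p q (fst w) (snd w)" for w
  have "\<bar>h (x, y)\<bar> \<le> c * maj z (x, y)" for x y
  proof -
    have "\<bar>phi m z p q x y\<bar> \<le> phi_const * z powi (2 * int m - int p - int q) * maj z (x, y)"
      using rad_ge(3)[of z x y] z by (intro phi_le_maj_ge z m q) auto
    then have "\<bar>bern_per p x * bern_snd p q y\<bar> * \<bar>phi m z p q x y\<bar> \<le> bern_bound p * (phi_const * z powi (2 * int m - int p - int q) * maj z (x, y))"
      using bern_bound[of p] by (intro mult_mono) auto
    then show ?thesis by (simp add: h_def c_def abs_mult mult.assoc)
  qed
  moreover have "h \<in> borel_measurable borel"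
    unfolding h_def by (rule borel_measurable_times[OF borel_measurable_bern_fst_snd borel_measurable_phi])
  moreover have "0 \<le> c" unfolding c_def using phi_const(1) bern_bound(1)[of p] z by auto
  ultimately have "integral {0..} (\<lambda>y. integral {0..} (\<lambda>x. h (x, y))) = (LINT w:quadrant|lborel. h w)"
    by (intro nested_integral_eq[OF z, where c = c]) auto
  then show ?thesis by (simp add: JJ_def h_def)
qed

lemma bcoef_eq_hfint:
  assumes m: "m < M"
  shows "bcoef (Phi m) M s =
     4 / of_real ((fact p)\<^sup>2) * hfint (\<lambda>z. u z * of_real (integral {0..} (\<lambda>y. integral {0..} (\<lambda>x.
        bern_per p x * bern_per p y * (deriv ^^ p) (\<lambda>x'. (deriv ^^ p) (\<lambda>y'. Phi m x' y' z) y) x))))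
   + 8 / of_real (fact p) * hfint (\<lambda>z. u z * of_real (integral {0..} (\<lambda>y. integral {0..} (\<lambda>x.
        bern_per p x * (deriv ^^ p) (\<lambda>x'. Phi m x' y z) x))))"
  unfolding bcoef_def p_def[symmetric] bern_per_def u_def by simp

lemma hfint_phi:
  assumes m: "m < M" and q: "q = 0 \<or> q = p"
    and v: "\<And>z. 0 < z \<Longrightarrow> v z = u z * of_real (JJ p q (phi m z) quadrant)"
    and c: "\<And>z. sing m q z = c4 / z ^ 4 + c3 / z ^ 3"
  shows "set_integrable lborel {0<..} (\<lambda>z. u z * of_real (g_reg (\<lambda>z. JJ p q (phi m z) quadrant) c4 c3 z))"
    and "hfint v = (LINT z:{0<..}|lborel. u z * of_real (g_reg (\<lambda>z. JJ p q (phi m z) quadrant) c4 c3 z)) - of_real c4 / (2 * s) + of_real c3 * L3"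
proof -
  have qp: "q \<le> p" using q by auto
  obtain D where D: "0 \<le> D" "\<And>m z. m < M \<Longrightarrow> 1 \<le> z \<Longrightarrow> \<bar>JJ p q (phi m z) quadrant\<bar> \<le> D / z ^ 5"
    using JJ_phi_large[OF qp] by auto
  obtain C where C: "0 \<le> C" "\<And>m z. m < M \<Longrightarrow> 0 < z \<Longrightarrow> z \<le> 1 \<Longrightarrow> \<bar>JJ p q (phi m z) quadrant - sing m q z\<bar> \<le> C / z\<^sup>2"
    using JJ_phi_small[OF q] by auto
  have D': "\<bar>JJ p q (phi m z) quadrant\<bar> \<le> D / z ^ 4" if "1 \<le> z" for z
  proof -
    have "D / z ^ 5 \<le> D / z ^ 4" using that D(1) by (intro divide_left_mono power_increasing) auto
    with D(2)[OF m that] show ?thesis by linarith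
  qed
  note * = hfint_eval[OF borel_measurable_JJ_phi C(2)[OF m, unfolded c] C(1) D' D(1) v]
  show "set_integrable lborel {0<..} (\<lambda>z. u z * of_real (g_reg (\<lambda>z. JJ p q (phi m z) quadrant) c4 c3 z))"
    by (rule *(1))
  show "hfint v = (LINT z:{0<..}|lborel. u z * of_real (g_reg (\<lambda>z. JJ p q (phi m z) quadrant) c4 c3 z)) - of_real c4 / (2 * s) + of_real c3 * L3"
    by (rule *(2))
qed

text \<open>In \<open>Rm 0\<close> the z^-3 parts are 8 pi/8 and -4 pi/4 and cancel, while the z^-4
  parts add up to exactly z^-4, which \<open>delta4\<close> removes. The difference is absolutely
  integrable; in the regularised integrals the terms with \<open>L3\<close> cancel likewise, and
  -1/(2s) is matched by the tail of z^-4.\<close>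

lemma bcoef_eq:
  assumes m: "m < M"
  shows "set_integrable lborel {0<..} (\<lambda>z. u z * of_real (Rm m z - delta4 m z))"
    and "bcoef (Phi m) M s = (LINT z:{0<..}|lborel. u z * of_real (Rm m z - delta4 m z))"
proof -
  define d where "d = (if m = 0 then 1 else 0 :: real)"
  define f where "f = (fact p :: real)"
  have f: "0 < f" by (simp add: f_def)
  define v0 where "v0 z = u z * of_real (integral {0..} (\<lambda>y. integral {0..} (\<lambda>x.
        bern_per p x * (deriv ^^ p) (\<lambda>x'. Phi m x' y z) x)))" for z
  define vp where "vp z = u z * of_real (integral {0..} (\<lambda>y. integral {0..} (\<lambda>x.
        bern_per p x * bern_per p y * (deriv ^^ p) (\<lambda>x'. (deriv ^^ p) (\<lambda>y'. Phi m x' y' z) y) x)))" for z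
  have v0: "v0 z = u z * of_real (JJ p 0 (phi m z) quadrant)" if z: "0 < z" for z
    using nested_phi[OF z m, of 0] Phi_derivs[OF z, of p 0 m] by (simp add: v0_def phi_def bern_snd_def)
  have vp: "vp z = u z * of_real (JJ p p (phi m z) quadrant)" if z: "0 < z" for z
    using nested_phi[OF z m, of p] Phi_derivs[OF z, of p p m] p_odd by (simp add: vp_def phi_def bern_snd_def)
  have s0: "sing m 0 z = 0 / z ^ 4 + (d * f * (pi / 8)) / z ^ 3" for z by (simp add: sing_def d_def f_def)
  have sp: "sing m p z = (d * f\<^sup>2 / 4) / z ^ 4 + (- (d * f\<^sup>2 * pi / 4)) / z ^ 3" for z
    using p_odd by (simp add: sing_def d_def f_def field_simps)
  define g0 where "g0 = g_reg (\<lambda>z. JJ p 0 (phi m z) quadrant) 0 (d * f * (pi / 8))"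
  define gp where "gp = g_reg (\<lambda>z. JJ p p (phi m z) quadrant) (d * f\<^sup>2 / 4) (- (d * f\<^sup>2 * pi / 4))"
  have q0: "(0::nat) = 0 \<or> 0 = p" and qp: "p = 0 \<or> p = p" by auto
  note h0 = hfint_phi[OF m q0 v0 s0, folded g0_def] and hp = hfint_phi[OF m qp vp sp, folded gp_def]
  have split: "complex_of_real (Rm m z - delta4 m z) = of_real (8 / f) * of_real (g0 z) + of_real (4 / f\<^sup>2) * of_real (gp z)
      - of_real d * (indicator {1<..} z *\<^sub>R of_real (1 / z ^ 4))" if "0 < z" for z
  proof -
    have "Rm m z - delta4 m z = 8 / f * g0 z + 4 / f\<^sup>2 * gp z - d * (indicator {1<..} z * (1 / z ^ 4))"
      using f by (auto simp: Rm_def delta4_def g0_def gp_def g_reg_def f_def[symmetric] d_def indicator_def field_simps power2_eq_square)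
    then show ?thesis by (simp add: scaleR_conv_of_real)
  qed
  have tail: "set_integrable lborel {0<..} (\<lambda>z. of_real d * (u z * (indicator {1<..} z *\<^sub>R of_real (1 / z ^ 4))))"
     "(LINT z:{0<..}|lborel. of_real d * (u z * (indicator {1<..} z *\<^sub>R of_real (1 / z ^ 4)))) = of_real d / (2 * s)"
  proof -
    have "(\<lambda>z. indicator {0<..} z *\<^sub>R (u z * (indicator {1<..} z *\<^sub>R of_real (1 / z ^ 4)))) = (\<lambda>z. indicator {1<..} z *\<^sub>R (u z * complex_of_real (1 / z ^ 4)))"
      by (auto simp: fun_eq_iff indicator_def)
    then have A: "set_integrable lborel {0<..} (\<lambda>z. u z * (indicator {1<..} z *\<^sub>R of_real (1 / z ^ 4)))"
      and B: "(LINT z:{0<..}|lborel. u z * (indicator {1<..} z *\<^sub>R of_real (1 / z ^ 4))) = 1 / (2 * s)"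
      using u_inverse_4_tail unfolding set_integrable_def set_lebesgue_integral_def by (simp_all only:)
    show "set_integrable lborel {0<..} (\<lambda>z. of_real d * (u z * (indicator {1<..} z *\<^sub>R of_real (1 / z ^ 4))))"
     "(LINT z:{0<..}|lborel. of_real d * (u z * (indicator {1<..} z *\<^sub>R of_real (1 / z ^ 4)))) = of_real d / (2 * s)"
      by (rule set_integrable_mult_right[OF A]) (simp only: set_integral_mult_right B, simp)
  qed
  have i0: "set_integrable lborel {0<..} (\<lambda>z. of_real (8 / f) * (u z * of_real (g0 z)))"
    and ip: "set_integrable lborel {0<..} (\<lambda>z. of_real (4 / f\<^sup>2) * (u z * of_real (gp z)))"
    using set_integrable_mult_right[OF h0(1)] set_integrable_mult_right[OF hp(1)] by auto
  define G where "G z = of_real (8 / f) * (u z * of_real (g0 z)) + of_real (4 / f\<^sup>2) * (u z * of_real (gp z))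
     - of_real d * (u z * (indicator {1<..} z *\<^sub>R of_real (1 / z ^ 4)))" for z
  have G: "u z * of_real (Rm m z - delta4 m z) = G z" if "0 < z" for z
    unfolding split[OF that] G_def by (simp add: algebra_simps)
  have iG: "set_integrable lborel {0<..} G" unfolding G_def[abs_def]
    by (intro set_integral_diff(1) set_integral_add(1) i0 ip tail(1))
  have eqG: "(\<lambda>z. indicator {0<..} z *\<^sub>R (u z * of_real (Rm m z - delta4 m z))) = (\<lambda>z. indicator {0<..} z *\<^sub>R G z)"
    using G by (auto simp: fun_eq_iff indicator_def)
  show "set_integrable lborel {0<..} (\<lambda>z. u z * of_real (Rm m z - delta4 m z))"
    using iG unfolding set_integrable_def eqG .
  have "(LINT z:{0<..}|lborel. u z * of_real (Rm m z - delta4 m z)) = (LINT z:{0<..}|lborel. G z)"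
    unfolding set_lebesgue_integral_def eqG ..
  also have "\<dots> = of_real (8 / f) * (LINT z:{0<..}|lborel. u z * of_real (g0 z)) + of_real (4 / f\<^sup>2) * (LINT z:{0<..}|lborel. u z * of_real (gp z)) - of_real d / (2 * s)"
    unfolding G_def[abs_def] set_integral_diff(2)[OF set_integral_add(1)[OF i0 ip] tail(1)] set_integral_add(2)[OF i0 ip] tail(2)
    by (simp only: set_integral_mult_right)
  also have "\<dots> = 4 / of_real (f\<^sup>2) * hfint vp + 8 / of_real f * hfint v0"
  proof -
    have f0: "complex_of_real f \<noteq> 0" and s0: "s \<noteq> 0" using f s by auto
    have H0: "hfint v0 = (LINT z:{0<..}|lborel. u z * of_real (g0 z)) - of_real 0 / (2 * s) + of_real (d * f * (pi / 8)) * L3"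
      by (rule h0(2))
    have Hp: "hfint vp = (LINT z:{0<..}|lborel. u z * of_real (gp z)) - of_real (d * f\<^sup>2 / 4) / (2 * s) + of_real (- (d * f\<^sup>2 * pi / 4)) * L3"
      by (rule hp(2))
    show ?thesis unfolding H0 Hp using f0 s0
      by (simp add: field_simps power2_eq_square)
  qed
  finally show "bcoef (Phi m) M s = (LINT z:{0<..}|lborel. u z * of_real (Rm m z - delta4 m z))"
    unfolding bcoef_eq_hfint[OF m] vp_def v0_def f_def by simp
qed

end

section \<open>Eigenvalues and scaling of the main term\<close>

context star
begin

definition lam :: "nat \<Rightarrow> nat \<Rightarrow> nat \<Rightarrow> real" where
  "lam n k1 k2 = (real n)\<^sup>2 / pi\<^sup>2 * (sin (pi * real k1 / real n))\<^sup>2 + (real n)\<^sup>2 / pi\<^sup>2 * (sin (pi * real k2 / real n))\<^sup>2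
     - \<kappa> * (1 / (real n)\<^sup>2 * (((real n)\<^sup>2 / pi\<^sup>2 * (sin (pi * real k1 / real n))\<^sup>2) * ((real n)\<^sup>2 / pi\<^sup>2 * (sin (pi * real k2 / real n))\<^sup>2)))"

definition zeta :: "nat \<Rightarrow> complex \<Rightarrow> complex" where
  "zeta n s = (\<Sum>k\<in>({0..<n} \<times> {0..<n}) - {(0,0)}. (complex_of_real (lam n (fst k) (snd k))) powr (- s))"

lemma Q_grid:
  assumes "0 < n"
  shows "Q (env x y (1 / (real n)\<^sup>2)) z = (real n)\<^sup>2 / pi\<^sup>2 * (sin (pi * x / real n))\<^sup>2 + (real n)\<^sup>2 / pi\<^sup>2 * (sin (pi * y / real n))\<^sup>2
     - \<kappa> * (1 / (real n)\<^sup>2 * (((real n)\<^sup>2 / pi\<^sup>2 * (sin (pi * x / real n))\<^sup>2) * ((real n)\<^sup>2 / pi\<^sup>2 * (sin (pi * y / real n))\<^sup>2))) + z\<^sup>2"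
  unfolding Q_def S_def env_simps S_grid[OF assms] by simp

lemma W_lattice:
  assumes "0 < n"
  shows "W 0 0 0 (real k1) (real k2) z (1 / (real n)\<^sup>2) = 1 / (lam n k1 k2 + z\<^sup>2)\<^sup>2"
  unfolding W_000 Q_grid[OF assms] lam_def by (simp add: inverse_eq_divide)

lemma lam_pos:
  assumes "k \<in> ({0..<n} \<times> {0..<n}) - {(0, 0)}"
  shows "0 < lam n (fst k) (snd k)"
proof -
  obtain k1 k2 where k: "k = (k1, k2)" "k1 < n" "k2 < n" "k1 \<noteq> 0 \<or> k2 \<noteq> 0" using assms by (cases k) auto
  have n: "0 < n" using k by auto
  define e where "e = 1 / (real n)\<^sup>2"
  have e: "0 \<le> e" by (simp add: e_def)
  have S: "S (env x y e) DX = (real n)\<^sup>2 / pi\<^sup>2 * (sin (pi * x / real n))\<^sup>2"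
    "S (env x y e) DY = (real n)\<^sup>2 / pi\<^sup>2 * (sin (pi * y / real n))\<^sup>2" for x y
    unfolding S_def env_simps e_def S_grid[OF n] by simp_all
  have sin: "0 < (real n)\<^sup>2 / pi\<^sup>2 * (sin (pi * real j / real n))\<^sup>2" if "j < n" "j \<noteq> 0" for j
  proof -
    have "0 < sin (pi * real j / real n)"
      using that n by (intro sin_gt_zero) (auto simp: field_simps)
    then show ?thesis using n by simp
  qed
  have "Q (env (real k1) (real k2) e) 0 = lam n k1 k2"
    unfolding e_def Q_grid[OF n] lam_def by simp
  moreover have "2 / 3 * (S (env (real k1) (real k2) e) DX + S (env (real k1) (real k2) e) DY) + 0\<^sup>2 \<le> Q (env (real k1) (real k2) e) 0"
    by (rule Q_lower_aux(1)[OF e])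
  moreover have "0 < S (env (real k1) (real k2) e) DX + S (env (real k1) (real k2) e) DY"
    using k(4)
  proof
    assume "k1 \<noteq> 0"
    with sin[of k1] k Q_lower_aux(3)[OF e, of "real k1" "real k2"] show ?thesis unfolding S(1) by linarith
  next
    assume "k2 \<noteq> 0"
    with sin[of k2] k Q_lower_aux(2)[OF e, of "real k1" "real k2"] show ?thesis unfolding S(2) by linarith
  qed
  ultimately show ?thesis unfolding k(1) fst_conv snd_conv by simp
qed

definition A_int :: "nat \<Rightarrow> real \<Rightarrow> real" where
  "A_int n z = integral {0..real n} (\<lambda>y. integral {0..real n} (\<lambda>x. W 0 0 0 x y z (1 / (real n)\<^sup>2)))"

text \<open>Scaling x, y, z by n at \<epsilon> = n^-2 multiplies Q by n^2: the integrand contributes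
  n^-4, the area n^2. Together with the n^(4-2s) of \<open>u_integral_scale\<close> this produces
  n^(2-2s).\<close>

lemma A_int_scale:
  assumes n: "0 < n" and z: "0 < z"
  shows "A_int n (real n * z) = A_int 1 z / (real n)\<^sup>2"
proof -
  have n0: "0 < real n" using n by simp
  have W: "W 0 0 0 x y (real n * z) (1 / (real n)\<^sup>2) = W 0 0 0 (x / real n) (y / real n) z (1 / (real 1)\<^sup>2) / real n ^ 4" for x y
  proof -
    have "Q (env x y (1 / (real n)\<^sup>2)) (real n * z) = (real n)\<^sup>2 * Q (env (x / real n) (y / real n) (1 / (real 1)\<^sup>2)) z"
      unfolding Q_grid[OF n] Q_grid[OF zero_less_one] using n0 by (simp add: power_mult_distrib field_simps power2_eq_square)
    then show ?thesis unfolding W_000 by (simp add: power_mult_distrib divide_inverse mult.commute flip: power_mult)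
  qed
  have "A_int n (real n * z) = integral {0..real n} (\<lambda>y. integral {0..real n} (\<lambda>x. W 0 0 0 (x / real n) (y / real n) z (1 / (real 1)\<^sup>2)) / real n ^ 4)"
    unfolding A_int_def W by simp
  also have "\<dots> = integral {0..real n} (\<lambda>y. (\<lambda>y. real n * integral {0..1} (\<lambda>x. W 0 0 0 x y z (1 / (real 1)\<^sup>2)) / real n ^ 4) (y / real n))"
    using integral_scale_unit[OF n0, of "\<lambda>x. W 0 0 0 x y z (1 / (real 1)\<^sup>2)" for y] by simp
  also have "\<dots> = real n * integral {0..1} (\<lambda>y. real n * integral {0..1} (\<lambda>x. W 0 0 0 x y z (1 / (real 1)\<^sup>2)) / real n ^ 4)"
    by (rule integral_scale_unit[OF n0])
  also have "\<dots> = A_int 1 z / (real n)\<^sup>2"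
    using n0 by (simp add: A_int_def field_simps eval_nat_numeral)
  finally show ?thesis .
qed

definition a_star :: "complex \<Rightarrow> complex" where
  "a_star s = integral {0<..} (\<lambda>z. (complex_of_real z) powr (3 - 2 * s) * complex_of_real (A_int 1 z))"

end

context asym
begin

definition Err :: "nat \<Rightarrow> real \<Rightarrow> real" where
  "Err n z = 8 / fact p * err 0 n z + 4 / (fact p)\<^sup>2 * err p n z"

text \<open>Euler-Maclaurin treats the full periodic sum; moving the term of the point 0 to the
  other side turns \<open>Rm\<close> into the integrable difference
  \<open>Rm m z - delta4 m z\<close>.\<close>

lemma lattice_sum:
  assumes n: "2 \<le> n" and z: "0 < z"
  shows "(\<Sum>k\<in>({0..<n} \<times> {0..<n}) - {(0,0)}. 1 / (lam n (fst k) (snd k) + z\<^sup>2)\<^sup>2)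
    = A_int n z + (\<Sum>m<M. (1 / (real n)\<^sup>2) ^ m * (Rm m z - delta4 m z)) + Err n z"
proof -
  define h where "h = 1 / (real n)\<^sup>2"
  have n0: "0 < n" and h0: "0 \<le> h" using n by (auto simp: h_def)
  have em: "(\<Sum>k2<n. \<Sum>k1<n. W 0 0 0 (real k1) (real k2) z h) = A_int n z + em_kernel p (lat_fam n z) (hbox n)"
    unfolding A_int_def h_def[symmetric]
  proof (rule periodic_em_2d)
    show "W i j 0 (real n) y z h = W i j 0 0 y z h" for i j y
      using W_periodic(1)[OF z n0, of i j 0 y] by (simp add: h_def)
    show "W i j 0 x (real n) z h = W i j 0 x 0 z h" for i j x
      using W_periodic(2)[OF z n0, of i j x 0] by (simp add: h_def)
    show "W i j 0 (real n - x) y z h = (- 1) ^ i * W i j 0 x y z h" for i j x y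
      unfolding h_def by (rule W_reflect(1)[OF z n0])
    show "W i j 0 x (real n - y) z h = (- 1) ^ j * W i j 0 x y z h" for i j x y
      unfolding h_def by (rule W_reflect(2)[OF z n0])
  qed (use z h0 p_odd in \<open>auto intro!: W_derivative W_swap continuous_intros\<close>)
  have kernel: "em_kernel p (lat_fam n z) (hbox n) = (\<Sum>m<M. h ^ m * Rm m z) + Err n z"
  proof -
    have "JJ p q (lat_fam n z) (hbox n) = err q n z + (\<Sum>m<M. h ^ m * JJ p q (phi m z) quadrant)" for q
      by (simp add: err_def h_def)
    then show ?thesis
      unfolding em_kernel_def J1_eq_JJ J2_eq_JJ[OF p_odd(3)] Err_def Rm_def
      by (simp add: distrib_left sum.distrib sum_distrib_left mult_ac)
  qed
  have "(\<Sum>k\<in>{0..<n} \<times> {0..<n}. 1 / (lam n (fst k) (snd k) + z\<^sup>2)\<^sup>2) = (\<Sum>k2<n. \<Sum>k1<n. W 0 0 0 (real k1) (real k2) z h)"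
    unfolding h_def W_lattice[OF n0] by (subst sum.swap) (simp add: sum.cartesian_product lessThan_atLeast0 case_prod_beta)
  moreover have "(\<Sum>k\<in>{0..<n} \<times> {0..<n}. 1 / (lam n (fst k) (snd k) + z\<^sup>2)\<^sup>2)
     = 1 / (lam n 0 0 + z\<^sup>2)\<^sup>2 + (\<Sum>k\<in>({0..<n} \<times> {0..<n}) - {(0,0)}. 1 / (lam n (fst k) (snd k) + z\<^sup>2)\<^sup>2)"
    using n0 by (subst sum.remove[of _ "(0, 0)"]) auto
  moreover have "1 / (lam n 0 0 + z\<^sup>2)\<^sup>2 = 1 / z ^ 4"
    by (simp add: lam_def flip: power_mult)
  moreover have "(\<Sum>m<M. h ^ m * delta4 m z) = 1 / z ^ 4"
  proof -
    have "(\<Sum>m<M. h ^ m * delta4 m z) = (\<Sum>m<M. if m = 0 then 1 / z ^ 4 else 0)"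
      by (intro sum.cong) (auto simp: delta4_def)
    then show ?thesis using M by simp
  qed
  ultimately show ?thesis using em kernel unfolding h_def[symmetric]
    by (simp add: right_diff_distrib sum_subtractf)
qed

lemma Err_integral_bound:
  "\<exists>C\<ge>0. \<forall>n\<ge>2. set_integrable lborel {0<..} (\<lambda>z. u z * of_real (Err n z)) \<and>
     norm (LINT z:{0<..}|lborel. u z * of_real (Err n z)) \<le> C * (1 / (real n)\<^sup>2) ^ M * real n powr (2 - 2 * Re s)"
proof -
  obtain C0 where C0: "0 \<le> C0" "\<And>n z. 2 \<le> n \<Longrightarrow> 0 < z \<Longrightarrow> \<bar>err 0 n z\<bar> \<le> C0 * (1 / (real n)\<^sup>2) ^ M / z\<^sup>2"
    "\<And>n z. 2 \<le> n \<Longrightarrow> 0 < z \<Longrightarrow> real n \<le> z \<Longrightarrow> \<bar>err 0 n z\<bar> \<le> C0 * (1 / (real n)\<^sup>2) ^ M * (real n)\<^sup>2 / z ^ 4"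
    using err_bound[of 0] by blast
  obtain C1 where C1: "0 \<le> C1" "\<And>n z. 2 \<le> n \<Longrightarrow> 0 < z \<Longrightarrow> \<bar>err p n z\<bar> \<le> C1 * (1 / (real n)\<^sup>2) ^ M / z\<^sup>2"
    "\<And>n z. 2 \<le> n \<Longrightarrow> 0 < z \<Longrightarrow> real n \<le> z \<Longrightarrow> \<bar>err p n z\<bar> \<le> C1 * (1 / (real n)\<^sup>2) ^ M * (real n)\<^sup>2 / z ^ 4"
    using err_bound[of p] by blast
  define B where "B = 8 / fact p * C0 + 4 / (fact p)\<^sup>2 * C1"
  have B: "0 \<le> B" using C0(1) C1(1) by (simp add: B_def)
  have comb: "\<bar>8 / fact p * a + 4 / (fact p)\<^sup>2 * b\<bar> \<le> B * t" if "\<bar>a\<bar> \<le> C0 * t" "\<bar>b\<bar> \<le> C1 * t" for a b t :: real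
  proof -
    have "\<bar>8 / fact p * a + 4 / (fact p)\<^sup>2 * b\<bar> \<le> 8 / fact p * \<bar>a\<bar> + 4 / (fact p)\<^sup>2 * \<bar>b\<bar>"
      by (rule order_trans[OF abs_triangle_ineq]) (simp add: abs_mult)
    also have "\<dots> \<le> 8 / fact p * (C0 * t) + 4 / (fact p)\<^sup>2 * (C1 * t)"
      using that by (intro add_mono mult_left_mono) auto
    finally show ?thesis by (simp add: B_def algebra_simps)
  qed
  \<comment> \<open>The two summands come from integrating z^(1 - 2 Re s) up to n and n^2 z^(-1 - 2
    Re s) beyond n; both carry the power n^(2 - 2 Re s).\<close>
  define K where "K = B * (1 / (2 - 2 * Re s) + 1 / (2 * Re s))"
  have "set_integrable lborel {0<..} (\<lambda>z. u z * of_real (Err n z)) \<and>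
     norm (LINT z:{0<..}|lborel. u z * of_real (Err n z)) \<le> K * (1 / (real n)\<^sup>2) ^ M * real n powr (2 - 2 * Re s)" if n: "2 \<le> n" for n
  proof -
    define h where "h = (1 / (real n)\<^sup>2) ^ M"
    have h: "0 < h" and n0: "0 < real n" using n by (auto simp: h_def)
    have m: "Err n \<in> borel_measurable borel" unfolding Err_def[abs_def] using borel_measurable_err by measurable
    have 1: "\<bar>Err n z\<bar> \<le> B * h / z\<^sup>2" if "0 < z" for z
      unfolding Err_def using comb[of "err 0 n z" "h / z\<^sup>2" "err p n z"] C0(2)[OF n that] C1(2)[OF n that] by (simp add: h_def)
    have 2: "\<bar>Err n z\<bar> \<le> B * h * (real n)\<^sup>2 / z ^ 4" if "real n < z" for z
    proof -
      have "0 < z" "real n \<le> z" using that n0 by auto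
      then show ?thesis
        unfolding Err_def using comb[of "err 0 n z" "h * (real n)\<^sup>2 / z ^ 4" "err p n z"] C0(3)[OF n] C1(3)[OF n] by (simp add: h_def mult.assoc)
    qed
    have nn: "0 \<le> B * h" "0 \<le> B * h * (real n)\<^sup>2" using B h by auto
    note I = u_integrable[OF n0 m 1 nn(1) 2 nn(2)]
    have "(real n)\<^sup>2 * real n powr (- 2 * Re s) = real n powr (2 - 2 * Re s)"
      using n0 powr_add[of "real n" 2 "- 2 * Re s"] by simp
    then have "B * h * (real n powr (2 - 2 * Re s) / (2 - 2 * Re s)) + B * h * (real n)\<^sup>2 * (real n powr (- 2 * Re s) / (2 * Re s))
       = K * h * real n powr (2 - 2 * Re s)"
      unfolding K_def by (simp only: mult.assoc times_divide_eq_right) (simp add: algebra_simps)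
    with I(1,3) show ?thesis by (simp add: h_def)
  qed
  moreover have "0 \<le> K" using B s by (simp add: K_def)
  ultimately show ?thesis by blast
qed

text \<open>\<open>lattice_sum\<close> integrated against z^(3-2s). Integrability of the main term
  is read off from this equation, as every other term in it is already known to be
  integrable.\<close>

lemma zeta_identity:
  assumes n: "2 \<le> n" and iE: "set_integrable lborel {0<..} (\<lambda>z. u z * of_real (Err n z))"
  shows "zeta n s - V2 s * (a_star s * (of_nat n) powr (2 - 2 * s)
     + (\<Sum>m<M. bcoef (Phi m) M s * (of_nat n) powr (- 2 * of_nat m))) = V2 s * (LINT z:{0<..}|lborel. u z * of_real (Err n z))"
proof -
  define I where "I = ({0..<n} \<times> {0..<n}) - {(0::nat,0::nat)}"
  define h where "h = 1 / (real n)\<^sup>2"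
  have n0: "0 < real n" "0 < n" using n by auto
  have fin: "finite I" by (simp add: I_def)
  have iL: "set_integrable lborel {0<..} (\<lambda>z. u z * of_real (1 / (lam n (fst k) (snd k) + z\<^sup>2)\<^sup>2))" if "k \<in> I" for k
    using that lam_pos[of k n] by (intro u_rational_integrable) (simp add: I_def)
  define L where "L z = (\<Sum>k\<in>I. u z * of_real (1 / (lam n (fst k) (snd k) + z\<^sup>2)\<^sup>2))" for z
  define R where "R z = (\<Sum>m<M. of_real (h ^ m) * (u z * of_real (Rm m z - delta4 m z)))" for z
  define E where "E z = u z * of_real (Err n z)" for z
  have iL': "set_integrable lborel {0<..} L"
    unfolding L_def set_integrable_def scaleR_sum_right
    by (intro Bochner_Integration.integrable_sum) (use iL in \<open>auto simp: set_integrable_def\<close>)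
  have VL: "V2 s * (LINT z:{0<..}|lborel. L z) = zeta n s"
  proof -
    have "(LINT z:{0<..}|lborel. L z) = (\<Sum>k\<in>I. LINT z:{0<..}|lborel. u z * of_real (1 / (lam n (fst k) (snd k) + z\<^sup>2)\<^sup>2))"
      unfolding L_def set_lebesgue_integral_def scaleR_sum_right
      by (intro Bochner_Integration.integral_sum) (use iL in \<open>auto simp: set_integrable_def\<close>)
    then have "V2 s * (LINT z:{0<..}|lborel. L z) = (\<Sum>k\<in>I. V2 s * (LINT z:{0<..}|lborel. u z * of_real (1 / (lam n (fst k) (snd k) + z\<^sup>2)\<^sup>2)))"
      by (simp only: sum_distrib_left)
    also have "\<dots> = (\<Sum>k\<in>I. complex_of_real (lam n (fst k) (snd k)) powr (- s))"
      by (intro sum.cong refl u_rational lam_pos) (simp add: I_def)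
    finally show ?thesis by (simp add: zeta_def I_def)
  qed
  have iR: "set_integrable lborel {0<..} R"
    unfolding R_def set_integrable_def scaleR_sum_right
    by (intro Bochner_Integration.integrable_sum set_integrable_mult_right[OF bcoef_eq(1), unfolded set_integrable_def]) auto
  have R: "(LINT z:{0<..}|lborel. R z) = (\<Sum>m<M. of_real (h ^ m) * bcoef (Phi m) M s)"
  proof -
    have "(LINT z:{0<..}|lborel. R z) = (\<Sum>m<M. LINT z:{0<..}|lborel. of_real (h ^ m) * (u z * of_real (Rm m z - delta4 m z)))"
      unfolding R_def set_lebesgue_integral_def scaleR_sum_right
      by (intro Bochner_Integration.integral_sum set_integrable_mult_right[OF bcoef_eq(1), unfolded set_integrable_def]) auto
    also have "\<dots> = (\<Sum>m<M. of_real (h ^ m) * bcoef (Phi m) M s)"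
      by (intro sum.cong refl) (simp only: set_integral_mult_right bcoef_eq(2) lessThan_iff)
    finally show ?thesis .
  qed
  have A: "u z * of_real (A_int n z) = L z - R z - E z" if z: "0 < z" for z
  proof -
    have "A_int n z = (\<Sum>k\<in>I. 1 / (lam n (fst k) (snd k) + z\<^sup>2)\<^sup>2) - (\<Sum>m<M. h ^ m * (Rm m z - delta4 m z)) - Err n z"
      using lattice_sum[OF n z] by (simp add: I_def h_def)
    then have "u z * of_real (A_int n z) = u z * ((\<Sum>k\<in>I. of_real (1 / (lam n (fst k) (snd k) + z\<^sup>2)\<^sup>2)) - (\<Sum>m<M. of_real (h ^ m) * of_real (Rm m z - delta4 m z)) - of_real (Err n z))"
      by (simp only: of_real_diff of_real_sum of_real_mult)
    then show ?thesis unfolding L_def R_def E_def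
      by (simp only: right_diff_distrib sum_distrib_left mult.left_commute)
  qed
  have eqA: "(\<lambda>z. indicator {0<..} z *\<^sub>R (u z * of_real (A_int n z))) = (\<lambda>z. indicator {0<..} z *\<^sub>R (L z - R z - E z))"
    using A by (auto simp: fun_eq_iff indicator_def)
  have iE': "set_integrable lborel {0<..} E" unfolding E_def by (rule iE)
  have iA: "set_integrable lborel {0<..} (\<lambda>z. u z * of_real (A_int n z))"
    using set_integral_diff(1)[OF set_integral_diff(1)[OF iL' iR] iE'] unfolding set_integrable_def eqA .
  have A_eq: "(LINT z:{0<..}|lborel. u z * of_real (A_int n z)) = (LINT z:{0<..}|lborel. L z) - (LINT z:{0<..}|lborel. R z) - (LINT z:{0<..}|lborel. E z)"
    using set_integral_diff(2)[OF set_integral_diff(1)[OF iL' iR] iE'] set_integral_diff(2)[OF iL' iR]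
    unfolding set_lebesgue_integral_def eqA by simp
  have scaled: "(LINT z:{0<..}|lborel. u z * of_real (A_int n z)) = of_nat n powr (2 - 2 * s) * a_star s"
  proof -
    have eq1: "(\<lambda>z. indicator {0<..} z *\<^sub>R (u z * of_real (A_int n (real n * z)))) = (\<lambda>z. of_real (1 / (real n)\<^sup>2) * (indicator {0<..} z *\<^sub>R (u z * of_real (A_int 1 z))))"
      using A_int_scale[OF n0(2)] by (auto simp: fun_eq_iff indicator_def)
    \<comment> \<open>Integrability passes from period n to period 1 by scaling. It identifies the
      gauge integral in \<open>a_star\<close> with the Lebesgue integral.\<close>
    have "set_integrable lborel {0<..} (\<lambda>z. u z * of_real (A_int n (real n * z)))"
      using iA u_integral_scale(2)[OF n0(1), of "\<lambda>z. of_real (A_int n z)"] by simp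
    then have "integrable lborel (\<lambda>z. of_real ((real n)\<^sup>2) * (of_real (1 / (real n)\<^sup>2) * (indicator {0<..} z *\<^sub>R (u z * complex_of_real (A_int 1 z)))))"
      unfolding set_integrable_def eq1 by (rule integrable_mult_right)
    then have i1: "set_integrable lborel {0<..} (\<lambda>z. u z * of_real (A_int 1 z))"
      using n0 by (simp add: set_integrable_def)
    have a: "(LINT z:{0<..}|lborel. u z * of_real (A_int 1 z)) = a_star s"
      using set_borel_integral_eq_integral(2)[OF i1] by (simp add: a_star_def u_def)
    have "(LINT z:{0<..}|lborel. u z * of_real (A_int n z)) = of_real (real n) powr (4 - 2 * s) * (LINT z:{0<..}|lborel. u z * of_real (A_int n (real n * z)))"
      by (rule u_integral_scale(1)[OF n0(1)])
    also have "(LINT z:{0<..}|lborel. u z * of_real (A_int n (real n * z))) = of_real (1 / (real n)\<^sup>2) * a_star s"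
      unfolding set_lebesgue_integral_def eq1 integral_mult_right_zero a[symmetric] ..
    also have "of_real (real n) powr (4 - 2 * s) * (of_real (1 / (real n)\<^sup>2) * a_star s) = of_nat n powr (2 - 2 * s) * a_star s"
    proof -
      have "complex_of_real (real n) powr (4 - 2 * s) = of_real (real n) powr ((2 - 2 * s) + of_nat 2)" by simp
      also have "\<dots> = of_real (real n) powr (2 - 2 * s) * of_real (real n) ^ 2"
        using n0 by (subst powr_add, subst powr_nat') auto
      finally show ?thesis using n0 by simp
    qed
    finally show ?thesis .
  qed
  have hm: "complex_of_real (h ^ m) = of_nat n powr (- 2 * of_nat m)" for m
  proof -
    have "complex_of_nat n powr (- 2 * of_nat m) = inverse (of_nat n powr of_nat (2 * m))"
      by (simp add: powr_minus[symmetric])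
    also have "\<dots> = inverse (of_nat n ^ (2 * m))" using n0 by (subst powr_nat') auto
    finally show ?thesis by (simp add: h_def power_mult power_one_over inverse_eq_divide)
  qed
  have "V2 s * (LINT z:{0<..}|lborel. L z) = V2 s * ((of_nat n powr (2 - 2 * s) * a_star s) + (\<Sum>m<M. of_real (h ^ m) * bcoef (Phi m) M s) + (LINT z:{0<..}|lborel. E z))"
    using A_eq unfolding scaled R by (simp add: algebra_simps)
  then show ?thesis unfolding VL hm E_def by (simp add: algebra_simps)
qed

lemma zeta_asymptotics:
  "(\<lambda>n. zeta n s - V2 s * (a_star s * (of_nat n) powr (2 - 2 * s)
     + (\<Sum>m<M. bcoef (Phi m) M s * (of_nat n) powr (- 2 * of_nat m)))) \<in> O(\<lambda>n. (of_nat n) powr (- 2 * of_nat M - 2 * s + 2))"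
proof -
  obtain C where C: "0 \<le> C" "\<And>n. 2 \<le> n \<Longrightarrow> set_integrable lborel {0<..} (\<lambda>z. u z * of_real (Err n z))"
     "\<And>n. 2 \<le> n \<Longrightarrow> norm (LINT z:{0<..}|lborel. u z * of_real (Err n z)) \<le> C * (1 / (real n)\<^sup>2) ^ M * real n powr (2 - 2 * Re s)"
    using Err_integral_bound by blast
  show ?thesis
  proof (rule bigoI[of _ "norm (V2 s) * C"], rule eventually_mono[OF eventually_ge_at_top[of 2]])
    fix n :: nat assume n: "2 \<le> n"
    have n0: "0 < real n" using n by simp
    have "(1 / (real n)\<^sup>2) ^ M = real n powr (- 2 * real M)"
    proof -
      have "real n powr (- 2 * real M) = inverse (real n powr real (2 * M))" by (simp add: powr_minus[symmetric])
      also have "\<dots> = inverse (real n ^ (2 * M))" using n0 by (subst powr_realpow) auto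
      finally show ?thesis by (simp add: power_mult power_one_over inverse_eq_divide)
    qed
    then have "(1 / (real n)\<^sup>2) ^ M * real n powr (2 - 2 * Re s) = real n powr (- 2 * real M + (2 - 2 * Re s))"
      by (simp only: powr_add)
    also have "\<dots> = norm (complex_of_nat n powr (- 2 * of_nat M - 2 * s + 2))"
      using n0 norm_powr_real_powr[of "of_nat n" "- 2 * of_nat M - 2 * s + 2"] by (simp add: algebra_simps)
    finally have eq: "(1 / (real n)\<^sup>2) ^ M * real n powr (2 - 2 * Re s) = norm (complex_of_nat n powr (- 2 * of_nat M - 2 * s + 2))" .
    have "norm (V2 s) * norm (LINT z:{0<..}|lborel. u z * of_real (Err n z)) \<le> norm (V2 s) * (C * ((1 / (real n)\<^sup>2) ^ M * real n powr (2 - 2 * Re s)))"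
      using C(3)[OF n] by (intro mult_left_mono) (auto simp: mult.assoc)
    then show "norm (zeta n s - V2 s * (a_star s * (of_nat n) powr (2 - 2 * s)
       + (\<Sum>m<M. bcoef (Phi m) M s * (of_nat n) powr (- 2 * of_nat m)))) \<le> norm (V2 s) * C * norm (complex_of_nat n powr (- 2 * of_nat M - 2 * s + 2))"
      unfolding zeta_identity[OF n C(2)[OF n]] norm_mult eq by (simp only: mult.assoc)
  qed
qed

end

text \<open>For M = 0 the expansion with M = 1 is weakened: its only coefficient term is constant in
  n, hence O(n^(2-2s)) because Re s < 1, and its error is smaller still.\<close>

lemma star_zeta_asymptotics:
  assumes \<kappa>: "0 \<le> \<kappa>" "\<kappa> \<le> 2 * pi\<^sup>2 / 3" and s: "0 < Re s" "Re s < 1"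
  shows "(\<lambda>n. star.zeta \<kappa> n s - V2 s * (star.a_star \<kappa> s * (of_nat n) powr (2 - 2 * s)
     + (\<Sum>m<M. bcoef (star.Phi \<kappa> m) M s * (of_nat n) powr (- 2 * of_nat m)))) \<in> O(\<lambda>n. (of_nat n) powr (- 2 * of_nat M - 2 * s + 2))"
proof (cases "M = 0")
  case False
  interpret asym \<kappa> M "2 * M + 1" s
    by unfold_locales (use assms False in auto)
  show ?thesis by (rule zeta_asymptotics)
next
  case True
  interpret asym \<kappa> 1 3 s
    by unfold_locales (use assms in auto)
  define b where "b = V2 s * bcoef (Phi 0) 1 s"
  have "(\<lambda>n. zeta n s - V2 s * (a_star s * (of_nat n) powr (2 - 2 * s) + (\<Sum>m<1. bcoef (Phi m) 1 s * (of_nat n) powr (- 2 * of_nat m))))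
     \<in> O(\<lambda>n. (of_nat n) powr (- 2 * of_nat 1 - 2 * s + 2))"
    by (rule zeta_asymptotics)
  also have "(\<lambda>n. (of_nat n :: complex) powr (- 2 * of_nat 1 - 2 * s + 2)) \<in> O(\<lambda>n. (of_nat n) powr (2 - 2 * s))"
  proof (rule bigoI[of _ 1], rule eventually_mono[OF eventually_ge_at_top[of 1]])
    fix n :: nat assume "1 \<le> n"
    then show "norm ((of_nat n :: complex) powr (- 2 * of_nat 1 - 2 * s + 2)) \<le> 1 * norm ((of_nat n :: complex) powr (2 - 2 * s))"
      by (simp add: norm_powr_real_powr powr_mono)
  qed
  finally have 1: "(\<lambda>n. zeta n s - V2 s * (a_star s * (of_nat n) powr (2 - 2 * s) + (\<Sum>m<1. bcoef (Phi m) 1 s * (of_nat n) powr (- 2 * of_nat m))))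
     \<in> O(\<lambda>n. (of_nat n) powr (2 - 2 * s))" .
  have 2: "(\<lambda>n::nat. b * of_nat n powr (- 2 * of_nat 0)) \<in> O(\<lambda>n. (of_nat n) powr (2 - 2 * s))"
  proof (rule bigoI[of _ "norm b"], rule eventually_mono[OF eventually_ge_at_top[of 1]])
    fix n :: nat assume n: "1 \<le> n"
    have "1 \<le> real n powr (2 - 2 * Re s)" using n s by (intro ge_one_powr_ge_zero) auto
    then have "norm b * 1 \<le> norm b * real n powr (2 - 2 * Re s)" by (intro mult_left_mono) auto
    then show "norm (b * of_nat n powr (- 2 * of_nat 0)) \<le> norm b * norm ((of_nat n :: complex) powr (2 - 2 * s))"
      using n by (simp add: norm_powr_real_powr norm_mult)
  qed
  from sum_in_bigo(1)[OF 1 2] show ?thesis using True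
    by (simp add: b_def algebra_simps)
qed

theorem theorem3p5:
  fixes s :: complex and M :: nat
  assumes "0 < Re s" and "Re s < 1"
  shows "((\<lambda>n::nat. zeta5 n s - V2 s * (a5 s * (of_nat n) powr (2 - 2 * s)
             + (\<Sum>m<M. b5 M m s * (of_nat n) powr (- 2 * of_nat m))))
           \<in> O(\<lambda>n. (of_nat n) powr (- 2 * of_nat M - 2 * s + 2)))
    \<and> ((\<lambda>n::nat. zeta9 n s - V2 s * (a9 s * (of_nat n) powr (2 - 2 * s)
             + (\<Sum>m<M. b9 M m s * (of_nat n) powr (- 2 * of_nat m))))
           \<in> O(\<lambda>n. (of_nat n) powr (- 2 * of_nat M - 2 * s + 2)))"
proof -
  interpret five: star 0 by unfold_locales auto
  interpret nine: star "2 * pi\<^sup>2 / 3" by unfold_locales auto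
  have "lam5 n k1 k2 = five.lam n k1 k2" for n k1 k2
    by (simp add: lam5_def five.lam_def algebra_simps)
  then have zeta5: "zeta5 n s = five.zeta n s" for n
    by (simp add: zeta5_def five.zeta_def)
  \<comment> \<open>The product of the two terms n^2 sin^2 is divided by n^2, which asks for n > 0;
    for n = 0 the index set of the sum is empty.\<close>
  have "lam9 n k1 k2 = nine.lam n k1 k2" if "0 < n" for n k1 k2
    using that unfolding lam9_def lam5_def nine.lam_def by (simp add: field_simps power2_eq_square)
  then have zeta9: "zeta9 n s = nine.zeta n s" for n
    unfolding zeta9_def nine.zeta_def by (intro sum.cong) auto
  have "Phi5 m = five.Phi m" for m
    by (rule ext)+ (simp add: Phi5_def five.Phi_def G5_def[abs_def])
  then have b5: "b5 M m s = bcoef (five.Phi m) M s" for m by (simp add: b5_def)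
  have "Phi9 m = nine.Phi m" for m
    by (rule ext)+ (simp add: Phi9_def nine.Phi_def G9_def[abs_def])
  then have b9: "b9 M m s = bcoef (nine.Phi m) M s" for m by (simp add: b9_def)
  have "five.A_int 1 z = integral {0..1} (\<lambda>y. integral {0..1} (\<lambda>x.
       inverse (((sin (pi * x))^2 / pi^2 + (sin (pi * y))^2 / pi^2 + z^2)^2)))" for z
    unfolding five.A_int_def five.W_000 five.Q_grid[OF zero_less_one] by simp
  then have a5: "a5 s = five.a_star s" by (simp add: a5_def five.a_star_def)
  have "nine.A_int 1 z = integral {0..1} (\<lambda>y. integral {0..1} (\<lambda>x.
       inverse (((sin (pi * x))^2 / pi^2 + (sin (pi * y))^2 / pi^2
                 - 2 / (3 * pi^2) * (sin (pi * x))^2 * (sin (pi * y))^2 + z^2)^2)))" for z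
  proof -
    have "2 * pi\<^sup>2 / 3 * (1 / (real 1)\<^sup>2 * ((real 1)\<^sup>2 / pi\<^sup>2 * a * ((real 1)\<^sup>2 / pi\<^sup>2 * b))) = 2 / (3 * pi\<^sup>2) * a * b" for a b
      by (simp add: field_simps power2_eq_square)
    then show ?thesis unfolding nine.A_int_def nine.W_000 nine.Q_grid[OF zero_less_one] by simp
  qed
  then have a9: "a9 s = nine.a_star s" by (simp add: a9_def nine.a_star_def)
  show ?thesis
    unfolding zeta5 zeta9 b5 b9 a5 a9
    using star_zeta_asymptotics[OF five.kappa assms, of M] star_zeta_asymptotics[OF nine.kappa assms, of M]
    by (rule conjI)
qed

end
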